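(* The Poincaré series $P_{V,0}(t)$ of the arc filtration of isolated surface singularities $(V,0)\subset(\mathbb{C}^3,0)$ are given by the following list. (i) For the stabilizations $\{f(x,y)-z^2=0\}$ of the (reduced) plane curve singularities $\{f=0\}\subset(\mathbb{C}^2,0)$ with non-zero $3$-jet except the simple ones, i.e., $J_{k,i}$ ($i\ge0$), $E_{6k}$, $E_{6k+1}$, and $E_{6k+2}$ (in all cases $k\ge2$), we have $$P_{V,0}(t)=\frac{1-t^6}{(1-t)(1-t^2)(1-t^3)}.$$ (ii) For the stabilizations $\{f(x,y)-z^2=0\}$ of the (reduced) plane curve singularities $\{f=0\}\subset(\mathbb{C}^2,0)$ with zero $3$-jet and non-zero $4$-jet, i.e., for those of Arnold's classes $\mathbf{X}$, $\mathbf{Y}$, $\mathbf{Z}$, and $\mathbf{W}$, we have $$P_{V,0}(t)=\frac{1-t^4}{(1-t)^2(1-t^2)}.$$ (iii) For the singularities $(V,0)=\{f(x,y,z)=0\}$ of multiplicity $3$ with a reduced $3$-jet, i.e., for those of Arnold's series $\mathbf{Q}$, $\mathbf{S}$, and $\mathbf{U}$, we have $$P_{V,0}(t)=\frac{1-t^3}{(1-t)^3}.$$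
   Context: Arc filtration. For a germ $(V,0)$ of a complex analytic variety, $\mathcal{O}_{V,0}$ is the ring of germs of holomorphic functions on $(V,0)$. An arc on $(V,0)$ is a germ of a complex analytic mapping $\phi:(\mathbb{C},0)\to(V,0)$. For $g\in\mathcal{O}_{V,0}$, $v_\phi(g)\in\mathbb{Z}_{\ge0}\cup\{+\infty\}$ is the order of vanishing at the origin of $g\circ\phi$ ($+\infty$ if $g\circ\phi\equiv0$), and $v(g)=\min_\phi v_\phi(g)$ over all arcs $\phi$ on $(V,0)$. The arc filtration is given by the ideals $F_i=\{g\in\mathcal{O}_{V,0}: v(g)\ge i\}$, $i\ge0$, and its Poincaré series is $P_{V,0}(t)=\sum_{i\ge0}\dim_{\mathbb{C}}(F_i/F_{i+1})\,t^i$. Terminology. A plane curve singularity is a reduced germ $\{f=0\}$ with $f\in\mathfrak{m}^2$, $\mathfrak{m}$ the maximal ideal of $\mathcal{O}_{\mathbb{C}^2,0}$. The $k$-jet of $f$ is its Taylor polynomial of degree $k$ at the origin. A plane curve singularity is simple if, in suitable local analytic coordinates and up to multiplication of $f$ by an invertible germ, $f$ is one of: $x^2+y^{k+1}$ ($A_k$, $k\ge1$), $x^2y+y^{k-1}$ ($D_k$, $k\ge4$), $x^3+y^4$ ($E_6$), $x^3+xy^3$ ($E_7$), $x^3+y^5$ ($E_8$). Thus (i) concerns the non-simple plane curve singularities of multiplicity $3$ and (ii) those of multiplicity $4$. In (iii), $f\in\mathcal{O}_{\mathbb{C}^3,0}$ has zero $2$-jet, and its $3$-jet is a non-zero homogeneous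 cubic polynomial in $x,y,z$ without multiple irreducible factors. The symbols $J_{k,i}$, $E_{6k}$, $E_{6k+1}$, $E_{6k+2}$, $\mathbf{X}$, $\mathbf{Y}$, $\mathbf{Z}$, $\mathbf{W}$, $\mathbf{Q}$, $\mathbf{S}$, $\mathbf{U}$ are the names of classes and series in V. I. Arnold's classification of singularities of functions (Arnold, Gusein-Zade, Varchenko, Singularities of Differentiable Maps, Vol. I); there, the series $\mathbf{Q}$, $\mathbf{S}$, $\mathbf{U}$ consist of germs whose $3$-jet is, in suitable coordinates, $x^3+yz^2$, $x^2z+yz^2$, $x^3+xz^2$ respectively. *)

theory Defs
  imports
    "HOL-Complex_Analysis.Complex_Analysis"
    "HOL-Computational_Algebra.Computational_Algebra"
    "HOL-Library.Extended_Nat"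
begin

(* Function germs at 0 are represented by total functions on C^n; only the values near 0 matter,
   and equality of germs is equality for all x in a neighbourhood of 0. *)

definition hol_germ :: "(complex ^ 'n \<Rightarrow> complex) \<Rightarrow> bool" where
  "hol_germ f \<longleftrightarrow>
     (\<forall>\<^sub>F x in nhds 0. \<exists>D. (f has_derivative D) (at x) \<and> (\<forall>c v. D (c *s v) = c * D v))"

definition hol_map_germ :: "(complex ^ 'n \<Rightarrow> complex ^ 'm) \<Rightarrow> bool" where
  "hol_map_germ \<Phi> \<longleftrightarrow> (\<forall>i. hol_germ (\<lambda>x. \<Phi> x $ i))"

definition max_ideal :: "(complex ^ 'n \<Rightarrow> complex) set" where
  "max_ideal = {a. hol_germ a \<and> a 0 = 0}"

definition max_ideal_square :: "(complex ^ 'n \<Rightarrow> complex) set" where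
  "max_ideal_square = {f. hol_germ f \<and>
     (\<exists>(N::nat) a b. (\<forall>j<N. a j \<in> max_ideal \<and> b j \<in> max_ideal) \<and>
        (\<forall>\<^sub>F x in nhds 0. f x = (\<Sum>j<N. a j x * b j x)))}"

(* The summand for j is the homogeneous part of degree j of the Taylor series of f at 0. *)
definition jet :: "nat \<Rightarrow> (complex ^ 'n \<Rightarrow> complex) \<Rightarrow> complex ^ 'n \<Rightarrow> complex" where
  "jet k f = (\<lambda>x. \<Sum>j\<le>k. (deriv ^^ j) (\<lambda>t. f (t *s x)) 0 / fact j)"

(* f has no multiple factor in the ring of germs: if h^2 divides f then h is a unit.
   In particular f is not the zero germ. *)
definition reduced_germ :: "(complex ^ 'n \<Rightarrow> complex) \<Rightarrow> bool" where
  "reduced_germ f \<longleftrightarrow>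
     (\<forall>h k. hol_germ h \<and> hol_germ k \<and> (\<forall>\<^sub>F x in nhds 0. f x = (h x)\<^sup>2 * k x) \<longrightarrow> h 0 \<noteq> 0)"

definition plane_curve_singularity :: "(complex ^ 2 \<Rightarrow> complex) \<Rightarrow> bool" where
  "plane_curve_singularity f \<longleftrightarrow> hol_germ f \<and> f \<in> max_ideal_square \<and> reduced_germ f"

definition coordinate_change :: "(complex ^ 'n \<Rightarrow> complex ^ 'n) \<Rightarrow> bool" where
  "coordinate_change \<Phi> \<longleftrightarrow> hol_map_germ \<Phi> \<and> \<Phi> 0 = 0 \<and>
     (\<exists>\<Psi>. hol_map_germ \<Psi> \<and> \<Psi> 0 = 0 \<and> (\<forall>\<^sub>F x in nhds 0. \<Psi> (\<Phi> x) = x \<and> \<Phi> (\<Psi> x) = x))"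

definition contact_equivalent ::
    "(complex ^ 'n \<Rightarrow> complex) \<Rightarrow> (complex ^ 'n \<Rightarrow> complex) \<Rightarrow> bool" where
  "contact_equivalent f g \<longleftrightarrow>
     (\<exists>\<Phi> u. coordinate_change \<Phi> \<and> hol_germ u \<and> u 0 \<noteq> 0 \<and>
        (\<forall>\<^sub>F x in nhds 0. u x * f (\<Phi> x) = g x))"

definition simple_germ :: "(complex ^ 2 \<Rightarrow> complex) \<Rightarrow> bool" where
  "simple_germ f \<longleftrightarrow>
     (\<exists>k\<ge>1. contact_equivalent f (\<lambda>p. (p $ 1) ^ 2 + (p $ 2) ^ (k + 1))) \<or>
     (\<exists>k\<ge>4. contact_equivalent f (\<lambda>p. (p $ 1) ^ 2 * p $ 2 + (p $ 2) ^ (k - 1))) \<or>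
     contact_equivalent f (\<lambda>p. (p $ 1) ^ 3 + (p $ 2) ^ 4) \<or>
     contact_equivalent f (\<lambda>p. (p $ 1) ^ 3 + p $ 1 * (p $ 2) ^ 3) \<or>
     contact_equivalent f (\<lambda>p. (p $ 1) ^ 3 + (p $ 2) ^ 5)"

definition stabilization :: "(complex ^ 2 \<Rightarrow> complex) \<Rightarrow> complex ^ 3 \<Rightarrow> complex" where
  "stabilization f = (\<lambda>p. f (vector [p $ 1, p $ 2]) - (p $ 3)\<^sup>2)"

definition zero_set :: "(complex ^ 'n \<Rightarrow> complex) \<Rightarrow> (complex ^ 'n) set" where
  "zero_set f = {x. f x = 0}"

definition isolated_hypersurface_singularity :: "(complex ^ 'n \<Rightarrow> complex) \<Rightarrow> bool" where
  "isolated_hypersurface_singularity f \<longleftrightarrow>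
     f 0 = 0 \<and> (f has_derivative (\<lambda>_. 0)) (at 0) \<and>
     (\<forall>\<^sub>F x in at 0. f x = 0 \<longrightarrow> \<not> (f has_derivative (\<lambda>_. 0)) (at x))"

(* C[x,y,z] is encoded as C[z][y][x], the outermost variable being x. *)
definition eval_poly3 :: "complex poly poly poly \<Rightarrow> complex ^ 3 \<Rightarrow> complex" where
  "eval_poly3 p = (\<lambda>v. poly (poly (poly p [:[:v $ 1:]:]) [:v $ 2:]) (v $ 3))"

(* The polynomial p is determined by F; squarefree p excludes p = 0. *)
definition reduced_polynomial3 :: "(complex ^ 3 \<Rightarrow> complex) \<Rightarrow> bool" where
  "reduced_polynomial3 F \<longleftrightarrow> (\<exists>p. F = eval_poly3 p \<and> squarefree p)"

definition arcs_on :: "(complex ^ 'n) set \<Rightarrow> (complex \<Rightarrow> complex ^ 'n) set" where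
  "arcs_on V = {\<phi>. (\<forall>i. (\<lambda>t. \<phi> t $ i) analytic_on {0}) \<and> \<phi> 0 = 0 \<and>
                   (\<forall>\<^sub>F t in nhds 0. \<phi> t \<in> V)}"

(* zorder is unspecified for functions vanishing identically near the point. *)
definition vanishing_order :: "(complex \<Rightarrow> complex) \<Rightarrow> enat" where
  "vanishing_order h =
     (if \<forall>\<^sub>F t in nhds 0. h t = 0 then \<infinity> else enat (nat (zorder h 0)))"

definition arc_order :: "(complex ^ 'n) set \<Rightarrow> (complex ^ 'n \<Rightarrow> complex) \<Rightarrow> enat" where
  "arc_order V g = (INF \<phi>\<in>arcs_on V. vanishing_order (g \<circ> \<phi>))"

(* An element of the local ring of (V,0) is represented by the holomorphic germs on (C^n,0)
   restricting to it, two of which represent the same element iff they agree on V near 0.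
   By arc_order_cong below, arc_order V g depends only on that restriction. Each arc_filtration V i contains
   all germs vanishing on V, so that passing to the quotient by them does not change the
   quotients of successive members of the filtration. *)
definition arc_filtration :: "(complex ^ 'n) set \<Rightarrow> nat \<Rightarrow> (complex ^ 'n \<Rightarrow> complex) set" where
  "arc_filtration V i = {g. hol_germ g \<and> arc_order V g \<ge> enat i}"

lemma arc_order_cong:
  assumes "\<forall>\<^sub>F x in nhds 0. x \<in> V \<longrightarrow> g x = h x"
  shows "arc_order V g = arc_order V h"
proof -
  have "vanishing_order (g \<circ> \<phi>) = vanishing_order (h \<circ> \<phi>)" if "\<phi> \<in> arcs_on V" for \<phi>
  proof -
    have "isCont (\<lambda>t. \<phi> t $ i) 0" for i
      using that by (auto simp: arcs_on_def intro: analytic_at_imp_isCont)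
    hence "(\<phi> \<longlongrightarrow> \<phi> 0) (nhds 0)"
      by (intro vec_tendstoI)
         (simp add: isCont_def tendsto_at_iff_tendsto_nhds[where g = "\<lambda>t. \<phi> t $ i" for i])
    hence "filterlim \<phi> (nhds 0) (nhds 0)"
      using that by (simp add: arcs_on_def)
    with assms have "\<forall>\<^sub>F t in nhds 0. \<phi> t \<in> V \<longrightarrow> g (\<phi> t) = h (\<phi> t)"
      unfolding filterlim_iff by blast
    moreover have "\<forall>\<^sub>F t in nhds 0. \<phi> t \<in> V"
      using that by (simp add: arcs_on_def)
    ultimately have eq: "\<forall>\<^sub>F t in nhds 0. (g \<circ> \<phi>) t = (h \<circ> \<phi>) t"
      by eventually_elim simp
    have "zorder (g \<circ> \<phi>) 0 = zorder (h \<circ> \<phi>) 0"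
      by (rule zorder_cong)
         (use eq in \<open>auto simp: eventually_at_filter elim: eventually_mono\<close>)
    moreover have "(\<forall>\<^sub>F t in nhds 0. (g \<circ> \<phi>) t = 0) \<longleftrightarrow> (\<forall>\<^sub>F t in nhds 0. (h \<circ> \<phi>) t = 0)"
      by (rule eventually_cong) (use eq in \<open>auto elim: eventually_mono\<close>)
    ultimately show ?thesis
      by (simp add: vanishing_order_def)
  qed
  thus ?thesis
    unfolding arc_order_def by (intro INF_cong) auto
qed

(* U / W has dimension n over C: the cosets of the n elements of B form a basis. *)
definition quotient_has_dim :: "('a \<Rightarrow> complex) set \<Rightarrow> ('a \<Rightarrow> complex) set \<Rightarrow> nat \<Rightarrow> bool" where
  "quotient_has_dim U W n \<longleftrightarrow>
     (\<exists>B. finite B \<and> card B = n \<and> B \<subseteq> U \<and>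
        (\<forall>c. (\<lambda>x. \<Sum>b\<in>B. c b * b x) \<in> W \<longrightarrow> (\<forall>b\<in>B. c b = 0)) \<and>
        (\<forall>u\<in>U. \<exists>c. (\<lambda>x. u x - (\<Sum>b\<in>B. c b * b x)) \<in> W))"

(* A relation rather than a function, so that it includes finiteness of all the dimensions. *)
definition has_arc_Poincare_series :: "(complex ^ 'n) set \<Rightarrow> real fps \<Rightarrow> bool" where
  "has_arc_Poincare_series V P \<longleftrightarrow>
     (\<exists>d. (\<forall>i. quotient_has_dim (arc_filtration V i) (arc_filtration V (i + 1)) (d i)) \<and>
          P = Abs_fps (\<lambda>i. real (d i)))"

end

theory Submission
  imports Defs "HOL-Computational_Algebra.Field_as_Ring"
begin

text \<open>
  Give the coordinates of the ambient space positive integer weights so that every arc on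
  \<open>V\<close> gives each coordinate at least the order of its weight, and let the leading
  cone be the zero set of the part of lowest weight of the equation. If an arc with exactly
  these orders runs in the direction of every general point of the cone, then
  \<open>v(g)\<close> is the largest weighted order of a germ that agrees with \<open>g\<close>
  on \<open>V\<close>: a leading form that vanishes at all general points of the cone is a
  multiple of the equation of the cone and can be removed by subtracting a multiple of the
  equation of \<open>V\<close>. Hence \<open>F i / F (i + 1)\<close> is the part of degree
  \<open>i\<close> of the graded coordinate ring of the cone, and the Poincare series is
  \<open>(1 - t^d) / ((1 - t^w1) (1 - t^w2) (1 - t^w3))\<close>, where the \<open>w\<close> are
  the weights of the coordinates and \<open>d\<close> is the weighted degree of the cone.

  For a double cover \<open>z^2 = f(x, y)\<close> (locale \<open>weighted_surface\<close>) every
  germ is congruent to \<open>a(x, y) + z b(x, y)\<close>. The arcs over the curves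
  \<open>(\<alpha> t^w, t)\<close> occur in pairs that differ by the sign of \<open>z\<close>,
  which separates \<open>a\<close> from \<open>b\<close>: the leading cone \<open>z^2 = f0(x,
  y)\<close> is reduced as soon as the weighted leading part \<open>f0\<close> of
  \<open>f\<close> is non-zero. If \<open>f\<close> has order 4, the weights of \<open>x, y,
  z\<close> are 1, 1, 2. If \<open>f\<close> has order at most 3 and is not simple, the
  classification of simple singularities gives coordinates in which \<open>f = X^3 A + X^2 Y^2 B
  + X Y^4 C + Y^6 D\<close> with \<open>A\<close> a unit
  (\<open>nonsimple_weight6_form\<close>), and the weights of \<open>X, Y, z\<close> are 2, 1,
  3: along an arc the order of \<open>f = z^2\<close> is even, whereas it would be 3 if
  \<open>X\<close> had order 1.

  For a surface of multiplicity 3 (locale \<open>reduced_cone_surface\<close>) all weights are 1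
  and the cone is the cubic tangent cone \<open>P = 0\<close>. If \<open>a\<close> is a smooth
  point of the cone and \<open>e\<close> a coordinate vector transversal to the cone at
  \<open>a\<close>, the implicit function theorem gives an arc \<open>t (a + \<sigma>(t)
  e)\<close> on \<open>V\<close> with \<open>\<sigma>(0) = 0\<close>
  (\<open>smooth_cone_point_arc\<close>). A polynomial that vanishes at all smooth points of a
  squarefree cubic is a multiple of it (\<open>squarefree_smooth_nullstellensatz\<close>).

  The analytic input is elementary: division by a coordinate, obtained from Cauchy's integral
  formula in one variable, gives Hadamard's lemma and Taylor expansions, and the inverse
  function theorem gives coordinate changes and implicit functions.
\<close>

no_notation fps_nth (infixl \<open>$\<close> 75)

section \<open>Holomorphic functions of several variables\<close>

text \<open>
  The condition imposed by \<open>hol_germ\<close> at a single point. Closure properties are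
  proved at a point first and then hold on the intersection of neighbourhoods.
\<close>

definition hol_at :: "(complex ^ 'n \<Rightarrow> complex) \<Rightarrow> complex ^ 'n \<Rightarrow> bool" where
  "hol_at f x \<longleftrightarrow> (\<exists>D. (f has_derivative D) (at x) \<and> (\<forall>c v. D (c *s v) = c * D v))"

lemma hol_germ_iff: "hol_germ f \<longleftrightarrow> (\<forall>\<^sub>F x in nhds 0. hol_at f x)"
  by (simp add: hol_germ_def hol_at_def)

lemma hol_atI:
  assumes "(f has_derivative D) (at x)" "\<And>c v. D (c *s v) = c * D v"
  shows "hol_at f x"
  using assms unfolding hol_at_def by blast

lemma hol_at_const: "hol_at (\<lambda>_. c) x"
  by (rule hol_atI[where D = "\<lambda>_. 0"]) auto

lemma hol_at_coord: "hol_at (\<lambda>x. x $ i) x"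
  by (rule hol_atI[where D = "\<lambda>v. v $ i"])
     (auto intro!: bounded_linear.has_derivative[OF bounded_linear_vec_nth] derivative_intros)

lemma hol_at_add:
  assumes "hol_at f x" "hol_at g x" shows "hol_at (\<lambda>x. f x + g x) x"
proof -
  obtain D where D: "(f has_derivative D) (at x)" "\<And>c v. D (c *s v) = c * D v"
    using assms(1) unfolding hol_at_def by blast
  obtain E where E: "(g has_derivative E) (at x)" "\<And>c v. E (c *s v) = c * E v"
    using assms(2) unfolding hol_at_def by blast
  show ?thesis
    by (rule hol_atI[OF has_derivative_add[OF D(1) E(1)]]) (simp add: D(2) E(2) algebra_simps)
qed

lemma hol_at_mult:
  assumes "hol_at f x" "hol_at g x" shows "hol_at (\<lambda>x. f x * g x) x"
proof -
  obtain D where D: "(f has_derivative D) (at x)" "\<And>c v. D (c *s v) = c * D v"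
    using assms(1) unfolding hol_at_def by blast
  obtain E where E: "(g has_derivative E) (at x)" "\<And>c v. E (c *s v) = c * E v"
    using assms(2) unfolding hol_at_def by blast
  show ?thesis
    by (rule hol_atI[OF has_derivative_mult[OF D(1) E(1)]]) (simp add: D(2) E(2) algebra_simps)
qed

lemma hol_at_outer:
  assumes "hol_at f x" "h field_differentiable (at (f x))"
  shows "hol_at (\<lambda>x. h (f x)) x"
proof -
  obtain D where D: "(f has_derivative D) (at x)" "\<And>c v. D (c *s v) = c * D v"
    using assms(1) unfolding hol_at_def by blast
  obtain h' where "(h has_field_derivative h') (at (f x))"
    using assms(2) by (auto simp: field_differentiable_def)
  from has_derivative_compose[OF D(1), of h "(*) h'"] this
  have "((\<lambda>x. h (f x)) has_derivative (\<lambda>v. h' * D v)) (at x)"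
    by (simp add: has_field_derivative_def)
  thus ?thesis by (rule hol_atI) (simp add: D(2))
qed

lemma bounded_linear_cscale: "bounded_linear (\<lambda>c. c *s (v :: complex ^ 'n))"
  unfolding linear_conv_bounded_linear[symmetric]
  by (rule linearI) (simp_all add: vec_eq_iff algebra_simps)

lemma has_derivative_vec_components:
  fixes \<Phi> :: "'a::real_normed_vector \<Rightarrow> complex ^ 'm"
  assumes "\<And>i. ((\<lambda>x. \<Phi> x $ i) has_derivative D i) (at x)"
  shows "(\<Phi> has_derivative (\<lambda>v. \<chi> i. D i v)) (at x)"
proof -
  have eq: "(\<Sum>i\<in>UNIV. (w $ i) *s axis i 1) = w" for w :: "complex ^ 'm"
    by (rule basis_expansion)
  have "((\<lambda>x. \<Sum>i\<in>UNIV. (\<Phi> x $ i) *s (axis i 1 :: complex ^ 'm)) has_derivative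
        (\<lambda>v. \<Sum>i\<in>UNIV. D i v *s (axis i 1 :: complex ^ 'm))) (at x)"
    by (intro has_derivative_sum bounded_linear.has_derivative[OF bounded_linear_cscale] assms)
  moreover have "(\<lambda>v. \<Sum>i\<in>UNIV. D i v *s (axis i 1 :: complex ^ 'm)) = (\<lambda>v. \<chi> i. D i v)"
    using eq[of "\<chi> i. D i _"] by (auto simp: fun_eq_iff)
  ultimately show ?thesis by (simp add: eq)
qed

lemma hol_at_compose:
  fixes \<Phi> :: "complex ^ 'm \<Rightarrow> complex ^ 'n"
  assumes "\<And>i. hol_at (\<lambda>x. \<Phi> x $ i) x" "hol_at f (\<Phi> x)"
  shows "hol_at (\<lambda>x. f (\<Phi> x)) x"
proof -
  have "\<exists>D. \<forall>i. ((\<lambda>x. \<Phi> x $ i) has_derivative D i) (at x) \<and> (\<forall>c v. D i (c *s v) = c * D i v)"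
    using assms(1) unfolding hol_at_def by (rule choice[OF allI])
  then obtain D where D: "\<And>i. ((\<lambda>x. \<Phi> x $ i) has_derivative D i) (at x)"
    "\<And>i c v. D i (c *s v) = c * D i v" by blast
  obtain E where E: "(f has_derivative E) (at (\<Phi> x))" "\<And>c v. E (c *s v) = c * E v"
    using assms(2) unfolding hol_at_def by blast
  have "((\<lambda>x. f (\<Phi> x)) has_derivative (\<lambda>v. E (\<chi> i. D i v))) (at x)"
    by (rule has_derivative_compose[OF has_derivative_vec_components[OF D(1)] E(1)])
  moreover have "E (\<chi> i. D i (c *s v)) = c * E (\<chi> i. D i v)" for c v
  proof -
    have "(\<chi> i. D i (c *s v)) = c *s (\<chi> i. D i v)" by (simp add: D(2) vec_eq_iff)
    thus ?thesis by (simp add: E(2))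
  qed
  ultimately show ?thesis by (rule hol_atI)
qed

lemma field_differentiable_compose_hol_at:
  fixes \<phi> :: "complex \<Rightarrow> complex ^ 'n"
  assumes "\<And>i. (\<lambda>t. \<phi> t $ i) field_differentiable (at t)" "hol_at f (\<phi> t)"
  shows "(\<lambda>t. f (\<phi> t)) field_differentiable (at t)"
proof -
  have "\<exists>d. \<forall>i. ((\<lambda>t. \<phi> t $ i) has_field_derivative d i) (at t)"
    using assms(1) unfolding field_differentiable_def by (rule choice[OF allI])
  then obtain d where d: "\<And>i. ((\<lambda>t. \<phi> t $ i) has_derivative (*) (d i)) (at t)"
    by (auto simp: has_field_derivative_def)
  obtain E where E: "(f has_derivative E) (at (\<phi> t))" "\<And>c v. E (c *s v) = c * E v"
    using assms(2) unfolding hol_at_def by blast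
  have "((\<lambda>t. f (\<phi> t)) has_derivative (\<lambda>v. E (\<chi> i. d i * v))) (at t)"
    by (rule has_derivative_compose[OF has_derivative_vec_components[OF d] E(1)])
  moreover have "E (\<chi> i. d i * v) = E (\<chi> i. d i) * v" for v
  proof -
    have "(\<chi> i. d i * v) = v *s (\<chi> i. d i)" by (simp add: vec_eq_iff)
    thus ?thesis by (simp add: E(2))
  qed
  ultimately show ?thesis
    unfolding field_differentiable_def has_field_derivative_def by (intro exI[of _ "E (\<chi> i. d i)"]) simp
qed

lemma hol_at_continuous: "hol_at f x \<Longrightarrow> isCont f x"
  by (auto simp: hol_at_def intro: has_derivative_continuous)

lemma complex_linear_expand:
  fixes D :: "complex ^ 'n \<Rightarrow> complex"
  assumes "linear D" "\<And>c v. D (c *s v) = c * D v"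
  shows "D v = (\<Sum>i\<in>UNIV. v $ i * D (axis i 1))"
proof -
  have "D v = D (\<Sum>i\<in>UNIV. (v $ i) *s axis i 1)" by (simp add: basis_expansion)
  also have "\<dots> = (\<Sum>i\<in>UNIV. D ((v $ i) *s axis i 1))" by (rule linear_sum[OF assms(1)])
  finally show ?thesis by (simp add: assms(2))
qed

text \<open>
  Defined by the derivative of a one-variable slice, so that Cauchy's formula in one variable
  applies to it.
\<close>

definition partial_deriv :: "'n \<Rightarrow> (complex ^ 'n \<Rightarrow> complex) \<Rightarrow> complex ^ 'n \<Rightarrow> complex" where
  "partial_deriv i f x = deriv (\<lambda>s. f (x + s *s axis i 1)) 0"

lemma slice_derivative:
  fixes f :: "complex ^ 'n \<Rightarrow> complex"
  assumes "(f has_derivative D) (at (x + s *s v))" "\<And>c v. D (c *s v) = c * D v"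
  shows "((\<lambda>s. f (x + s *s v)) has_field_derivative D v) (at s)"
proof -
  have 1: "((\<lambda>s. x + s *s v) has_derivative (\<lambda>s. s *s v)) (at s)"
    using has_derivative_add[OF has_derivative_const[of x]
      bounded_linear.has_derivative[OF bounded_linear_cscale[of v] has_derivative_ident]] by simp
  show ?thesis
    using has_derivative_compose[OF 1, of f D] assms(1)
    by (simp add: assms(2) has_field_derivative_def mult_commute_abs)
qed

lemma slice_differentiable:
  "hol_at f (x + s *s v) \<Longrightarrow> (\<lambda>s. f (x + s *s v)) field_differentiable (at s)"
proof -
  assume "hol_at f (x + s *s v)"
  then obtain D where D: "(f has_derivative D) (at (x + s *s v))" "\<And>c v. D (c *s v) = c * D v"
    unfolding hol_at_def by blast
  show ?thesis
    unfolding field_differentiable_def by (rule exI, rule slice_derivative[OF D])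
qed

lemma partial_deriv_eq:
  assumes "(f has_derivative D) (at x)" "\<And>c v. D (c *s v) = c * D v"
  shows "partial_deriv i f x = D (axis i 1)"
  unfolding partial_deriv_def using slice_derivative[of f D x 0 "axis i 1"] assms by (auto intro: DERIV_imp_deriv)

lemma hol_at_has_derivative_partial_deriv:
  assumes "hol_at f x"
  shows "(f has_derivative (\<lambda>v. \<Sum>i\<in>UNIV. v $ i * partial_deriv i f x)) (at x)"
proof -
  obtain D where D: "(f has_derivative D) (at x)" "\<forall>c v. D (c *s v) = c * D v"
    using assms unfolding hol_at_def by blast
  have "D v = (\<Sum>i\<in>UNIV. v $ i * partial_deriv i f x)" for v
  proof -
    have "partial_deriv i f x = D (axis i 1)" for i using partial_deriv_eq[OF D(1)] D(2) by blast
    moreover have "D v = (\<Sum>i\<in>UNIV. v $ i * D (axis i 1))"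
      by (rule complex_linear_expand[OF has_derivative_linear[OF D(1)]]) (use D(2) in blast)
    ultimately show ?thesis by simp
  qed
  hence "D = (\<lambda>v. \<Sum>i\<in>UNIV. v $ i * partial_deriv i f x)" by (rule ext)
  thus ?thesis using D(1) by (simp only:)
qed

section \<open>Cauchy's formula in one coordinate\<close>

text \<open>
  The circle path of radius \<open>\<rho>\<close> around 0, written so that Cauchy's formula
  becomes an integral over the real interval from 0 to 1 to which differentiation under the
  integral sign applies.
\<close>

definition circle_point :: "real \<Rightarrow> real \<Rightarrow> complex" where
  "circle_point \<rho> t = of_real \<rho> * exp (2 * of_real pi * \<i> * of_real t)"

lemma norm_circle_point: "\<rho> \<ge> 0 \<Longrightarrow> norm (circle_point \<rho> t) = \<rho>"
  by (simp add: circle_point_def norm_mult)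

lemma continuous_on_circle_point [continuous_intros]:
  "continuous_on A f \<Longrightarrow> continuous_on A (\<lambda>x. circle_point \<rho> (f x))"
  unfolding circle_point_def by (intro continuous_intros)

lemma circlepath_circle_point: "circlepath 0 \<rho> = circle_point \<rho>"
  by (auto simp: circlepath circle_point_def)

lemma vector_derivative_circle_point:
  "t \<in> {0..1} \<Longrightarrow> vector_derivative (circle_point \<rho>) (at t within {0..1}) = 2 * of_real pi * \<i> * circle_point \<rho> t"
  using vector_derivative_circlepath01[of t 0 \<rho>] by (simp add: circlepath_circle_point circle_point_def)

lemma circle_integral_formula:
  assumes "F holomorphic_on cball 0 \<rho>" "norm w < \<rho>"
  shows "((\<lambda>t. F (circle_point \<rho> t) * circle_point \<rho> t / (circle_point \<rho> t - w)) has_integral F w) {0..1}"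
proof -
  have "((\<lambda>u. F u / (u - w)) has_contour_integral (2 * of_real pi * \<i> * F w)) (circlepath 0 \<rho>)"
    by (rule Cauchy_integral_circlepath_simple) (use assms in auto)
  hence "((\<lambda>t. F (circlepath 0 \<rho> t) / (circlepath 0 \<rho> t - w) *
      vector_derivative (circlepath 0 \<rho>) (at t within {0..1})) has_integral (2 * of_real pi * \<i> * F w)) {0..1}"
    by (simp add: has_contour_integral_def)
  hence "((\<lambda>t. F (circle_point \<rho> t) / (circle_point \<rho> t - w) * (2 * of_real pi * \<i> * circle_point \<rho> t)) has_integral (2 * of_real pi * \<i> * F w)) {0..1}"
    by (rule has_integral_eq[rotated]) (simp add: circlepath_circle_point vector_derivative_circle_point)
  from has_integral_mult_right[OF this, of "1 / (2 * of_real pi * \<i>)"]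
  show ?thesis by (simp add: mult_ac)
qed

lemma circle_derivative_formula:
  assumes "F holomorphic_on cball 0 \<rho>" "0 < \<rho>"
  shows "((\<lambda>t. F (circle_point \<rho> t) / circle_point \<rho> t) has_integral deriv F 0) {0..1}"
proof -
  have "((\<lambda>u. F u / (u - 0)^2) has_contour_integral (2 * of_real pi * \<i> * deriv F 0)) (circlepath 0 \<rho>)"
    using Cauchy_has_contour_integral_higher_derivative_circlepath[of 0 \<rho> F 0 1] assms
    by (auto simp: holomorphic_on_imp_continuous_on holomorphic_on_subset power2_eq_square)
  hence "((\<lambda>t. F (circlepath 0 \<rho> t) / (circlepath 0 \<rho> t)^2 *
      vector_derivative (circlepath 0 \<rho>) (at t within {0..1})) has_integral (2 * of_real pi * \<i> * deriv F 0)) {0..1}"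
    by (simp add: has_contour_integral_def)
  hence "((\<lambda>t. F (circle_point \<rho> t) / (circle_point \<rho> t)^2 * (2 * of_real pi * \<i> * circle_point \<rho> t)) has_integral (2 * of_real pi * \<i> * deriv F 0)) {0..1}"
    by (rule has_integral_eq[rotated]) (simp add: circlepath_circle_point vector_derivative_circle_point)
  from has_integral_mult_right[OF this, of "1 / (2 * of_real pi * \<i>)"]
  have "((\<lambda>t. 1 / (2 * of_real pi * \<i>) * (F (circle_point \<rho> t) / (circle_point \<rho> t)^2 * (2 * of_real pi * \<i> * circle_point \<rho> t)))
      has_integral deriv F 0) {0..1}" by simp
  moreover have "1 / (2 * of_real pi * \<i>) * (F (circle_point \<rho> t) / (circle_point \<rho> t)^2 * (2 * of_real pi * \<i> * circle_point \<rho> t)) =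
      F (circle_point \<rho> t) / circle_point \<rho> t" for t
  proof -
    have "circle_point \<rho> t \<noteq> 0" using norm_circle_point[of \<rho> t] assms(2) by auto
    thus ?thesis by (simp add: power2_eq_square)
  qed
  ultimately show ?thesis by simp
qed

lemma norm_smult_axis: "norm (c *s axis i 1 :: complex ^ 'n) = norm c"
proof -
  have "(\<Sum>j\<in>UNIV. (norm ((c *s axis i 1 :: complex ^ 'n) $ j))\<^sup>2) = (\<Sum>j\<in>UNIV. if j = i then (norm c)\<^sup>2 else 0)"
    by (rule sum.cong) (auto simp: axis_def)
  thus ?thesis by (simp add: norm_vec_def L2_set_def)
qed

lemma partial_deriv_circle_formula:
  assumes "\<And>y. y \<in> ball 0 (2*r) \<Longrightarrow> hol_at f y" "x \<in> ball 0 r" "r > 0"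
  shows "partial_deriv i f x = integral {0..1} (\<lambda>s. f (x + circle_point r s *s axis i 1) / circle_point r s)"
proof -
  have "(\<lambda>s. f (x + s *s axis i 1)) field_differentiable (at s)" if "s \<in> cball 0 r" for s
  proof (rule slice_differentiable, rule assms(1))
    have "norm (x + s *s axis i 1) \<le> norm x + norm s"
      using norm_triangle_ineq[of x "s *s axis i 1"] by (simp add: norm_smult_axis)
    thus "x + s *s axis i 1 \<in> ball 0 (2*r)" using that assms(2) by simp
  qed
  hence "(\<lambda>s. f (x + s *s axis i 1)) holomorphic_on cball 0 r"
    by (auto simp: holomorphic_on_def field_differentiable_at_within)
  from circle_derivative_formula[OF this assms(3)] show ?thesis
    unfolding partial_deriv_def by (simp add: integral_unique)
qed

lemma continuous_on_partial_deriv_param: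
  fixes K :: "complex ^ 'n \<Rightarrow> real \<Rightarrow> complex"
  assumes cont: "continuous_on (ball 0 (2*r) \<times> {0..1}) (\<lambda>(x, t). K x t)"
    and hol: "\<And>x t. x \<in> ball 0 (2*r) \<Longrightarrow> t \<in> {0..1} \<Longrightarrow> hol_at (\<lambda>x. K x t) x" and "r > 0"
  shows "continuous_on (ball 0 r \<times> {0..1}) (\<lambda>(x, t). partial_deriv i (\<lambda>x. K x t) x)"
proof -
  have sub: "x + circle_point r s *s axis i 1 \<in> ball 0 (2*r)" if "x \<in> ball 0 r" for x s and i :: 'n
  proof -
    have "norm (x + circle_point r s *s axis i 1) \<le> norm x + r"
      using norm_triangle_ineq[of x "circle_point r s *s axis i 1"] \<open>r > 0\<close>
      by (simp add: norm_smult_axis norm_circle_point)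
    thus ?thesis using that by simp
  qed
  have nz: "circle_point r s \<noteq> 0" for s using norm_circle_point[of r s] \<open>r > 0\<close> by auto
  have "continuous_on ((ball 0 r \<times> {0..1}) \<times> cbox 0 (1::real))
      (\<lambda>(p, s). K (fst p + circle_point r s *s axis i 1) (snd p) / circle_point r s)"
  proof -
    have "continuous_on ((ball 0 r \<times> {0..1}) \<times> cbox 0 (1::real))
      (\<lambda>q. (\<lambda>(x, t). K x t) (fst (fst q) + circle_point r (snd q) *s axis i 1, snd (fst q)))"
    proof (rule continuous_on_compose2[OF cont])
      show "continuous_on ((ball 0 r \<times> {0..1}) \<times> cbox 0 1)
         (\<lambda>q. (fst (fst q) + circle_point r (snd q) *s axis i 1, snd (fst q)))"
        by (intro continuous_intros bounded_linear.continuous_on[OF bounded_linear_cscale])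
    qed (use sub in auto)
    hence "continuous_on ((ball 0 r \<times> {0..1}) \<times> cbox 0 (1::real))
      (\<lambda>q. K (fst (fst q) + circle_point r (snd q) *s axis i 1) (snd (fst q)) / circle_point r (snd q))"
      by (intro continuous_intros) (auto simp: nz)
    thus ?thesis by (simp add: case_prod_beta)
  qed
  from integral_continuous_on_param[OF this]
  have "continuous_on (ball 0 r \<times> {0..1}) (\<lambda>p. integral {0..1} (\<lambda>s. K (fst p + circle_point r s *s axis i 1) (snd p) / circle_point r s))"
    by simp
  thus ?thesis
    by (rule continuous_on_eq) (use partial_deriv_circle_formula[OF hol _ \<open>r > 0\<close>] in auto)
qed

text \<open>
  Differentiation under the integral sign. The derivative of the kernel has to depend
  continuously on the point and on the parameter; this follows from continuity of the kernel
  itself, because Cauchy's formula writes the partial derivatives as integrals of the kernel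
  over circles.
\<close>

lemma hol_at_integral:
  fixes K :: "complex ^ 'n \<Rightarrow> real \<Rightarrow> complex"
  assumes cont: "continuous_on (ball 0 (2*r) \<times> {0..1}) (\<lambda>(x, t). K x t)"
    and hol: "\<And>x t. x \<in> ball 0 (2*r) \<Longrightarrow> t \<in> {0..1} \<Longrightarrow> hol_at (\<lambda>x. K x t) x" and "r > 0"
    and x0: "x0 \<in> ball 0 r"
  shows "hol_at (\<lambda>x. integral {0..1} (K x)) x0"
proof -
  define Dk where "Dk x t = Blinfun (\<lambda>v. \<Sum>i\<in>UNIV. v $ i * partial_deriv i (\<lambda>x. K x t) x)" for x t
  have Dk: "blinfun_apply (Dk x t) = (\<lambda>v. \<Sum>i\<in>UNIV. v $ i * partial_deriv i (\<lambda>x. K x t) x)"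
    if "x \<in> ball 0 (2*r)" "t \<in> {0..1}" for x t
    unfolding Dk_def
    by (rule bounded_linear_Blinfun_apply has_derivative_bounded_linear)+
       (rule hol_at_has_derivative_partial_deriv[OF hol[OF that]])
  have r2: "x \<in> ball 0 r \<Longrightarrow> x \<in> ball 0 (2*r)" for x :: "complex ^ 'n" using \<open>r > 0\<close> by simp
  have cD: "continuous_on (ball 0 r \<times> cbox 0 1) (\<lambda>(x, t). Dk x t)"
  proof (rule continuous_on_blinfun_componentwise)
    fix v :: "complex ^ 'n"
    have "continuous_on (ball 0 r \<times> cbox 0 1) (\<lambda>p. \<Sum>i\<in>UNIV. v $ i * (\<lambda>(x, t). partial_deriv i (\<lambda>x. K x t) x) p)"
      by (intro continuous_intros) (use continuous_on_partial_deriv_param[OF cont hol \<open>r > 0\<close>] in simp)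
    thus "continuous_on (ball 0 r \<times> cbox 0 1) (\<lambda>p. blinfun_apply (case p of (x, t) \<Rightarrow> Dk x t) v)"
      by (rule continuous_on_eq) (use Dk r2 in \<open>auto simp del: mem_ball_0\<close>)
  qed
  have "((\<lambda>x. integral (cbox 0 1) (K x)) has_derivative integral (cbox 0 1) (Dk x0)) (at x0 within ball 0 r)"
  proof (rule leibniz_rule)
    show "((\<lambda>x. K x t) has_derivative blinfun_apply (Dk x t)) (at x within ball 0 r)"
      if "x \<in> ball 0 r" "t \<in> cbox 0 1" for x t
      using hol_at_has_derivative_partial_deriv[OF hol[OF r2[OF that(1)], of t]] that Dk[OF r2[OF that(1)], of t]
      by (simp add: has_derivative_at_withinI)
    show "K x integrable_on cbox 0 1" if "x \<in> ball 0 r" for x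
    proof (rule integrable_continuous)
      show "continuous_on (cbox 0 1) (K x)"
        using continuous_on_compose2[OF cont, of "cbox 0 1" "\<lambda>t. (x, t)"] r2[OF that]
        by (force intro: continuous_intros)
    qed
  qed (use cD x0 in auto)
  hence d: "((\<lambda>x. integral {0..1} (K x)) has_derivative integral {0..1} (Dk x0)) (at x0)"
    using at_within_open[OF x0 open_ball] by simp
  have int: "Dk x0 integrable_on {0..1}"
  proof -
    have "continuous_on (cbox 0 1) (\<lambda>t. (\<lambda>(x, t). Dk x t) (x0, t))"
      by (rule continuous_on_compose2[OF cD]) (use x0 in \<open>auto intro!: continuous_intros\<close>)
    thus ?thesis by (simp add: integrable_continuous_interval)
  qed
  show ?thesis
  proof (rule hol_atI[OF d])
    fix c v
    have "blinfun_apply (integral {0..1} (Dk x0)) (c *s v) = integral {0..1} (\<lambda>t. blinfun_apply (Dk x0 t) (c *s v))"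
      by (rule blinfun_apply_integral[OF int])
    also have "\<dots> = integral {0..1} (\<lambda>t. c * blinfun_apply (Dk x0 t) v)"
      by (rule integral_cong) (use Dk[OF r2[OF x0]] in \<open>simp add: sum_distrib_left mult.assoc\<close>)
    also have "\<dots> = c * blinfun_apply (integral {0..1} (Dk x0)) v"
      by (simp add: blinfun_apply_integral[OF int])
    finally show "blinfun_apply (integral {0..1} (Dk x0)) (c *s v) = c * blinfun_apply (integral {0..1} (Dk x0)) v" .
  qed
qed

lemma hol_germ_ballE:
  assumes "hol_germ f"
  obtains r where "r > 0" "\<And>x. x \<in> ball 0 r \<Longrightarrow> hol_at f x"
  using assms unfolding hol_germ_iff eventually_nhds_metric by (auto simp: dist_commute)

lemma hol_germI_ball:
  assumes "r > 0" "\<And>x. x \<in> ball 0 r \<Longrightarrow> hol_at f x" shows "hol_germ f"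
  using assms unfolding hol_germ_iff eventually_nhds_metric by (auto simp: dist_commute)

text \<open>
  Holomorphic germs are only assumed complex differentiable near 0. Cauchy's formula exhibits a
  partial derivative as an integral of translates of the function, and these are holomorphic.
\<close>

lemma hol_germ_partial_deriv:
  assumes "hol_germ f" shows "hol_germ (partial_deriv i f)"
proof -
  obtain R where R: "R > 0" "\<And>x. x \<in> ball 0 R \<Longrightarrow> hol_at f x"
    using assms by (rule hol_germ_ballE) blast
  \<comment> \<open>A circle of radius \<open>r\<close> around a point of the ball of radius
     \<open>2 r\<close> stays within radius \<open>3 r < R\<close>.\<close>
  define r where "r = R/4"
  have r: "r > 0" "4*r = R" using R by (simp_all add: r_def)
  have sub: "x + circle_point r s *s axis i 1 \<in> ball 0 R" if "x \<in> ball 0 (2*r)" for x s and i :: 'a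
  proof -
    have "norm (x + circle_point r s *s axis i 1) \<le> norm x + r"
      using norm_triangle_ineq[of x "circle_point r s *s axis i 1"] \<open>r > 0\<close>
      by (simp add: norm_smult_axis norm_circle_point)
    thus ?thesis using that r by simp
  qed
  have nz: "circle_point r s \<noteq> 0" for s using norm_circle_point[of r s] \<open>r > 0\<close> by auto
  have hol: "hol_at (\<lambda>x. f (x + circle_point r s *s axis i 1) / circle_point r s) x" if "x \<in> ball 0 (2*r)" for x s
    unfolding divide_inverse
  proof (rule hol_at_mult[OF hol_at_compose[of "\<lambda>x. x + circle_point r s *s axis i 1" x f] hol_at_const])
    show "hol_at (\<lambda>x. (x + circle_point r s *s axis i 1) $ j) x" for j
      by (simp add: hol_at_add hol_at_coord hol_at_const)
    show "hol_at f (x + circle_point r s *s axis i 1)" by (rule R(2)[OF sub[OF that]])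
  qed
  have cf: "continuous_on (ball 0 R) f"
    using R(2) hol_at_continuous continuous_at_imp_continuous_on by blast
  have "continuous_on (ball 0 (2*r) \<times> {0..1}) (\<lambda>p. f (fst p + circle_point r (snd p) *s axis i 1) / circle_point r (snd p))"
    by (intro continuous_intros bounded_linear.continuous_on[OF bounded_linear_cscale] continuous_on_compose2[OF cf])
       (use sub nz in auto)
  hence cont: "continuous_on (ball 0 (2*r) \<times> {0..1}) (\<lambda>(x, s). f (x + circle_point r s *s axis i 1) / circle_point r s)"
    by (simp add: case_prod_beta)
  have "hol_at (partial_deriv i f) x" if x: "x \<in> ball 0 r" for x
  proof -
    have ev: "\<forall>\<^sub>F y in nhds x. integral {0..1} (\<lambda>s. f (y + circle_point r s *s axis i 1) / circle_point r s) = partial_deriv i f y"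
      unfolding eventually_nhds
      by (rule exI[of _ "ball 0 r"]) (use x partial_deriv_circle_formula[of r f] R(2) r in auto)
    obtain D where D: "((\<lambda>x. integral {0..1} (\<lambda>s. f (x + circle_point r s *s axis i 1) / circle_point r s)) has_derivative D) (at x)"
      and DD: "\<And>c v. D (c *s v) = c * D v"
      using hol_at_integral[OF cont hol r(1) x] unfolding hol_at_def by blast
    have "(partial_deriv i f has_derivative D) (at x)"
      using has_derivative_transform_eventually[OF D eventually_nhds_conv_at[THEN iffD1, OF ev, THEN conjunct1]
        eventually_nhds_x_imp_x[OF ev]] by simp
    thus ?thesis using DD by (rule hol_atI)
  qed
  with r(1) show ?thesis by (rule hol_germI_ball)
qed

definition set_coord :: "'n \<Rightarrow> complex \<Rightarrow> complex ^ 'n \<Rightarrow> complex ^ 'n" where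
  "set_coord i c x = (\<chi> j. if j = i then c else x $ j)"

lemma set_coord_eq: "set_coord i c x = x + (c - x $ i) *s axis i 1"
  by (simp add: set_coord_def vec_eq_iff axis_def)

lemma set_coord_nth: "set_coord i c x $ j = (if j = i then c else x $ j)"
  by (simp add: set_coord_def)

lemma set_coord_0: "set_coord i 0 0 = 0"
  by (simp add: set_coord_def vec_eq_iff)

lemma set_coord_same: "set_coord i (x $ i) x = x"
  by (simp add: set_coord_def vec_eq_iff)

text \<open>
  Division by a coordinate without passing to power series: for the function \<open>F c = f
  (set_coord i c x)\<close> of one variable, Cauchy's formula gives \<open>(F w - F 0) /
  w\<close> as the mean of \<open>F c / (c - w)\<close> over a circle, and this depends
  holomorphically on all coordinates, also where \<open>w = x $ i\<close> is 0.
\<close>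

lemma hol_germ_difference_quotient:
  fixes f :: "complex ^ 'n \<Rightarrow> complex"
  assumes "hol_germ f"
  shows "\<exists>h. hol_germ h \<and> (\<forall>\<^sub>F x in nhds 0. f x = f (set_coord i 0 x) + x $ i * h x)"
proof -
  obtain R where R: "R > 0" "\<And>x. x \<in> ball 0 R \<Longrightarrow> hol_at f x"
    using assms by (rule hol_germ_ballE) blast
  define \<rho> where "\<rho> = R/4"
  \<comment> \<open>In the ball of radius \<open>2 r\<close> the coordinate \<open>x $ i\<close>
     stays inside the circle of radius \<open>\<rho>\<close>, so the denominator of the kernel does
     not vanish.\<close>
  define r where "r = R/16"
  have r: "r > 0" "\<rho> > 0" "16*r = R" "4*\<rho> = R" using R by (simp_all add: r_def \<rho>_def)
  have ni: "norm (x $ i) \<le> norm x" for x :: "complex ^ 'n" by (rule Finite_Cartesian_Product.norm_nth_le)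
  have sub: "set_coord i c x \<in> ball 0 R" if "x \<in> ball 0 (2*r)" "norm c \<le> \<rho>" for x c
  proof -
    have "norm (set_coord i c x) \<le> norm x + norm (c - x $ i)"
      using norm_triangle_ineq[of x "(c - x $ i) *s axis i 1"] by (simp only: norm_smult_axis set_coord_eq)
    also have "norm (c - x $ i) \<le> norm c + norm x" using norm_triangle_ineq4[of c "x $ i"] ni[of x] by simp
    finally show ?thesis using that r by simp
  qed
  have nz: "circle_point \<rho> s - x $ i \<noteq> 0" if "x \<in> ball 0 (2*r)" for s x
  proof
    assume "circle_point \<rho> s - x $ i = 0"
    hence "norm (circle_point \<rho> s) = norm (x $ i)" by simp
    thus False using norm_circle_point[of \<rho> s] ni[of x] that r by simp
  qed
  let ?K = "\<lambda>x s. f (set_coord i (circle_point \<rho> s) x) / (circle_point \<rho> s - x $ i)"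
  have hol: "hol_at (\<lambda>x. ?K x s) x" if "x \<in> ball 0 (2*r)" for x s
    unfolding divide_inverse
  proof (rule hol_at_mult[OF hol_at_compose[of "set_coord i (circle_point \<rho> s)" x f]])
    show "hol_at (\<lambda>x. set_coord i (circle_point \<rho> s) x $ j) x" for j
      by (cases "j = i") (simp_all add: set_coord_nth hol_at_coord hol_at_const)
    have 1: "hol_at (\<lambda>x. circle_point \<rho> s + (-1) * x $ i) x"
      by (intro hol_at_add hol_at_mult hol_at_coord hol_at_const)
    show "hol_at (\<lambda>x. inverse (circle_point \<rho> s - x $ i)) x"
      using hol_at_outer[OF 1, of inverse] nz[OF that, of s]
      by (simp add: field_differentiable_inverse[of "\<lambda>z. z", OF field_differentiable_ident])
    show "hol_at f (set_coord i (circle_point \<rho> s) x)" by (rule R(2), rule sub[OF that]) (use r in \<open>simp add: norm_circle_point\<close>)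
  qed
  have cf: "continuous_on (ball 0 R) f"
    using R(2) hol_at_continuous continuous_at_imp_continuous_on by blast
  have "continuous_on (ball 0 (2*r) \<times> {0..1}) (\<lambda>p. f (fst p + (circle_point \<rho> (snd p) - fst p $ i) *s axis i 1)
     / (circle_point \<rho> (snd p) - fst p $ i))"
    apply (intro continuous_intros bounded_linear.continuous_on[OF bounded_linear_cscale] continuous_on_compose2[OF cf])
    subgoal using sub r by (auto simp: set_coord_eq norm_circle_point)
    subgoal using nz by auto
    done
  hence cont: "continuous_on (ball 0 (2*r) \<times> {0..1}) (\<lambda>(x, s). ?K x s)"
    by (simp add: case_prod_beta set_coord_eq)
  let ?h = "\<lambda>x. integral {0..1} (?K x)"
  have "hol_germ ?h"
    using r(1) by (rule hol_germI_ball) (rule hol_at_integral[OF cont hol r(1)])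
  moreover have "f x = f (set_coord i 0 x) + x $ i * ?h x" if "x \<in> ball 0 r" for x
  proof -
    define F where "F c = f (set_coord i c x)" for c
    have x2: "x \<in> ball 0 (2*r)" using that r by simp
    have xr: "norm (x $ i) < \<rho>" using ni[of x] that r by simp
    have "F field_differentiable (at c)" if "c \<in> cball 0 \<rho>" for c
      unfolding F_def
    proof (rule field_differentiable_compose_hol_at)
      show "(\<lambda>t. set_coord i t x $ j) field_differentiable at c" for j
        by (cases "j = i") (simp_all add: set_coord_nth)
      show "hol_at f (set_coord i c x)" by (rule R(2), rule sub[OF x2]) (use that in simp)
    qed
    hence F: "F holomorphic_on cball 0 \<rho>"
      by (auto simp: holomorphic_on_def field_differentiable_at_within)
    have 1: "((\<lambda>t. F (circle_point \<rho> t) * circle_point \<rho> t / (circle_point \<rho> t - x $ i)) has_integral F (x $ i)) {0..1}"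
      by (rule circle_integral_formula[OF F xr])
    have 2: "((\<lambda>t. F (circle_point \<rho> t) * circle_point \<rho> t / (circle_point \<rho> t - 0)) has_integral F 0) {0..1}"
      by (rule circle_integral_formula[OF F]) (use r in simp)
    have "((\<lambda>t. F (circle_point \<rho> t) * circle_point \<rho> t / (circle_point \<rho> t - x $ i) - F (circle_point \<rho> t) * circle_point \<rho> t / (circle_point \<rho> t - 0))
        has_integral F (x $ i) - F 0) {0..1}"
      by (rule has_integral_diff[OF 1 2])
    moreover have "F (circle_point \<rho> t) * circle_point \<rho> t / (circle_point \<rho> t - x $ i) - F (circle_point \<rho> t) * circle_point \<rho> t / (circle_point \<rho> t - 0) = x $ i * ?K x t" for t
    proof -
      have "circle_point \<rho> t \<noteq> 0" using norm_circle_point[of \<rho> t] r by auto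
      thus ?thesis using nz[OF x2, of t] by (simp add: F_def divide_simps) (simp add: algebra_simps)
    qed
    ultimately have "((\<lambda>t. x $ i * ?K x t) has_integral F (x $ i) - F 0) {0..1}" by simp
    hence "integral {0..1} (\<lambda>t. x $ i * ?K x t) = F (x $ i) - F 0"
      by (rule integral_unique)
    hence "F (x $ i) - F 0 = x $ i * ?h x"
      by (simp only: integral_mult_right)
    thus ?thesis by (simp add: F_def set_coord_same algebra_simps)
  qed
  hence "\<forall>\<^sub>F x in nhds 0. f x = f (set_coord i 0 x) + x $ i * ?h x"
    unfolding eventually_nhds by (intro exI[of _ "ball 0 r"]) (use r in auto)
  ultimately show ?thesis by blast
qed

named_theorems hol_intros

section \<open>The ring of germs\<close>

lemma hol_germ_const [hol_intros]: "hol_germ (\<lambda>_. c)"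
  by (simp add: hol_germ_iff hol_at_const)

lemma hol_germ_coord [hol_intros]: "hol_germ (\<lambda>x. x $ i)"
  by (simp add: hol_germ_iff hol_at_coord)

lemma hol_germ_add [hol_intros]:
  assumes "hol_germ f" "hol_germ g" shows "hol_germ (\<lambda>x. f x + g x)"
  using assms unfolding hol_germ_iff by eventually_elim (rule hol_at_add)

lemma hol_germ_mult [hol_intros]:
  assumes "hol_germ f" "hol_germ g" shows "hol_germ (\<lambda>x. f x * g x)"
  using assms unfolding hol_germ_iff by eventually_elim (rule hol_at_mult)

lemma hol_germ_minus [hol_intros]:
  assumes "hol_germ f" shows "hol_germ (\<lambda>x. - f x)"
  using hol_germ_mult[OF hol_germ_const[of "-1"] assms] by simp

lemma hol_germ_diff [hol_intros]:
  assumes "hol_germ f" "hol_germ g" shows "hol_germ (\<lambda>x. f x - g x)"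
  using hol_germ_add[OF assms(1) hol_germ_minus[OF assms(2)]] by simp

lemma hol_germ_power [hol_intros]:
  assumes "hol_germ f" shows "hol_germ (\<lambda>x. f x ^ k)"
  by (induction k) (auto intro: hol_intros assms)

lemma hol_germ_sum [hol_intros]:
  assumes "\<And>i. i \<in> A \<Longrightarrow> hol_germ (f i)" shows "hol_germ (\<lambda>x. \<Sum>i\<in>A. f i x)"
  using assms by (induction A rule: infinite_finite_induct) (auto intro: hol_intros)

lemma hol_germ_continuous: "hol_germ f \<Longrightarrow> isCont f 0"
  unfolding hol_germ_iff using eventually_nhds_x_imp_x hol_at_continuous by blast

lemma hol_germ_tendsto: "hol_germ f \<Longrightarrow> (f \<longlongrightarrow> f 0) (nhds 0)"
  using hol_germ_continuous[of f] by (simp add: isCont_def tendsto_at_iff_tendsto_nhds)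

lemma hol_germ_outer:
  assumes "hol_germ f" "h analytic_on {f 0}"
  shows "hol_germ (\<lambda>x. h (f x))"
proof -
  obtain S where S: "open S" "f 0 \<in> S" "h holomorphic_on S"
    using assms(2) by (auto simp: analytic_at)
  have "\<forall>\<^sub>F x in nhds 0. f x \<in> S"
    using hol_germ_tendsto[OF assms(1)] S(1,2) by (rule topological_tendstoD)
  thus ?thesis using assms(1) unfolding hol_germ_iff
  proof eventually_elim
    case (elim x)
    have "h field_differentiable (at (f x))"
      using holomorphic_on_imp_differentiable_at[OF S(3,1) elim(1)] .
    with elim(2) show ?case by (rule hol_at_outer)
  qed
qed

lemma hol_germ_inverse [hol_intros]:
  assumes "hol_germ f" "f 0 \<noteq> 0" shows "hol_germ (\<lambda>x. inverse (f x))"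
  by (rule hol_germ_outer[OF assms(1)]) (use assms(2) in \<open>auto intro!: analytic_intros\<close>)

lemma hol_germ_divide [hol_intros]:
  assumes "hol_germ f" "hol_germ g" "g 0 \<noteq> 0" shows "hol_germ (\<lambda>x. f x / g x)"
  unfolding divide_inverse by (intro hol_intros assms)

lemma hol_germ_nonzero:
  assumes "hol_germ f" "f 0 \<noteq> 0" shows "\<forall>\<^sub>F x in nhds 0. f x \<noteq> 0"
  using topological_tendstoD[OF hol_germ_tendsto[OF assms(1)], of "- {0}"] assms(2) by (simp add: open_Compl)

lemma hol_germ_root:
  assumes "hol_germ u" "u 0 \<noteq> 0" "k > 0"
  shows "\<exists>w. hol_germ w \<and> w 0 \<noteq> 0 \<and> (\<forall>\<^sub>F x in nhds 0. w x ^ k = u x)"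
proof -
  let ?w = "\<lambda>x. exp (Ln (u 0) / k) * exp (Ln (u x / u 0) / of_nat k)"
  have 1: "hol_germ (\<lambda>x. u x / u 0)" by (intro hol_intros assms)
  have "hol_germ ?w"
    by (intro hol_germ_mult hol_germ_const hol_germ_outer[of "\<lambda>x. u x / u 0" "\<lambda>z. exp (Ln z / of_nat k)"] 1)
       (use assms in \<open>auto intro!: analytic_intros\<close>)
  moreover have "\<forall>\<^sub>F x in nhds 0. ?w x ^ k = u x"
    using hol_germ_nonzero[OF assms(1,2)]
    by eventually_elim (use assms in \<open>simp add: power_mult_distrib exp_of_nat_mult[symmetric]\<close>)
  ultimately show ?thesis by (intro exI[of _ ?w]) simp
qed

lemma map_germ_tendsto:
  assumes "hol_map_germ \<Phi>" "\<Phi> 0 = 0" shows "(\<Phi> \<longlongrightarrow> 0) (nhds 0)"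
  using hol_germ_tendsto[of "\<lambda>x. \<Phi> x $ i" for i] assms
  by (intro vec_tendstoI) (simp add: hol_map_germ_def)

lemma eventually_compose:
  assumes "hol_map_germ \<Phi>" "\<Phi> 0 = 0" "\<forall>\<^sub>F y in nhds 0. P y"
  shows "\<forall>\<^sub>F x in nhds 0. P (\<Phi> x)"
  using map_germ_tendsto[OF assms(1,2)] assms(3) by (simp add: filterlim_iff)

lemma hol_germ_compose:
  assumes "hol_map_germ \<Phi>" "\<Phi> 0 = 0" "hol_germ f" shows "hol_germ (\<lambda>x. f (\<Phi> x))"
proof -
  have "\<forall>\<^sub>F x in nhds 0. \<forall>i. hol_at (\<lambda>x. \<Phi> x $ i) x"
    using assms(1) by (simp add: hol_map_germ_def hol_germ_iff eventually_all_finite)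
  moreover have "\<forall>\<^sub>F x in nhds 0. hol_at f (\<Phi> x)"
    using eventually_compose[OF assms(1,2)] assms(3) by (simp add: hol_germ_iff)
  ultimately show ?thesis unfolding hol_germ_iff
    by eventually_elim (blast intro: hol_at_compose)
qed

section \<open>Hadamard's lemma\<close>

text \<open>
  Setting the coordinates in \<open>A\<close> to zero one after another, each step is one
  division by a coordinate.
\<close>

lemma hol_germ_hadamard_set:
  fixes f :: "complex ^ 'n \<Rightarrow> complex"
  assumes "finite A" "hol_germ f"
  shows "\<exists>h. (\<forall>i. hol_germ (h i)) \<and>
    (\<forall>\<^sub>F x in nhds 0. f x = f (\<chi> j. if j \<in> A then 0 else x $ j) + (\<Sum>i\<in>A. x $ i * h i x))"
  using assms(1)
proof (induction A rule: finite_induct)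
  case empty
  have "(\<chi> j. x $ j) = x" for x :: "complex ^ 'n" by (simp add: vec_eq_iff)
  thus ?case by (auto intro!: exI[of _ "\<lambda>_ _. 0"] hol_intros)
next
  case (insert i A)
  let ?z = "\<lambda>A x. (\<chi> j. if j \<in> A then 0 else x $ j) :: complex ^ 'n"
  obtain h where h: "\<And>i. hol_germ (h i)" "\<forall>\<^sub>F x in nhds 0. f x = f (?z A x) + (\<Sum>i\<in>A. x $ i * h i x)"
    using insert.IH by blast
  have "hol_germ (\<lambda>x. f (?z A x))"
  proof (rule hol_germ_compose[OF _ _ assms(2)])
    have "hol_germ (\<lambda>x. if j \<in> A then 0 else x $ j)" for j
      by (cases "j \<in> A") (simp_all add: hol_intros)
    thus "hol_map_germ (?z A)" by (simp add: hol_map_germ_def)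
  qed (simp add: vec_eq_iff)
  from hol_germ_difference_quotient[OF this, of i] obtain g where
    g: "hol_germ g" "\<forall>\<^sub>F x in nhds 0. f (?z A x) = f (?z A (set_coord i 0 x)) + x $ i * g x"
    by blast
  have z: "?z A (set_coord i 0 x) = ?z (insert i A) x" for x by (simp add: vec_eq_iff set_coord_nth)
  have "\<forall>\<^sub>F x in nhds 0. f x = f (?z (insert i A) x) + (\<Sum>j\<in>insert i A. x $ j * (h(i := g)) j x)"
    using h(2) g(2)
  proof eventually_elim
    case (elim x)
    have "(\<Sum>j\<in>A. x $ j * (h(i := g)) j x) = (\<Sum>j\<in>A. x $ j * h j x)"
      by (rule sum.cong) (use insert.hyps in auto)
    thus ?case using elim insert.hyps by (simp add: z)
  qed
  moreover have "\<forall>j. hol_germ ((h(i := g)) j)" using h g by simp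
  ultimately show ?case by blast
qed

lemma hol_germ_hadamard:
  fixes f :: "complex ^ 'n \<Rightarrow> complex"
  assumes "hol_germ f"
  shows "\<exists>h. (\<forall>i. hol_germ (h i)) \<and> (\<forall>\<^sub>F x in nhds 0. f x = f 0 + (\<Sum>i\<in>UNIV. x $ i * h i x))"
proof -
  have "(\<chi> j. if j \<in> UNIV then 0 else x $ j) = (0 :: complex ^ 'n)" for x by (simp add: vec_eq_iff)
  thus ?thesis using hol_germ_hadamard_set[OF finite_class.finite_UNIV assms] by simp
qed

section \<open>Inverse functions and arcs\<close>

text \<open>
  The real inverse function theorem gives a differentiable inverse; its derivative is the
  inverse of a complex linear map and therefore complex linear. Continuity of the derivative
  holds because the partial derivatives are holomorphic.
\<close>

lemma injective_derivative_coordinate_change: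
  fixes \<Phi> :: "complex ^ 'n \<Rightarrow> complex ^ 'n"
  assumes "hol_map_germ \<Phi>" "\<Phi> 0 = 0" "(\<Phi> has_derivative L) (at 0)" "\<And>v. L v = 0 \<Longrightarrow> v = 0"
  shows "coordinate_change \<Phi>"
proof -
  define J where "J x v = (\<chi> i. \<Sum>j\<in>UNIV. v $ j * partial_deriv j (\<lambda>x. \<Phi> x $ i) x)" for x v
  have "\<forall>\<^sub>F x in nhds 0. \<forall>i j. hol_at (\<lambda>x. \<Phi> x $ i) x \<and> hol_at (partial_deriv j (\<lambda>x. \<Phi> x $ i)) x"
    using assms(1) hol_germ_partial_deriv by (auto simp: hol_map_germ_def hol_germ_iff intro!: eventually_all_finite eventually_conj)
  then obtain U where U: "open U" "0 \<in> U"
    "\<And>x i j. x \<in> U \<Longrightarrow> hol_at (\<lambda>x. \<Phi> x $ i) x" "\<And>x i j. x \<in> U \<Longrightarrow> hol_at (partial_deriv j (\<lambda>x. \<Phi> x $ i)) x"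
    unfolding eventually_nhds by blast
  have der: "(\<Phi> has_derivative J x) (at x)" if "x \<in> U" for x
    using has_derivative_vec_components[OF hol_at_has_derivative_partial_deriv[OF U(3)[OF that]]]
    unfolding J_def[abs_def] .
  have Jc: "J x (c *s v) = c *s J x v" for x c v
    by (simp add: J_def vec_eq_iff sum_distrib_left mult.assoc)
  have bl: "blinfun_apply (Blinfun (J x)) = J x" if "x \<in> U" for x
    by (rule bounded_linear_Blinfun_apply[OF has_derivative_bounded_linear[OF der[OF that]]])
  have cont: "continuous_on U (\<lambda>x. Blinfun (J x))"
  proof (rule continuous_on_blinfun_componentwise)
    fix v :: "complex ^ 'n"
    have "continuous_on U (partial_deriv j (\<lambda>x. \<Phi> x $ i))" for i j
      using U(4) hol_at_continuous continuous_at_imp_continuous_on by blast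
    hence "continuous_on U (\<lambda>x. J x v)" unfolding J_def by (intro continuous_intros)
    thus "continuous_on U (\<lambda>x. blinfun_apply (Blinfun (J x)) v)"
      by (rule continuous_on_eq) (simp add: bl)
  qed
  have LJ: "L = J 0" by (rule has_derivative_unique[OF assms(3) der[OF U(2)]])
  have lin: "linear (J 0)" using der[OF U(2)] by (rule has_derivative_linear)
  hence "inj (J 0)" using assms(4) unfolding LJ by (simp add: linear_injective_0)
  then obtain g0 where g0: "linear g0" "g0 \<circ> J 0 = id"
    using linear_injective_left_inverse[OF lin] by blast
  have g0b: "bounded_linear g0" using g0(1) by (simp add: linear_conv_bounded_linear)
  have inv: "Blinfun g0 o\<^sub>L Blinfun (J 0) = id_blinfun"
    by (rule blinfun_eqI) (use g0(2) in \<open>simp add: bl U(2) bounded_linear_Blinfun_apply[OF g0b] fun_eq_iff\<close>)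
  obtain U' V g g' where F: "open U'" "U' \<subseteq> U" "0 \<in> U'" "open V" "\<Phi> 0 \<in> V" "homeomorphism U' V \<Phi> g"
    "\<And>y. y \<in> V \<Longrightarrow> (g has_derivative (g' y)) (at y)"
    "\<And>y. y \<in> V \<Longrightarrow> g' y = inv (blinfun_apply (Blinfun (J (g y))))"
    "\<And>y. y \<in> V \<Longrightarrow> bij (blinfun_apply (Blinfun (J (g y))))"
  proof (rule inverse_function_theorem[OF U(1) _ cont U(2) inv])
    show "(\<Phi> has_derivative blinfun_apply (Blinfun (J x))) (at x)" if "x \<in> U" for x
      using der[OF that] by (simp add: bl[OF that])
  qed blast
  have gU: "g y \<in> U" if "y \<in> V" for y
    using F(2,6) that by (auto simp: homeomorphism_def)
  have "hol_at (\<lambda>y. g y $ i) y" if y: "y \<in> V" for y i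
  proof -
    have b: "bij (J (g y))" and gi: "g' y = inv (J (g y))"
      using F(8,9)[OF y] bl[OF gU[OF y]] by simp_all
    have "g' y (c *s v) = c *s g' y v" for c v
      unfolding gi
    proof (rule inv_f_eq[OF bij_is_inj[OF b]])
      show "J (g y) (c *s inv (J (g y)) v) = c *s v"
        by (simp add: Jc surj_f_inv_f[OF bij_is_surj[OF b]])
    qed
    moreover have "((\<lambda>y. g y $ i) has_derivative (\<lambda>v. g' y v $ i)) (at y)"
      by (rule bounded_linear.has_derivative[OF bounded_linear_vec_nth F(7)[OF y]])
    ultimately show ?thesis by (intro hol_atI) auto
  qed
  moreover have V0: "0 \<in> V" using F(5) assms(2) by simp
  ultimately have "hol_map_germ g"
    unfolding hol_map_germ_def hol_germ_iff eventually_nhds using F(4) by blast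
  moreover have "g 0 = 0" using F(3,6) assms(2) by (auto simp: homeomorphism_def)
  moreover have "\<forall>\<^sub>F x in nhds 0. g (\<Phi> x) = x \<and> \<Phi> (g x) = x"
    unfolding eventually_nhds
    by (rule exI[of _ "U' \<inter> V"]) (use F(1,3,4,6) V0 in \<open>auto simp: homeomorphism_def\<close>)
  ultimately show ?thesis unfolding coordinate_change_def using assms(1,2) by blast
qed

lemma analytic_at_iff_eventually:
  "f analytic_on {z} \<longleftrightarrow> (\<forall>\<^sub>F w in nhds z. f field_differentiable (at w))"
proof
  assume "f analytic_on {z}"
  then obtain S where S: "open S" "z \<in> S" "f holomorphic_on S" by (auto simp: analytic_at)
  thus "\<forall>\<^sub>F w in nhds z. f field_differentiable (at w)"
    unfolding eventually_nhds using holomorphic_on_imp_differentiable_at by blast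
next
  assume "\<forall>\<^sub>F w in nhds z. f field_differentiable (at w)"
  then obtain S where S: "open S" "z \<in> S" "\<And>w. w \<in> S \<Longrightarrow> f field_differentiable (at w)"
    unfolding eventually_nhds by blast
  hence "f holomorphic_on S" by (auto simp: holomorphic_on_def field_differentiable_at_within)
  thus "f analytic_on {z}" using S by (auto simp: analytic_at)
qed

lemma curve_tendsto:
  fixes \<phi> :: "complex \<Rightarrow> complex ^ 'n"
  assumes "\<And>i. (\<lambda>t. \<phi> t $ i) analytic_on {0}" "\<phi> 0 = 0"
  shows "(\<phi> \<longlongrightarrow> 0) (nhds 0)"
proof -
  have "((\<lambda>t. \<phi> t $ i) \<longlongrightarrow> \<phi> 0 $ i) (nhds 0)" for i
    using analytic_at_imp_isCont[OF assms(1)[of i]]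
    by (simp add: isCont_def tendsto_at_iff_tendsto_nhds[where g = "\<lambda>t. \<phi> t $ i"])
  thus ?thesis using assms(2) by (intro vec_tendstoI) simp
qed

lemma analytic_compose_hol_germ:
  fixes \<phi> :: "complex \<Rightarrow> complex ^ 'n"
  assumes "hol_germ f" "\<And>i. (\<lambda>t. \<phi> t $ i) analytic_on {0}" "\<phi> 0 = 0"
  shows "(\<lambda>t. f (\<phi> t)) analytic_on {0}"
proof -
  have "\<forall>\<^sub>F t in nhds 0. \<forall>i. (\<lambda>t. \<phi> t $ i) field_differentiable (at t)"
    using assms(2) by (intro eventually_all_finite) (simp add: analytic_at_iff_eventually)
  moreover have "\<forall>\<^sub>F t in nhds 0. hol_at f (\<phi> t)"
    using curve_tendsto[OF assms(2,3)] assms(1) unfolding hol_germ_iff filterlim_iff by blast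
  ultimately show ?thesis unfolding analytic_at_iff_eventually
    by eventually_elim (blast intro: field_differentiable_compose_hol_at)
qed

text \<open>
  The exponent is tied to \<open>zorder\<close>, in terms of which orders along arcs are
  defined.
\<close>

lemma analytic_factor_order:
  fixes c :: "complex \<Rightarrow> complex"
  assumes "c analytic_on {0}" "\<not> (\<forall>\<^sub>F t in nhds 0. c t = 0)"
  shows "\<exists>m w. w analytic_on {0} \<and> w 0 \<noteq> 0 \<and> (\<forall>\<^sub>F t in nhds 0. c t = t ^ m * w t) \<and> m = nat (zorder c 0)"
proof -
  obtain r where r: "r > 0" "c holomorphic_on ball 0 r"
    using assms(1) by (auto simp: analytic_on_def)
  have "\<exists>w\<in>ball 0 r. c w \<noteq> 0"
  proof (rule ccontr)
    assume "\<not> ?thesis"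
    hence "\<forall>\<^sub>F t in nhds 0. c t = 0"
      unfolding eventually_nhds by (intro exI[of _ "ball 0 r"]) (use r in auto)
    thus False using assms(2) by simp
  qed
  from zorder_exist_zero[OF r(2) open_ball _ _ this, of 0] r(1) convex_connected[OF convex_ball, of "0::complex" r]
  have "\<exists>e>0. zor_poly c 0 holomorphic_on cball 0 e \<and>
    (\<forall>w\<in>cball 0 e. c w = zor_poly c 0 w * (w - 0) ^ nat (zorder c 0) \<and> zor_poly c 0 w \<noteq> 0)"
    by fastforce
  then obtain e where e: "e > 0" "zor_poly c 0 holomorphic_on cball 0 e"
    "\<And>w. w \<in> cball 0 e \<Longrightarrow> c w = zor_poly c 0 w * (w - 0) ^ nat (zorder c 0) \<and> zor_poly c 0 w \<noteq> 0"
    by blast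
  have "zor_poly c 0 analytic_on {0}"
    unfolding analytic_at by (rule exI[of _ "ball 0 e"])
      (use e(1) holomorphic_on_subset[OF e(2) ball_subset_cball] in auto)
  moreover have "\<forall>\<^sub>F t in nhds 0. c t = t ^ nat (zorder c 0) * zor_poly c 0 t"
    unfolding eventually_nhds by (rule exI[of _ "ball 0 e"]) (use e in auto)
  ultimately show ?thesis using e(3)[of 0] e(1) by (intro exI[of _ "nat (zorder c 0)"] exI[of _ "zor_poly c 0"]) auto
qed

lemma hol_germ_outer0:
  assumes "hol_germ f" "f 0 = 0" "h analytic_on {0}" shows "hol_germ (\<lambda>x. h (f x))"
  using hol_germ_outer[of f h] assms by simp

lemma eventually_compose_germ:
  assumes "hol_germ f" "f 0 = 0" "\<forall>\<^sub>F y in nhds 0. P y" shows "\<forall>\<^sub>F x in nhds 0. P (f x)"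
  using hol_germ_tendsto[OF assms(1)] assms(2,3) by (simp add: filterlim_iff)

section \<open>Coordinates of the plane\<close>

text \<open>
  Coordinates \<open>X, Y\<close> are kept as functions of the original point. A change of
  coordinates then replaces \<open>X\<close> and \<open>Y\<close> by other germs and leaves the
  coefficients of an expansion alone, so no germ ever has to be composed with a substitution.
\<close>

definition chart :: "(complex ^ 2 \<Rightarrow> complex) \<Rightarrow> (complex ^ 2 \<Rightarrow> complex) \<Rightarrow> bool" where
  "chart X Y \<longleftrightarrow> hol_germ X \<and> hol_germ Y \<and> X 0 = 0 \<and> Y 0 = 0 \<and>
     (\<exists>DX DY. (X has_derivative DX) (at 0) \<and> (Y has_derivative DY) (at 0) \<and>
        (\<forall>v. DX v = 0 \<and> DY v = 0 \<longrightarrow> v = 0))"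

lemma chartD: assumes "chart X Y" shows "hol_germ X" "hol_germ Y" "X 0 = 0" "Y 0 = 0"
  using assms by (auto simp: chart_def)

lemma chart_sym: "chart X Y \<Longrightarrow> chart Y X"
  unfolding chart_def by blast

lemma hol_germ_at_0: "hol_germ f \<Longrightarrow> hol_at f 0"
  unfolding hol_germ_iff by (rule eventually_nhds_x_imp_x)

lemma vec2_eqI: "p $ 1 = q $ 1 \<Longrightarrow> p $ 2 = q $ 2 \<Longrightarrow> p = (q :: complex ^ 2)"
  by (simp add: vec_eq_iff forall_2)

lemma zero_vec2: "vector [0, 0] = (0 :: complex ^ 2)"
  by (simp add: vec_eq_iff forall_2)

lemma vector2_eta: "vector [p $ 1, p $ 2] = (p :: complex ^ 2)"
  by (simp add: vec_eq_iff forall_2)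

lemma map_germ_vector2:
  "hol_germ f \<Longrightarrow> hol_germ g \<Longrightarrow> hol_map_germ (\<lambda>p. vector [f p, g p] :: complex ^ 2)"
  by (simp add: hol_map_germ_def forall_2)

lemma chart_standard: "chart (\<lambda>p. p $ 1) (\<lambda>p. p $ 2)"
proof -
  have d: "((\<lambda>p :: complex ^ 2. p $ i) has_derivative (\<lambda>v. v $ i)) (at 0)" for i
    by (rule bounded_linear.has_derivative[OF bounded_linear_vec_nth has_derivative_ident])
  show ?thesis unfolding chart_def
    using d[of 1] d[of 2]
    by (intro conjI hol_intros exI[of _ "\<lambda>v. v $ 1"] exI[of _ "\<lambda>v. v $ 2"]) (auto simp: vec_eq_iff forall_2)
qed

lemma chart_coordinate_change:
  assumes "chart X Y" shows "coordinate_change (\<lambda>p. vector [X p, Y p])"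
proof -
  obtain DX DY where D: "(X has_derivative DX) (at 0)" "(Y has_derivative DY) (at 0)"
    "\<And>v. DX v = 0 \<Longrightarrow> DY v = 0 \<Longrightarrow> v = 0" using assms unfolding chart_def by blast
  have "((\<lambda>p. vector [X p, Y p] :: complex ^ 2) has_derivative (\<lambda>v. \<chi> i. if i = 1 then DX v else DY v)) (at 0)"
  proof (rule has_derivative_vec_components)
    fix i :: 2
    show "((\<lambda>x. (vector [X x, Y x] :: complex ^ 2) $ i) has_derivative (\<lambda>v. if i = 1 then DX v else DY v)) (at 0)"
      using exhaust_2[of i] D(1,2) by auto
  qed
  from injective_derivative_coordinate_change[OF _ _ this] show ?thesis
    using chartD[OF assms] D(3) by (auto simp: map_germ_vector2 zero_vec2 vec_eq_iff forall_2)
qed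

lemma coordinate_change_inverse:
  assumes "coordinate_change \<Phi>"
  obtains \<Psi> where "coordinate_change \<Psi>" "\<forall>\<^sub>F x in nhds 0. \<Psi> (\<Phi> x) = x \<and> \<Phi> (\<Psi> x) = x"
proof -
  from assms obtain \<Psi> where P: "hol_map_germ \<Phi>" "\<Phi> 0 = 0" "hol_map_germ \<Psi>" "\<Psi> 0 = 0"
    "\<forall>\<^sub>F x in nhds 0. \<Psi> (\<Phi> x) = x \<and> \<Phi> (\<Psi> x) = x"
    unfolding coordinate_change_def by blast
  have "\<forall>\<^sub>F x in nhds 0. \<Phi> (\<Psi> x) = x \<and> \<Psi> (\<Phi> x) = x"
    using P(5) by (simp add: conj_commute)
  thus ?thesis using P by (intro that[of \<Psi>]) (auto simp: coordinate_change_def)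
qed

lemma chart_inverse:
  assumes "chart X Y"
  shows "\<exists>\<Phi>. coordinate_change \<Phi> \<and> hol_map_germ \<Phi> \<and> \<Phi> 0 = 0 \<and>
    (\<forall>\<^sub>F p in nhds 0. X (\<Phi> p) = p $ 1) \<and> (\<forall>\<^sub>F p in nhds 0. Y (\<Phi> p) = p $ 2) \<and>
    (\<forall>\<^sub>F p in nhds 0. \<Phi> (vector [X p, Y p]) = p)"
proof -
  obtain \<Psi> where P: "coordinate_change \<Psi>"
    "\<forall>\<^sub>F x in nhds 0. \<Psi> (vector [X x, Y x]) = x \<and> (vector [X (\<Psi> x), Y (\<Psi> x)] :: complex ^ 2) = x"
    using coordinate_change_inverse[OF chart_coordinate_change[OF assms]] by blast
  have "\<forall>\<^sub>F p in nhds 0. X (\<Psi> p) = p $ 1" "\<forall>\<^sub>F p in nhds 0. Y (\<Psi> p) = p $ 2"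
    using P(2) by (eventually_elim, metis vector_2)+
  moreover have "\<forall>\<^sub>F p in nhds 0. \<Psi> (vector [X p, Y p]) = p"
    using P(2) by eventually_elim blast
  ultimately show ?thesis using P(1) unfolding coordinate_change_def by (intro exI[of _ \<Psi>]) simp
qed

text \<open>
  Passes from an expansion in a chart to the substitution that contact equivalence asks for.
\<close>

lemma chart_contact_equivalent:
  assumes "chart X Y" "\<forall>\<^sub>F p in nhds 0. f p = G (vector [X p, Y p])"
  shows "contact_equivalent f G"
proof -
  obtain \<Phi> :: "complex ^ 2 \<Rightarrow> complex ^ 2" where P: "coordinate_change \<Phi>" "hol_map_germ \<Phi>" "\<Phi> 0 = 0"
    "\<forall>\<^sub>F p in nhds 0. X (\<Phi> p) = p $ 1" "\<forall>\<^sub>F p in nhds 0. Y (\<Phi> p) = p $ 2"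
    using chart_inverse[OF assms(1)] by blast
  have "\<forall>\<^sub>F p in nhds 0. 1 * f (\<Phi> p) = G p"
    using eventually_compose[OF P(2,3) assms(2)] P(4,5)
    by eventually_elim (simp add: vector2_eta)
  thus ?thesis unfolding contact_equivalent_def using P(1)
    by (intro exI[of _ \<Phi>] exI[of _ "\<lambda>_. 1"]) (simp add: hol_germ_const)
qed

text \<open>
  The matrix of a coordinate change may have germs as entries: modulo higher order only its
  value at 0 acts on the differentials.
\<close>

lemma chart_change:
  assumes "chart X Y" "hol_germ a" "hol_germ b" "hol_germ c" "hol_germ d" "a 0 * d 0 - b 0 * c 0 \<noteq> 0"
  shows "chart (\<lambda>p. a p * X p + b p * Y p) (\<lambda>p. c p * X p + d p * Y p)"
proof -
  obtain DX DY where D: "(X has_derivative DX) (at 0)" "(Y has_derivative DY) (at 0)"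
    "\<And>v. DX v = 0 \<Longrightarrow> DY v = 0 \<Longrightarrow> v = 0" using assms unfolding chart_def by blast
  note C = chartD[OF assms(1)]
  have der: "\<exists>D. (f has_derivative D) (at 0)" if "hol_germ f" for f :: "complex ^ 2 \<Rightarrow> complex"
    using hol_germ_at_0[OF that] unfolding hol_at_def by blast
  have lin: "((\<lambda>p. u p * X p + v p * Y p) has_derivative (\<lambda>h. u 0 * DX h + v 0 * DY h)) (at 0)"
    if uv: "hol_germ u" "hol_germ v" for u v
  proof -
    obtain Du Dv where "(u has_derivative Du) (at 0)" "(v has_derivative Dv) (at 0)"
      using der[OF uv(1)] der[OF uv(2)] by blast
    from has_derivative_add[OF has_derivative_mult[OF this(1) D(1)] has_derivative_mult[OF this(2) D(2)]]
    show ?thesis using C by simp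
  qed
  have "h = 0" if "a 0 * DX h + b 0 * DY h = 0" "c 0 * DX h + d 0 * DY h = 0" for h
  proof (rule D(3))
    have "(a 0 * d 0 - b 0 * c 0) * DX h = 0" "(a 0 * d 0 - b 0 * c 0) * DY h = 0"
      using that by algebra+
    thus "DX h = 0" "DY h = 0" using assms(6) by simp_all
  qed
  thus ?thesis unfolding chart_def
    using lin[OF assms(2,3)] lin[OF assms(4,5)] C assms(2-5)
    by (intro conjI hol_intros exI[of _ "\<lambda>h. a 0 * DX h + b 0 * DY h"] exI[of _ "\<lambda>h. c 0 * DX h + d 0 * DY h"]) auto
qed

lemma chart_units:
  assumes "chart X Y" "hol_germ u" "hol_germ w" "u 0 \<noteq> 0" "w 0 \<noteq> 0"
  shows "chart (\<lambda>p. u p * X p) (\<lambda>p. w p * Y p)"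
  using chart_change[OF assms(1,2) hol_germ_const[of 0] hol_germ_const[of 0] assms(3)] assms(4,5) by simp

lemma chart_shift:
  assumes "chart X Y" "hol_germ k" shows "chart (\<lambda>p. X p + k p * Y p) Y"
  using chart_change[OF assms(1) hol_germ_const[of 1] assms(2) hol_germ_const[of 0] hol_germ_const[of 1]] by simp

lemma chart_hadamard:
  assumes "chart X Y" "hol_germ f"
  obtains U W where "hol_germ U" "hol_germ W" "\<forall>\<^sub>F p in nhds 0. f p = f 0 + X p * U p + Y p * W p"
proof -
  obtain \<Phi> :: "complex ^ 2 \<Rightarrow> complex ^ 2" where P: "hol_map_germ \<Phi>" "\<Phi> 0 = 0"
    "\<forall>\<^sub>F p in nhds 0. X (\<Phi> p) = p $ 1" "\<forall>\<^sub>F p in nhds 0. Y (\<Phi> p) = p $ 2"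
    "\<forall>\<^sub>F p in nhds 0. \<Phi> (vector [X p, Y p]) = p"
    using chart_inverse[OF assms(1)] by blast
  note C = chartD[OF assms(1)]
  let ?T = "\<lambda>p. vector [X p, Y p] :: complex ^ 2"
  have T: "hol_map_germ ?T" "?T 0 = 0" using C by (simp_all add: map_germ_vector2 zero_vec2)
  obtain h where h: "\<And>i. hol_germ (h i)"
     "\<forall>\<^sub>F x in nhds 0. f (\<Phi> x) = f (\<Phi> 0) + (\<Sum>i\<in>UNIV. x $ i * h i x)"
    using hol_germ_hadamard[OF hol_germ_compose[OF P(1,2) assms(2)]] by blast
  have "\<forall>\<^sub>F p in nhds 0. f p = f 0 + X p * h 1 (?T p) + Y p * h 2 (?T p)"
    using eventually_compose[OF T h(2)] P(5)
    by eventually_elim (simp add: sum_2 P(2))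
  thus ?thesis by (rule that[OF hol_germ_compose[OF T h(1)] hol_germ_compose[OF T h(1)]])
qed

text \<open>
  In the given coordinates this is division by a coordinate: the remaining term is the
  restriction of \<open>f\<close> to \<open>X = 0\<close>.
\<close>

lemma chart_division:
  assumes "chart X Y" "hol_germ f" "\<forall>\<^sub>F p in nhds 0. X p = 0 \<longrightarrow> f p = 0"
  obtains U where "hol_germ U" "\<forall>\<^sub>F p in nhds 0. f p = X p * U p"
proof -
  obtain \<Phi> :: "complex ^ 2 \<Rightarrow> complex ^ 2" where P: "hol_map_germ \<Phi>" "\<Phi> 0 = 0"
    "\<forall>\<^sub>F p in nhds 0. X (\<Phi> p) = p $ 1" "\<forall>\<^sub>F p in nhds 0. Y (\<Phi> p) = p $ 2"
    "\<forall>\<^sub>F p in nhds 0. \<Phi> (vector [X p, Y p]) = p"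
    using chart_inverse[OF assms(1)] by blast
  note C = chartD[OF assms(1)]
  let ?T = "\<lambda>p. vector [X p, Y p] :: complex ^ 2"
  have T: "hol_map_germ ?T" "?T 0 = 0" using C by (simp_all add: map_germ_vector2 zero_vec2)
  obtain h where h: "hol_germ h" "\<forall>\<^sub>F x in nhds 0. f (\<Phi> x) = f (\<Phi> (set_coord 1 0 x)) + x $ 1 * h x"
    using hol_germ_difference_quotient[OF hol_germ_compose[OF P(1,2) assms(2)], of 1] by blast
  have u: "hol_map_germ (set_coord 1 0 :: complex ^ 2 \<Rightarrow> complex ^ 2)"
    by (simp add: hol_map_germ_def forall_2 set_coord_nth hol_intros)
  have "\<forall>\<^sub>F p in nhds 0. f p = X p * h (?T p)"
    using eventually_compose[OF T h(2)] P(5)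
       eventually_compose[OF T eventually_compose[OF u set_coord_0 P(3)]]
       eventually_compose[OF T eventually_compose[OF u set_coord_0 eventually_compose[OF P(1,2) assms(3)]]]
    by eventually_elim (simp add: set_coord_nth)
  thus ?thesis by (rule that[OF hol_germ_compose[OF T h(1)]])
qed

text \<open>
  The pair of \<open>H\<close> and the second coordinate is a chart, and the zero set of
  \<open>H\<close> is an axis in it.
\<close>

lemma implicit_function:
  fixes H :: "complex ^ 2 \<Rightarrow> complex"
  assumes "hol_germ H" "H 0 = 0" "((\<lambda>s. H (vector [s, 0])) has_field_derivative d) (at 0)" "d \<noteq> 0"
  obtains \<sigma> where "\<sigma> analytic_on {0}" "\<sigma> 0 = 0" "\<forall>\<^sub>F y in nhds 0. H (vector [\<sigma> y, y]) = 0"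
proof -
  obtain D where D: "(H has_derivative D) (at 0)" "\<And>c v. D (c *s v) = c * D v"
    using hol_germ_at_0[OF assms(1)] unfolding hol_at_def by blast
  have e: "vector [s, 0] = (0 + s *s axis 1 1 :: complex ^ 2)" for s :: complex
    by (rule vec2_eqI) (simp_all add: axis_def)
  have "(\<lambda>s. H (vector [s, 0])) = (\<lambda>s. H (0 + s *s axis 1 1))" by (simp only: e)
  moreover have "((\<lambda>s. H (0 + s *s axis 1 1)) has_field_derivative D (axis 1 1)) (at 0)"
    by (rule slice_derivative) (use D in simp_all)
  ultimately have "((\<lambda>s. H (vector [s, 0])) has_field_derivative D (axis 1 1)) (at 0)" by simp
  hence d: "D (axis 1 1) \<noteq> 0" using assms(3,4) DERIV_unique by blast
  have "v = 0" if v: "D v = 0" "v $ 2 = 0" for v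
  proof -
    have "v = v $ 1 *s axis 1 1" using v(2) by (intro vec2_eqI) (simp_all add: axis_def)
    hence "D v = v $ 1 * D (axis 1 1)" by (metis D(2))
    thus ?thesis using v d by (simp add: vec_eq_iff forall_2)
  qed
  moreover have "((\<lambda>p :: complex ^ 2. p $ 2) has_derivative (\<lambda>v. v $ 2)) (at 0)"
    by (rule bounded_linear.has_derivative[OF bounded_linear_vec_nth has_derivative_ident])
  ultimately have "chart H (\<lambda>p. p $ 2)"
    unfolding chart_def using assms(1,2) D(1) hol_germ_coord by auto
  from chart_inverse[OF this] obtain \<Phi> :: "complex ^ 2 \<Rightarrow> complex ^ 2" where P: "hol_map_germ \<Phi>" "\<Phi> 0 = 0"
    "\<forall>\<^sub>F p in nhds 0. H (\<Phi> p) = p $ 1" "\<forall>\<^sub>F p in nhds 0. \<Phi> p $ 2 = p $ 2"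
    by blast
  have c: "(\<lambda>y. (vector [0, y] :: complex ^ 2) $ i) analytic_on {0}" for i
    using exhaust_2[of i] by (auto intro!: analytic_intros)
  have a: "(\<lambda>y. \<Phi> (vector [0, y]) $ 1) analytic_on {0}"
    by (rule analytic_compose_hol_germ[OF _ c]) (use P(1) in \<open>simp_all add: hol_map_germ_def zero_vec2\<close>)
  have t: "((\<lambda>y. vector [0, y] :: complex ^ 2) \<longlongrightarrow> 0) (nhds 0)"
    by (rule curve_tendsto[OF c]) (simp add: zero_vec2)
  have "\<forall>\<^sub>F y in nhds 0. H (\<Phi> (vector [0, y])) = (vector [0, y] :: complex ^ 2) $ 1"
    using t P(3) unfolding filterlim_iff by blast
  moreover have "\<forall>\<^sub>F y in nhds 0. \<Phi> (vector [0, y]) $ 2 = (vector [0, y] :: complex ^ 2) $ 2"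
    using t P(4) unfolding filterlim_iff by blast
  ultimately have "\<forall>\<^sub>F y in nhds 0. H (vector [\<Phi> (vector [0, y]) $ 1, y]) = 0"
  proof eventually_elim
    case (elim y)
    have "vector [\<Phi> (vector [0, y]) $ 1, y] = \<Phi> (vector [0, y])"
      using elim(2) by (simp add: vec_eq_iff forall_2)
    thus ?case using elim(1) by simp
  qed
  thus ?thesis using that[OF a] P(2) by (simp add: zero_vec2)
qed

section \<open>Orders of vanishing\<close>

text \<open>
  Order of vanishing as a growth bound. It is additive on products and passes to arcs by
  composition, with no derivatives involved; for one-variable germs it agrees with
  \<open>vanishing_order\<close> (\<open>vanishing_order_ge_iff\<close>).
\<close>

definition vanish :: "nat \<Rightarrow> ('a::real_normed_vector \<Rightarrow> complex) \<Rightarrow> bool" where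
  "vanish k f \<longleftrightarrow> (\<exists>c. \<forall>\<^sub>F x in nhds 0. norm (f x) \<le> c * norm x ^ k)"

lemma vanishE:
  assumes "vanish k f"
  obtains c where "c \<ge> 0" "\<forall>\<^sub>F x in nhds 0. norm (f x) \<le> c * norm x ^ k"
proof -
  obtain c where c: "\<forall>\<^sub>F x in nhds 0. norm (f x) \<le> c * norm x ^ k"
    using assms unfolding vanish_def by blast
  have "\<forall>\<^sub>F x in nhds 0. norm (f x) \<le> \<bar>c\<bar> * norm x ^ k"
    using c by eventually_elim (rule order_trans, assumption, simp add: mult_right_mono)
  thus ?thesis by (intro that[of "\<bar>c\<bar>"]) auto
qed

lemma vanish_add: assumes "vanish k f" "vanish k g" shows "vanish k (\<lambda>x. f x + g x)"
proof -
  obtain c where c: "c \<ge> 0" "\<forall>\<^sub>F x in nhds 0. norm (f x) \<le> c * norm x ^ k"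
    using assms(1) by (rule vanishE)
  obtain d where d: "d \<ge> 0" "\<forall>\<^sub>F x in nhds 0. norm (g x) \<le> d * norm x ^ k"
    using assms(2) by (rule vanishE)
  have "\<forall>\<^sub>F x in nhds 0. norm (f x + g x) \<le> (c + d) * norm x ^ k"
    using c(2) d(2)
  proof eventually_elim
    case (elim x)
    thus ?case using norm_triangle_ineq[of "f x" "g x"] by (simp add: algebra_simps)
  qed
  thus ?thesis unfolding vanish_def by blast
qed

lemma vanish_mult: assumes "vanish k f" "vanish l g" shows "vanish (k + l) (\<lambda>x. f x * g x)"
proof -
  obtain c where c: "c \<ge> 0" "\<forall>\<^sub>F x in nhds 0. norm (f x) \<le> c * norm x ^ k"
    using assms(1) by (rule vanishE)
  obtain d where d: "d \<ge> 0" "\<forall>\<^sub>F x in nhds 0. norm (g x) \<le> d * norm x ^ l"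
    using assms(2) by (rule vanishE)
  have "\<forall>\<^sub>F x in nhds 0. norm (f x * g x) \<le> (c * d) * norm x ^ (k + l)"
    using c(2) d(2)
  proof eventually_elim
    case (elim x)
    have "norm (f x) * norm (g x) \<le> (c * norm x ^ k) * (d * norm x ^ l)"
      by (rule mult_mono) (use elim c(1) in auto)
    thus ?case by (simp add: norm_mult power_add mult_ac)
  qed
  thus ?thesis unfolding vanish_def by blast
qed

lemma vanish_mono: assumes "vanish k f" "l \<le> k" shows "vanish l f"
proof -
  obtain c where c: "c \<ge> 0" "\<forall>\<^sub>F x in nhds 0. norm (f x) \<le> c * norm x ^ k"
    using assms(1) by (rule vanishE)
  have "\<forall>\<^sub>F x :: 'a in nhds 0. norm x < 1"
    unfolding eventually_nhds_metric by (auto intro!: exI[of _ 1])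
  hence "\<forall>\<^sub>F x in nhds 0. norm (f x) \<le> c * norm x ^ l"
    using c(2)
  proof eventually_elim
    case (elim x)
    have "c * norm x ^ k \<le> c * norm x ^ l"
      by (rule mult_left_mono[OF power_decreasing]) (use elim assms(2) c(1) in auto)
    thus ?case using elim by linarith
  qed
  thus ?thesis unfolding vanish_def by blast
qed

lemma vanish_cong: assumes "vanish k f" "\<forall>\<^sub>F x in nhds 0. f x = g x" shows "vanish k g"
proof -
  obtain c where "\<forall>\<^sub>F x in nhds 0. norm (f x) \<le> c * norm x ^ k"
    using assms(1) unfolding vanish_def by blast
  with assms(2) have "\<forall>\<^sub>F x in nhds 0. norm (g x) \<le> c * norm x ^ k"
    by eventually_elim simp
  thus ?thesis unfolding vanish_def by blast
qed

lemma vanish_0: "vanish k (\<lambda>_. 0)"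
  unfolding vanish_def by (rule exI[of _ 0]) simp

lemma vanish_bounded: assumes "(f \<longlongrightarrow> f 0) (nhds 0)" shows "vanish 0 f"
proof -
  have "\<forall>\<^sub>F x in nhds 0. dist (f x) (f 0) < 1" using assms by (rule tendstoD) simp
  hence "\<forall>\<^sub>F x in nhds 0. norm (f x) \<le> (norm (f 0) + 1) * norm x ^ 0"
  proof eventually_elim
    case (elim x)
    thus ?case using norm_triangle_sub[of "f x" "f 0"] by (simp add: dist_norm)
  qed
  thus ?thesis unfolding vanish_def by blast
qed

lemma vanish_const: "vanish 0 (\<lambda>_. c)"
  by (rule vanish_bounded) simp

lemma vanish_hol_germ: "hol_germ f \<Longrightarrow> vanish 0 f"
  by (rule vanish_bounded, rule hol_germ_tendsto)

lemma vanish_sum: assumes "\<And>i. i \<in> A \<Longrightarrow> vanish k (f i)" shows "vanish k (\<lambda>x. \<Sum>i\<in>A. f i x)"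
  using assms by (induction A rule: infinite_finite_induct) (auto intro: vanish_add vanish_0)

lemma vanish_mult_left: assumes "vanish k g" "vanish 0 f" shows "vanish k (\<lambda>x. f x * g x)"
  using vanish_mult[OF assms(2,1)] by simp

lemma vanish_diff: assumes "vanish k f" "vanish k g" shows "vanish k (\<lambda>x. f x - g x)"
  using vanish_add[OF assms(1) vanish_mult_left[OF assms(2) vanish_const[of "-1"]]] by simp

lemma vanish_power: assumes "vanish k f" shows "vanish (k * n) (\<lambda>x. f x ^ n)"
proof (induction n)
  case 0 thus ?case by (simp add: vanish_const)
next
  case (Suc n) thus ?case using vanish_mult[OF assms Suc] by simp
qed

lemma vanish_coord: "vanish 1 (\<lambda>x :: complex ^ 'n. x $ i)"
  unfolding vanish_def by (rule exI[of _ 1]) (simp add: Finite_Cartesian_Product.norm_nth_le)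

lemma vanish_hol_germ_zero:
  fixes f :: "complex ^ 'n \<Rightarrow> complex"
  assumes "hol_germ f" "f 0 = 0" shows "vanish 1 f"
proof -
  obtain h where h: "\<And>i. hol_germ (h i)" "\<forall>\<^sub>F x in nhds 0. f x = f 0 + (\<Sum>i\<in>UNIV. x $ i * h i x)"
    using hol_germ_hadamard[OF assms(1)] by blast
  have "vanish (1 + 0) (\<lambda>x. x $ i * h i x)" for i
    by (rule vanish_mult[OF vanish_coord vanish_hol_germ[OF h(1)]])
  hence "vanish 1 (\<lambda>x. \<Sum>i\<in>UNIV. x $ i * h i x)" by (intro vanish_sum) simp
  thus ?thesis by (rule vanish_cong) (use h(2) assms(2) in \<open>auto elim: eventually_mono\<close>)
qed

lemma analytic_tendsto_nhds: "f analytic_on {0} \<Longrightarrow> (f \<longlongrightarrow> f 0) (nhds 0)"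
  using analytic_at_imp_isCont[of f 0] by (simp add: isCont_def tendsto_at_iff_tendsto_nhds)

lemma analytic_divide_t:
  fixes f :: "complex \<Rightarrow> complex"
  assumes "f analytic_on {0}" "f 0 = 0"
  obtains g where "g analytic_on {0}" "\<forall>\<^sub>F t in nhds 0. f t = t * g t"
proof (cases "\<forall>\<^sub>F t in nhds 0. f t = 0")
  case True
  thus ?thesis by (intro that[of "\<lambda>_. 0"]) auto
next
  case False
  then obtain m w where w: "w analytic_on {0}" "w 0 \<noteq> 0" "\<forall>\<^sub>F t in nhds 0. f t = t ^ m * w t"
    using analytic_factor_order[OF assms(1)] by blast
  have "m \<noteq> 0" using eventually_nhds_x_imp_x[OF w(3)] w(2) assms(2) by (cases m) auto
  then obtain n where "m = Suc n" by (cases m) auto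
  with w show ?thesis by (intro that[of "\<lambda>t. t ^ n * w t"]) (auto intro!: analytic_intros elim!: eventually_mono)
qed

section \<open>Branches and completion of squares\<close>

lemma chart_sub_function:
  assumes "chart X Y" "\<xi> analytic_on {0}" "\<xi> 0 = 0" shows "chart (\<lambda>p. X p - \<xi> (Y p)) Y"
proof -
  obtain DX DY where D: "(X has_derivative DX) (at 0)" "(Y has_derivative DY) (at 0)"
    "\<And>v. DX v = 0 \<Longrightarrow> DY v = 0 \<Longrightarrow> v = 0" using assms(1) unfolding chart_def by blast
  note C = chartD[OF assms(1)]
  obtain d where "(\<xi> has_field_derivative d) (at 0)"
    using assms(2) analytic_on_imp_differentiable_at[of \<xi> "{0}" 0] by (auto simp: field_differentiable_def)
  hence "(\<xi> has_derivative (*) d) (at (Y 0))" using C(4) by (simp add: has_field_derivative_def)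
  from has_derivative_diff[OF D(1) has_derivative_compose[OF D(2) this]]
  have "((\<lambda>p. X p - \<xi> (Y p)) has_derivative (\<lambda>v. DX v - d * DY v)) (at 0)" by simp
  moreover have "hol_germ (\<lambda>p. X p - \<xi> (Y p))"
    by (rule hol_germ_diff[OF C(1) hol_germ_outer0[OF C(2,4) assms(2)]])
  ultimately show ?thesis unfolding chart_def using C assms(3) D
    by (intro conjI exI[of _ "\<lambda>v. DX v - d * DY v"] exI[of _ DY]) auto
qed

text \<open>
  The substitution \<open>X = Y^m s\<close> is a blow-up. In the \<open>s\<close>-direction the
  cubic polynomial in \<open>s\<close> has non-zero derivative at its simple root
  \<open>\<sigma>\<close>, so the implicit function theorem continues the root to a function of
  \<open>Y\<close>. The cubic vanishes on the resulting curve \<open>X = Y^m s\<close> and is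
  divisible by its equation. For \<open>m = 1\<close> this finds the smooth branch in a
  direction that is a simple root of the cubic form, for \<open>m = 2\<close> a branch tangent
  to \<open>X = 0\<close>.
\<close>

lemma chart_branch:
  fixes a0 a1 a2 a3 :: "complex ^ 2 \<Rightarrow> complex"
  assumes "chart X Y" "hol_germ a0" "hol_germ a1" "hol_germ a2" "hol_germ a3" "m > 0"
    and root: "a0 0 + a1 0 * \<sigma> + a2 0 * \<sigma> ^ 2 + a3 0 * \<sigma> ^ 3 = 0"
    and simple: "a1 0 + 2 * a2 0 * \<sigma> + 3 * a3 0 * \<sigma> ^ 2 \<noteq> 0"
  obtains s E where "hol_germ s" "s 0 = \<sigma>" "hol_germ E"
    "\<forall>\<^sub>F p in nhds 0. a0 p + a1 p * s p + a2 p * s p ^ 2 + a3 p * s p ^ 3 = (X p - Y p ^ m * s p) * E p"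
proof -
  obtain \<Phi> :: "complex ^ 2 \<Rightarrow> complex ^ 2" where P: "hol_map_germ \<Phi>" "\<Phi> 0 = 0"
    "\<forall>\<^sub>F p in nhds 0. \<Phi> (vector [X p, Y p]) = p"
    using chart_inverse[OF assms(1)] by blast
  note C = chartD[OF assms(1)]
  \<comment> \<open>The blow-up in the coordinates \<open>(s - \<sigma>, Y)\<close>. It contracts
     the axis \<open>Y = 0\<close> to the origin, where the coefficients take their values at
     0.\<close>
  define M :: "complex ^ 2 \<Rightarrow> complex ^ 2" where "M q = vector [q $ 2 ^ m * (\<sigma> + q $ 1), q $ 2]" for q
  have M: "hol_map_germ M" "M 0 = 0"
    unfolding M_def using \<open>m > 0\<close> by (auto intro!: map_germ_vector2 hol_intros vec2_eqI)
  have b: "hol_germ (\<lambda>q. a (\<Phi> (M q)))" if "hol_germ a" for a :: "complex ^ 2 \<Rightarrow> complex"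
    by (rule hol_germ_compose[OF M hol_germ_compose[OF P(1,2) that]])
  define H where "H q = a0 (\<Phi> (M q)) + a1 (\<Phi> (M q)) * (\<sigma> + q $ 1) + a2 (\<Phi> (M q)) * (\<sigma> + q $ 1) ^ 2
      + a3 (\<Phi> (M q)) * (\<sigma> + q $ 1) ^ 3" for q
  have "hol_germ H" unfolding H_def 
    by (intro hol_intros b[OF assms(2)] b[OF assms(3)] b[OF assms(4)] b[OF assms(5)])
  moreover have "H 0 = 0" using root by (simp add: H_def M(2) P(2))
  moreover have "((\<lambda>s. H (vector [s, 0])) has_field_derivative (a1 0 + 2 * a2 0 * \<sigma> + 3 * a3 0 * \<sigma> ^ 2)) (at 0)"
  proof -
    have "M (vector [s, 0]) = 0" for s using \<open>m > 0\<close> by (intro vec2_eqI) (simp_all add: M_def)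
    hence "(\<lambda>s. H (vector [s, 0])) = (\<lambda>s. a0 0 + a1 0 * (\<sigma> + s) + a2 0 * (\<sigma> + s) ^ 2 + a3 0 * (\<sigma> + s) ^ 3)"
      by (simp add: H_def P(2))
    thus ?thesis by (auto intro!: derivative_eq_intros)
  qed
  ultimately obtain \<tau> where t: "\<tau> analytic_on {0}" "\<tau> 0 = 0" "\<forall>\<^sub>F y in nhds 0. H (vector [\<tau> y, y]) = 0"
    using simple by (rule implicit_function)
  define s where "s p = \<sigma> + \<tau> (Y p)" for p
  have s: "hol_germ s" unfolding s_def by (rule hol_germ_add[OF hol_germ_const hol_germ_outer0[OF C(2,4) t(1)]])
  have ch: "chart (\<lambda>p. X p - Y p ^ m * s p) Y"
    using chart_sub_function[OF assms(1), of "\<lambda>y. y ^ m * (\<sigma> + \<tau> y)"] t \<open>m > 0\<close>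
    by (simp add: s_def analytic_intros)
  let ?Q = "\<lambda>p. a0 p + a1 p * s p + a2 p * s p ^ 2 + a3 p * s p ^ 3"
  have Q: "hol_germ ?Q" by (intro hol_intros assms s)
  have "\<forall>\<^sub>F p in nhds 0. H (vector [\<tau> (Y p), Y p]) = 0"
    by (rule eventually_compose_germ[OF C(2,4) t(3)])
  hence "\<forall>\<^sub>F p in nhds 0. X p - Y p ^ m * s p = 0 \<longrightarrow> ?Q p = 0"
    using P(3)
  proof eventually_elim
    case (elim p)
    show ?case
    proof
      assume "X p - Y p ^ m * s p = 0"
      hence "vector [X p, Y p] = M (vector [\<tau> (Y p), Y p])" by (simp add: M_def s_def)
      hence "\<Phi> (M (vector [\<tau> (Y p), Y p])) = p" using elim(2) by simp
      thus "?Q p = 0" using elim(1) by (simp add: H_def s_def)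
    qed
  qed
  from chart_division[OF ch Q this] obtain E where "hol_germ E"
    "\<forall>\<^sub>F p in nhds 0. ?Q p = (X p - Y p ^ m * s p) * E p" by blast
  thus ?thesis using that[OF s] t(2) C(4) by (simp add: s_def)
qed

text \<open>
  The coefficient \<open>P\<close> depends on both variables, so the square cannot be completed
  algebraically. Instead the critical point \<open>\<xi>(y)\<close> of \<open>G\<close> on each
  line of constant \<open>y\<close> is found by the implicit function theorem. Relative to it
  the Taylor expansion in \<open>x\<close> has no linear term, and the critical value is
  divisible by \<open>y^2\<close>.
\<close>

lemma complete_square_standard:
  fixes G P Q R :: "complex ^ 2 \<Rightarrow> complex"
  assumes "hol_germ G" "hol_germ P" "hol_germ Q" "hol_germ R" "P 0 \<noteq> 0"
    and G: "\<forall>\<^sub>F x in nhds 0. G x = x $ 1 ^ 2 * P x + x $ 1 * x $ 2 * Q x + x $ 2 ^ 2 * R x"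
  obtains \<xi> c V where "\<xi> analytic_on {0}" "\<xi> 0 = 0" "c analytic_on {0}" "hol_germ V" "V 0 \<noteq> 0"
    "\<forall>\<^sub>F x in nhds 0. G x = x $ 2 ^ 2 * c (x $ 2) + (x $ 1 - \<xi> (x $ 2)) ^ 2 * V x"
proof -
  define \<pi> where "\<pi> s = P (vector [s, 0])" for s
  have axis_curve: "(\<lambda>s. (vector [s, 0] :: complex ^ 2) $ i) analytic_on {0}" for i
    using exhaust_2[of i] by (auto intro!: analytic_intros)
  have axis_tendsto: "((\<lambda>s. vector [s, 0] :: complex ^ 2) \<longlongrightarrow> 0) (nhds 0)"
    by (rule curve_tendsto[OF axis_curve]) (simp add: zero_vec2)
  have pi: "\<pi> analytic_on {0}"
    unfolding \<pi>_def by (rule analytic_compose_hol_germ[OF assms(2) axis_curve]) (simp add: zero_vec2)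
  have shift: "vector [s, y] + u *s axis 1 1 = (vector [s + u, y] :: complex ^ 2)" for s u y
    by (rule vec2_eqI) (simp_all add: axis_def)
  \<comment> \<open>The critical points in the \<open>x\<close>-direction are the zeros of
     \<open>H\<close>.\<close>
  define H where "H = partial_deriv 1 G"
  have H: "hol_germ H" unfolding H_def by (rule hol_germ_partial_deriv[OF assms(1)])
  have Hax: "H (vector [s, y]) = deriv (\<lambda>u. G (vector [u, y])) s" for s y
  proof -
    have "H (vector [s, y]) = deriv (\<lambda>u. G (vector [s + u, y])) 0"
      by (simp add: H_def partial_deriv_def shift)
    also have "\<dots> = deriv (\<lambda>u. G (vector [u, y])) s"
      using deriv_shift_0'[where f = "\<lambda>u. G (vector [u, y])" and z = s] by (simp add: o_def)
    finally show ?thesis .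
  qed
  have Gax: "\<forall>\<^sub>F s in nhds 0. G (vector [s, 0]) = s ^ 2 * \<pi> s"
  proof -
    have "\<forall>\<^sub>F s in nhds 0. (\<lambda>x. G x = x $ 1 ^ 2 * P x + x $ 1 * x $ 2 * Q x + x $ 2 ^ 2 * R x) (vector [s, 0])"
      using axis_tendsto G unfolding filterlim_iff by blast
    thus ?thesis by (simp add: \<pi>_def)
  qed
  have Hs: "\<forall>\<^sub>F s in nhds 0. H (vector [s, 0]) = 2 * s * \<pi> s + s ^ 2 * deriv \<pi> s"
    using pi[unfolded analytic_at_iff_eventually] eventually_eventually[THEN iffD2, OF Gax]
  proof eventually_elim
    case (elim s)
    have "deriv (\<lambda>u. G (vector [u, 0])) s = deriv (\<lambda>s. s ^ 2 * \<pi> s) s"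
      by (rule deriv_cong_ev[OF elim(2)]) simp
    also have "((\<lambda>s. s ^ 2 * \<pi> s) has_field_derivative (2 * s * \<pi> s + s ^ 2 * deriv \<pi> s)) (at s)"
      using field_differentiable_derivI[OF elim(1)] by (auto intro!: derivative_eq_intros)
    hence "deriv (\<lambda>s. s ^ 2 * \<pi> s) s = 2 * s * \<pi> s + s ^ 2 * deriv \<pi> s" by (rule DERIV_imp_deriv)
    finally show ?case by (simp add: Hax)
  qed
  have H0: "H 0 = 0" using eventually_nhds_x_imp_x[OF Hs] by (simp add: zero_vec2)
  have "((\<lambda>s. 2 * s * \<pi> s + s ^ 2 * deriv \<pi> s) has_field_derivative (2 * \<pi> 0)) (at 0)"
  proof -
    have "\<pi> field_differentiable at 0" "deriv \<pi> field_differentiable at 0"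
      using pi analytic_deriv[OF pi] by (auto intro: analytic_on_imp_differentiable_at)
    from this[THEN field_differentiable_derivI] show ?thesis by (auto intro!: derivative_eq_intros)
  qed
  hence "((\<lambda>s. H (vector [s, 0])) has_field_derivative (2 * \<pi> 0)) (at 0)"
    using DERIV_cong_ev[OF refl Hs refl] by simp
  moreover have "2 * \<pi> 0 \<noteq> 0" using assms(5) by (simp add: \<pi>_def zero_vec2)
  ultimately obtain \<xi> where x: "\<xi> analytic_on {0}" "\<xi> 0 = 0" "\<forall>\<^sub>F y in nhds 0. H (vector [\<xi> y, y]) = 0"
    by (rule implicit_function[OF H H0])
  have xi: "hol_germ (\<lambda>q :: complex ^ 2. \<xi> (q $ 2))"
    by (rule hol_germ_outer0[OF hol_germ_coord _ x(1)]) simp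
  \<comment> \<open>The substitution \<open>S\<close> moves the critical points to the axis \<open>x
     = 0\<close>; \<open>T\<close> below is its inverse.\<close>
  define S where "S q = (vector [q $ 1 + \<xi> (q $ 2), q $ 2] :: complex ^ 2)" for q :: "complex ^ 2"
  have S: "hol_map_germ S" "S 0 = 0"
    unfolding S_def using x by (auto intro!: map_germ_vector2 hol_intros xi vec2_eqI)
  define F where "F q = G (S q)" for q
  have F: "hol_germ F" unfolding F_def by (rule hol_germ_compose[OF S assms(1)])
  obtain h where h: "hol_germ h" "\<forall>\<^sub>F q in nhds 0. F q = F (set_coord 1 0 q) + q $ 1 * h q"
    using hol_germ_difference_quotient[OF F] by blast
  obtain k where k: "hol_germ k" "\<forall>\<^sub>F q in nhds 0. h q = h (set_coord 1 0 q) + q $ 1 * k q"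
    using hol_germ_difference_quotient[OF h(1)] by blast
  have set_coord: "set_coord 1 0 q = vector [0, q $ 2]" for q :: "complex ^ 2"
    by (rule vec2_eqI) (simp_all add: set_coord_nth)
  have yaxis: "(\<lambda>y. (vector [0, y] :: complex ^ 2) $ i) analytic_on {0}" for i
    using exhaust_2[of i] by (auto intro!: analytic_intros)
  have yt: "((\<lambda>y. vector [0, y] :: complex ^ 2) \<longlongrightarrow> 0) (nhds 0)"
    by (rule curve_tendsto[OF yaxis]) (simp add: zero_vec2)
  \<comment> \<open>The linear coefficient \<open>h\<close> on the axis is the derivative of
     \<open>G\<close> at the critical point.\<close>
  have h0: "\<forall>\<^sub>F y in nhds 0. h (vector [0, y]) = 0"
  proof -
    have "\<forall>\<^sub>F q in nhds 0. \<forall>\<^sub>F q' in nhds q. F q' = F (set_coord 1 0 q') + q' $ 1 * h q'"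
      using h(2) by (simp add: eventually_eventually)
    hence e1: "\<forall>\<^sub>F y in nhds 0. \<forall>\<^sub>F q' in nhds (vector [0, y]). F q' = F (set_coord 1 0 q') + q' $ 1 * h q'"
      using yt unfolding filterlim_iff by blast
    have e2: "\<forall>\<^sub>F y in nhds 0. hol_at h (vector [0, y])"
      using yt h(1) unfolding filterlim_iff hol_germ_iff by blast
    show ?thesis using e1 e2 x(3)
    proof eventually_elim
      case (elim y)
      have v: "vector [0, y] + u *s axis 1 1 = (vector [u, y] :: complex ^ 2)" for u
        using shift[of 0 y u] by simp
      have hd: "(\<lambda>u. h (vector [u, y])) field_differentiable (at 0)"
        using slice_differentiable[of h "vector [0, y]" 0 "axis 1 1"] elim(2) by (simp add: v)
      have ut: "((\<lambda>u. vector [u, y] :: complex ^ 2) \<longlongrightarrow> vector [0, y]) (nhds 0)"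
      proof (rule vec_tendstoI)
        fix i :: 2
        show "((\<lambda>u. (vector [u, y] :: complex ^ 2) $ i) \<longlongrightarrow> (vector [0, y] :: complex ^ 2) $ i) (nhds 0)"
          using exhaust_2[of i] by (auto simp: filterlim_ident)
      qed
      have "\<forall>\<^sub>F u in nhds 0. (\<lambda>q'. F q' = F (set_coord 1 0 q') + q' $ 1 * h q') (vector [u, y])"
        using ut elim(1) unfolding filterlim_iff by blast
      hence "\<forall>\<^sub>F u in nhds 0. F (vector [u, y]) = F (vector [0, y]) + u * h (vector [u, y])"
        by (simp add: set_coord)
      moreover have "((\<lambda>u. F (vector [0, y]) + u * h (vector [u, y])) has_field_derivative h (vector [0, y])) (at 0)"
        using field_differentiable_derivI[OF hd] by (auto intro!: derivative_eq_intros)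
      ultimately have "((\<lambda>u. F (vector [u, y])) has_field_derivative h (vector [0, y])) (at 0)"
        by (rule DERIV_cong_ev[OF refl _ refl, THEN iffD2])
      hence "deriv (\<lambda>u. F (vector [u, y])) 0 = h (vector [0, y])" by (rule DERIV_imp_deriv)
      moreover have "deriv (\<lambda>u. F (vector [u, y])) 0 = H (vector [\<xi> y, y])"
        using deriv_shift_0'[where f = "\<lambda>u. G (vector [u, y])" and z = "\<xi> y"]
        by (simp add: F_def S_def Hax o_def add.commute)
      ultimately show ?case using elim(3) by simp
    qed
  qed
  define T where "T p = (vector [p $ 1 - \<xi> (p $ 2), p $ 2] :: complex ^ 2)" for p :: "complex ^ 2"
  have T: "hol_map_germ T" "T 0 = 0"
    unfolding T_def using x by (auto intro!: map_germ_vector2 hol_intros xi vec2_eqI)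
  have ST: "S (T p) = p" for p unfolding S_def T_def by (rule vec2_eqI) simp_all
  obtain \<xi>1 where x1: "\<xi>1 analytic_on {0}" "\<forall>\<^sub>F t in nhds 0. \<xi> t = t * \<xi>1 t"
    using analytic_divide_t[OF x(1,2)] by blast
  \<comment> \<open>Since \<open>\<xi> y = y \<xi>1 y\<close>, every term of the critical value is
     divisible by \<open>y^2\<close>.\<close>
  define c where "c y = \<xi>1 y ^ 2 * P (vector [\<xi> y, y]) + \<xi>1 y * Q (vector [\<xi> y, y]) + R (vector [\<xi> y, y])" for y
  have xc: "(\<lambda>y. (vector [\<xi> y, y] :: complex ^ 2) $ i) analytic_on {0}" for i
    using exhaust_2[of i] x(1) by (auto intro!: analytic_intros)
  have ca: "c analytic_on {0}"
    unfolding c_def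
    by (intro analytic_intros x1 analytic_compose_hol_germ[OF _ xc] assms) (simp_all add: x(2) zero_vec2)
  have xt: "((\<lambda>y. vector [\<xi> y, y] :: complex ^ 2) \<longlongrightarrow> 0) (nhds 0)"
    by (rule curve_tendsto[OF xc]) (simp add: x(2) zero_vec2)
  have "\<forall>\<^sub>F y in nhds 0. (\<lambda>x. G x = x $ 1 ^ 2 * P x + x $ 1 * x $ 2 * Q x + x $ 2 ^ 2 * R x) (vector [\<xi> y, y])"
    using xt G unfolding filterlim_iff by blast
  hence Fy: "\<forall>\<^sub>F y in nhds 0. F (vector [0, y]) = y ^ 2 * c y"
    using x1(2) by eventually_elim (simp add: F_def S_def c_def power2_eq_square algebra_simps)
  have y2: "\<forall>\<^sub>F x :: complex ^ 2 in nhds 0. W (x $ 2)" if "\<forall>\<^sub>F y in nhds 0. W y" for W :: "complex \<Rightarrow> bool"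
    using eventually_compose_germ[OF hol_germ_coord[of "2 :: 2"] _ that] by simp
  have FF: "\<forall>\<^sub>F q in nhds 0. F q = q $ 2 ^ 2 * c (q $ 2) + q $ 1 ^ 2 * k q"
    using h(2) k(2) y2[OF h0] y2[OF Fy] by eventually_elim (simp add: set_coord power2_eq_square)
  have k0: "k 0 \<noteq> 0"
  proof -
    have "\<forall>\<^sub>F s in nhds 0. (\<lambda>q. F q = q $ 2 ^ 2 * c (q $ 2) + q $ 1 ^ 2 * k q) (vector [s, 0])"
      using axis_tendsto FF unfolding filterlim_iff by blast
    hence "\<forall>\<^sub>F s in nhds 0. s ^ 2 * k (vector [s, 0]) = s ^ 2 * \<pi> s"
      using Gax by eventually_elim (auto simp: F_def S_def x(2))
    hence "\<forall>\<^sub>F s in at 0. k (vector [s, 0]) = \<pi> s"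
      unfolding eventually_at_filter by eventually_elim auto
    moreover have "((\<lambda>s. k (vector [s, 0])) \<longlongrightarrow> k 0) (at 0)" "(\<pi> \<longlongrightarrow> \<pi> 0) (at 0)"
      using analytic_at_imp_isCont[OF analytic_compose_hol_germ[OF k(1) axis_curve]] analytic_at_imp_isCont[OF pi]
      by (simp_all add: isCont_def zero_vec2)
    ultimately have "(\<pi> \<longlongrightarrow> k 0) (at 0)" using tendsto_cong by fast
    from tendsto_unique[OF _ this \<open>(\<pi> \<longlongrightarrow> \<pi> 0) (at 0)\<close>] have "k 0 = \<pi> 0" by simp
    thus ?thesis using assms(5) by (simp add: \<pi>_def zero_vec2)
  qed
  have "\<forall>\<^sub>F p in nhds 0. G p = p $ 2 ^ 2 * c (p $ 2) + (p $ 1 - \<xi> (p $ 2)) ^ 2 * k (T p)"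
    using eventually_compose[OF T FF] by eventually_elim (simp add: F_def ST, simp add: T_def)
  thus ?thesis using that[OF x(1,2) ca hol_germ_compose[OF T k(1)]] k0 T(2) by simp
qed

lemma complete_square:
  fixes P Q R g :: "complex ^ 2 \<Rightarrow> complex"
  assumes "chart X Y" "hol_germ g" "hol_germ P" "hol_germ Q" "hol_germ R" "P 0 \<noteq> 0"
    and g: "\<forall>\<^sub>F p in nhds 0. g p = X p ^ 2 * P p + X p * Y p * Q p + Y p ^ 2 * R p"
  obtains X' c V where "chart X' Y" "c analytic_on {0}" "hol_germ V" "V 0 \<noteq> 0"
    "\<forall>\<^sub>F p in nhds 0. g p = Y p ^ 2 * c (Y p) + X' p ^ 2 * V p"
proof -
  obtain \<Phi> :: "complex ^ 2 \<Rightarrow> complex ^ 2" where \<Phi>: "hol_map_germ \<Phi>" "\<Phi> 0 = 0"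
    "\<forall>\<^sub>F p in nhds 0. X (\<Phi> p) = p $ 1" "\<forall>\<^sub>F p in nhds 0. Y (\<Phi> p) = p $ 2"
    "\<forall>\<^sub>F p in nhds 0. \<Phi> (vector [X p, Y p]) = p"
    using chart_inverse[OF assms(1)] by blast
  note C = chartD[OF assms(1)]
  let ?T = "\<lambda>p. vector [X p, Y p] :: complex ^ 2"
  have T: "hol_map_germ ?T" "?T 0 = 0" using C by (simp_all add: map_germ_vector2 zero_vec2)
  note c = hol_germ_compose[OF \<Phi>(1,2)]
  have "\<forall>\<^sub>F x in nhds 0. g (\<Phi> x) = x $ 1 ^ 2 * P (\<Phi> x) + x $ 1 * x $ 2 * Q (\<Phi> x) + x $ 2 ^ 2 * R (\<Phi> x)"
    using eventually_compose[OF \<Phi>(1,2) g] \<Phi>(3,4) by eventually_elim simp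
  note G = this
  have P0: "P (\<Phi> 0) \<noteq> 0" using assms(6) \<Phi>(2) by simp
  obtain \<xi> c V where X: "\<xi> analytic_on {0}" "\<xi> 0 = 0" "c analytic_on {0}" "hol_germ V" "V 0 \<noteq> 0"
    "\<forall>\<^sub>F x in nhds 0. g (\<Phi> x) = x $ 2 ^ 2 * c (x $ 2) + (x $ 1 - \<xi> (x $ 2)) ^ 2 * V x"
    by (rule complete_square_standard[OF c[OF assms(2)] c[OF assms(3)] c[OF assms(4)] c[OF assms(5)] P0 G]) blast
  have "\<forall>\<^sub>F p in nhds 0. g p = Y p ^ 2 * c (Y p) + (X p - \<xi> (Y p)) ^ 2 * V (?T p)"
    using eventually_compose[OF T X(6)] \<Phi>(5) by eventually_elim simp
  thus ?thesis
    using that[OF chart_sub_function[OF assms(1) X(1,2)] X(3) hol_germ_compose[OF T X(4)]] X(5) T(2) by simp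
qed

section \<open>Normal forms of the simple singularities\<close>

text \<open>
  Roots of the unit coefficients can be absorbed into the coordinates.
\<close>

lemma contact_equivalent_powers:
  assumes "chart X Y" "hol_germ U" "hol_germ W" "U 0 \<noteq> 0" "W 0 \<noteq> 0" "a > 0" "b > 0"
    and "\<forall>\<^sub>F p in nhds 0. f p = X p ^ a * U p + Y p ^ b * W p"
  shows "contact_equivalent f (\<lambda>p. (p $ 1) ^ a + (p $ 2) ^ b)"
proof -
  obtain u where u: "hol_germ u" "u 0 \<noteq> 0" "\<forall>\<^sub>F x in nhds 0. u x ^ a = U x"
    using hol_germ_root[OF assms(2,4,6)] by blast
  obtain w where w: "hol_germ w" "w 0 \<noteq> 0" "\<forall>\<^sub>F x in nhds 0. w x ^ b = W x"
    using hol_germ_root[OF assms(3,5,7)] by blast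
  show ?thesis
  proof (rule chart_contact_equivalent[OF chart_units[OF assms(1) u(1) w(1) u(2) w(2)]])
    show "\<forall>\<^sub>F p in nhds 0. f p = (vector [u p * X p, w p * Y p] :: complex ^ 2) $ 1 ^ a +
        (vector [u p * X p, w p * Y p] :: complex ^ 2) $ 2 ^ b"
      using u(3) w(3) assms(8) by eventually_elim (simp add: power_mult_distrib mult.commute)
  qed
qed

lemma reduced_germD:
  assumes "reduced_germ f" "hol_germ h" "hol_germ k" "\<forall>\<^sub>F x in nhds 0. f x = (h x)\<^sup>2 * k x"
  shows "h 0 \<noteq> 0"
  using assms unfolding reduced_germ_def by blast

text \<open>
  After completion of the square, \<open>f = Y^2 c(Y) + X'^2 V\<close>. If \<open>c\<close>
  vanished identically then \<open>f\<close> would have the multiple factor \<open>X'\<close>;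
  hence \<open>c\<close> is a power of \<open>Y\<close> times a unit and \<open>f\<close> has
  type \<open>A\<close>.
\<close>

lemma simple_A:
  fixes f :: "complex ^ 2 \<Rightarrow> complex"
  assumes "chart X Y" "hol_germ f" "hol_germ P" "hol_germ Q" "hol_germ R" "P 0 \<noteq> 0" "reduced_germ f"
    and "\<forall>\<^sub>F p in nhds 0. f p = X p ^ 2 * P p + X p * Y p * Q p + Y p ^ 2 * R p"
  shows "simple_germ f"
proof -
  obtain X' c V where X: "chart X' Y" "c analytic_on {0}" "hol_germ V" "V 0 \<noteq> 0"
    "\<forall>\<^sub>F p in nhds 0. f p = Y p ^ 2 * c (Y p) + X' p ^ 2 * V p"
    using complete_square[OF assms(1-6) assms(8)] by blast
  note C = chartD[OF X(1)]
  have "\<not> (\<forall>\<^sub>F t in nhds 0. c t = 0)"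
  proof
    assume "\<forall>\<^sub>F t in nhds 0. c t = 0"
    from eventually_compose_germ[OF C(2,4) this] X(5)
    have "\<forall>\<^sub>F p in nhds 0. f p = (X' p)\<^sup>2 * V p" by eventually_elim simp
    from reduced_germD[OF assms(7) C(1) X(3) this] C(3) show False by simp
  qed
  from analytic_factor_order[OF X(2) this] obtain m w where
    w: "w analytic_on {0}" "w 0 \<noteq> 0" "\<forall>\<^sub>F t in nhds 0. c t = t ^ m * w t" by blast
  have "\<forall>\<^sub>F p in nhds 0. f p = X' p ^ 2 * V p + Y p ^ (m + 1 + 1) * w (Y p)"
    using X(5) eventually_compose_germ[OF C(2,4) w(3)]
    by eventually_elim (simp add: power2_eq_square algebra_simps)
  from contact_equivalent_powers[OF X(1,3) hol_germ_outer0[OF C(2,4) w(1)] X(4) _ _ _ this] w(2) C(4)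
  have "contact_equivalent f (\<lambda>p. (p $ 1) ^ 2 + (p $ 2) ^ (m + 1 + 1))" by simp
  thus ?thesis unfolding simple_germ_def by (intro disjI1 exI[of _ "m + 1"] conjI) simp_all
qed

text \<open>
  The line \<open>Y = 0\<close> is a simple factor of the cubic leading form and therefore
  tangent to a smooth branch \<open>Y' = 0\<close> of \<open>f\<close>. In the cofactor of
  \<open>Y'\<close> the coefficient of \<open>X^2\<close> is a unit, so the square can be
  completed; reducedness again excludes the degenerate case.
\<close>

lemma simple_D:
  fixes f :: "complex ^ 2 \<Rightarrow> complex"
  assumes ch: "chart X Y" and hol: "hol_germ A" "hol_germ B" "hol_germ C" "hol_germ D"
    and "A 0 = 0" "B 0 \<noteq> 0" "reduced_germ f"
    and f: "\<forall>\<^sub>F p in nhds 0. f p = X p ^ 3 * A p + X p ^ 2 * Y p * B p + X p * Y p ^ 2 * C p + Y p ^ 3 * D p"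
  shows "simple_germ f"
proof -
  obtain s E where s: "hol_germ s" "s 0 = 0" "hol_germ E"
    "\<forall>\<^sub>F p in nhds 0. A p + B p * s p + C p * s p ^ 2 + D p * s p ^ 3 = (Y p - X p ^ 1 * s p) * E p"
    by (rule chart_branch[OF chart_sym[OF ch] hol, of 1 0]) (use assms(6,7) in simp_all)
  define Y' where "Y' p = Y p - X p * s p" for p
  have ch': "chart X Y'"
    using chart_shift[OF chart_sym[OF ch] hol_germ_minus[OF s(1)]]
    by (simp add: Y'_def[abs_def] chart_sym mult.commute)
  note c = chartD[OF ch']
  \<comment> \<open>Coefficients of the quotient of \<open>f\<close> by \<open>Y'\<close>, found by
     substituting \<open>Y = Y' + X s\<close> in the cubic expansion.\<close>
  define P where "P p = X p * E p + B p + 2 * s p * C p + 3 * s p ^ 2 * D p" for p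
  define Q where "Q p = C p + 3 * s p * D p" for p
  define g where "g p = X p ^ 2 * P p + X p * Y' p * Q p + Y' p ^ 2 * D p" for p
  have PQ: "hol_germ P" "hol_germ Q" unfolding P_def[abs_def] Q_def[abs_def] by (intro hol_intros c s hol)+
  have g: "hol_germ g" unfolding g_def[abs_def] by (intro hol_intros c PQ hol)
  have fg: "\<forall>\<^sub>F p in nhds 0. f p = Y' p * g p"
    using f s(4)
  proof eventually_elim
    case (elim p)
    have Y: "Y p = Y' p + X p * s p" by (simp add: Y'_def)
    have "f p = X p ^ 3 * (A p + B p * s p + C p * s p ^ 2 + D p * s p ^ 3)
       + X p ^ 2 * Y' p * (B p + 2 * s p * C p + 3 * s p ^ 2 * D p) + X p * Y' p ^ 2 * (C p + 3 * s p * D p) + Y' p ^ 3 * D p"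
      unfolding elim(1) Y by algebra
    also have "A p + B p * s p + C p * s p ^ 2 + D p * s p ^ 3 = Y' p * E p"
      using elim(2) by (simp add: Y'_def)
    finally show ?case unfolding g_def P_def Q_def by algebra
  qed
  have P0: "P 0 \<noteq> 0" using c(3) s(2) assms(7) by (simp add: P_def)
  obtain X' k V where X: "chart X' Y'" "k analytic_on {0}" "hol_germ V" "V 0 \<noteq> 0"
    "\<forall>\<^sub>F p in nhds 0. g p = Y' p ^ 2 * k (Y' p) + X' p ^ 2 * V p"
    by (rule complete_square[OF ch' g PQ(1) PQ(2) hol(4) P0]) (auto simp: g_def)
  note c' = chartD[OF X(1)]
  have "\<not> (\<forall>\<^sub>F t in nhds 0. k t = 0)"
  proof
    assume "\<forall>\<^sub>F t in nhds 0. k t = 0"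
    from eventually_compose_germ[OF c'(2,4) this] X(5) fg
    have "\<forall>\<^sub>F p in nhds 0. f p = (X' p)\<^sup>2 * (V p * Y' p)" by eventually_elim simp
    from reduced_germD[OF assms(8) c'(1) hol_germ_mult[OF X(3) c'(2)] this] c'(3) show False by simp
  qed
  from analytic_factor_order[OF X(2) this] obtain m w where
    w: "w analytic_on {0}" "w 0 \<noteq> 0" "\<forall>\<^sub>F t in nhds 0. k t = t ^ m * w t" by blast
  have wY: "hol_germ (\<lambda>p. w (Y' p))" "w (Y' 0) \<noteq> 0" using hol_germ_outer0[OF c'(2,4) w(1)] w(2) c'(4) by simp_all
  \<comment> \<open>The unit of the pure power of \<open>Y'\<close> is absorbed first; the
     coordinate \<open>X'\<close> then compensates for the factor that this brings into the mixed
     term.\<close>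
  obtain \<omega> where o: "hol_germ \<omega>" "\<omega> 0 \<noteq> 0" "\<forall>\<^sub>F x in nhds 0. \<omega> x ^ (m + 3) = w (Y' x)"
    using hol_germ_root[OF wY, of "m + 3"] by auto
  have V\<omega>: "hol_germ (\<lambda>p. V p / \<omega> p)" "V 0 / \<omega> 0 \<noteq> 0" using X(3,4) o by (auto intro!: hol_intros)
  obtain \<eta> where e: "hol_germ \<eta>" "\<eta> 0 \<noteq> 0" "\<forall>\<^sub>F x in nhds 0. \<eta> x ^ 2 = V x / \<omega> x"
    using hol_germ_root[OF V\<omega>, of 2] by auto
  have "contact_equivalent f (\<lambda>p. (p $ 1) ^ 2 * p $ 2 + (p $ 2) ^ (m + 4 - 1))"
  proof (rule chart_contact_equivalent[OF chart_units[OF X(1) e(1) o(1) e(2) o(2)]])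
    show "\<forall>\<^sub>F p in nhds 0. f p = (vector [\<eta> p * X' p, \<omega> p * Y' p] :: complex ^ 2) $ 1 ^ 2 *
        (vector [\<eta> p * X' p, \<omega> p * Y' p] :: complex ^ 2) $ 2 +
        (vector [\<eta> p * X' p, \<omega> p * Y' p] :: complex ^ 2) $ 2 ^ (m + 4 - 1)"
      using fg X(5) eventually_compose_germ[OF c'(2,4) w(3)] o(3) e(3) hol_germ_nonzero[OF o(1,2)]
    proof eventually_elim
      case (elim p)
      have "(\<eta> p * X' p) ^ 2 * (\<omega> p * Y' p) = (\<eta> p ^ 2 * \<omega> p) * X' p ^ 2 * Y' p"
        by (simp add: power_mult_distrib)
      also have "\<eta> p ^ 2 * \<omega> p = V p" using elim(5,6) by simp
      finally have 1: "(\<eta> p * X' p) ^ 2 * (\<omega> p * Y' p) = V p * X' p ^ 2 * Y' p" .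
      have 2: "(\<omega> p * Y' p) ^ (m + 3) = w (Y' p) * Y' p ^ (m + 3)"
        by (simp only: power_mult_distrib elim(4))
      have 3: "f p = Y' p * (Y' p ^ 2 * (Y' p ^ m * w (Y' p)) + X' p ^ 2 * V p)"
        using elim(1-3) by simp
      have 4: "m + 4 - 1 = m + 3" by simp
      show ?case unfolding vector_2 4 1 2 3
        by (simp add: power_add power2_eq_square power3_eq_cube algebra_simps)
    qed
  qed
  thus ?thesis unfolding simple_germ_def by (intro disjI2 disjI1 exI[of _ "m + 4"] conjI) simp_all
qed

text \<open>
  Two coordinate changes complete a fourth power and then a cube, which removes the two mixed
  terms.
\<close>

lemma simple_E6:
  fixes f :: "complex ^ 2 \<Rightarrow> complex"
  assumes ch: "chart X Y" and hol: "hol_germ A" "hol_germ B" "hol_germ C" "hol_germ D"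
    and "A 0 \<noteq> 0" "D 0 \<noteq> 0"
    and f: "\<forall>\<^sub>F p in nhds 0. f p = X p ^ 3 * A p + X p ^ 2 * Y p ^ 2 * B p + X p * Y p ^ 3 * C p + Y p ^ 4 * D p"
  shows "simple_germ f"
proof -
  note c = chartD[OF ch]
  \<comment> \<open>Chosen such that \<open>D (Y + \<kappa> X)^4\<close> contains the term \<open>X
     Y^3 C\<close>; the remaining terms go into new coefficients \<open>A1\<close> and
     \<open>B1\<close>.\<close>
  define \<kappa> where "\<kappa> p = C p / (4 * D p)" for p
  have k: "hol_germ \<kappa>" unfolding \<kappa>_def[abs_def] by (intro hol_intros hol) (use assms(7) in simp)
  define Y1 where "Y1 p = Y p + \<kappa> p * X p" for p
  have ch1: "chart X Y1"
    using chart_shift[OF chart_sym[OF ch] k] by (simp add: Y1_def[abs_def] chart_sym)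
  note c1 = chartD[OF ch1]
  define B1 where "B1 p = B p - 6 * D p * \<kappa> p ^ 2" for p
  define A1 where "A1 p = A p - 4 * D p * Y p * \<kappa> p ^ 3 - D p * X p * \<kappa> p ^ 4
     + B1 p * (X p * \<kappa> p ^ 2 - 2 * Y1 p * \<kappa> p)" for p
  have AB: "hol_germ B1" "hol_germ A1" 
    unfolding B1_def[abs_def] A1_def[abs_def] by (intro hol_intros c c1 hol k)+
  have A10: "A1 0 \<noteq> 0" using c c1 assms(6) by (simp add: A1_def)
  \<comment> \<open>Chosen such that \<open>A1 (X + Y1^2 \<beta>)^3\<close> contains the term
     \<open>X^2 Y1^2 B1\<close>.\<close>
  define \<beta> where "\<beta> p = B1 p / (3 * A1 p)" for p
  have b: "hol_germ \<beta>" unfolding \<beta>_def[abs_def] by (intro hol_intros AB) (use A10 in simp)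
  define X1 where "X1 p = X p + (Y1 p * \<beta> p) * Y1 p" for p
  have ch2: "chart X1 Y1"
    unfolding X1_def[abs_def] by (rule chart_shift[OF ch1]) (intro hol_intros c1 b)
  define D1 where "D1 p = D p - 3 * A1 p * X p * \<beta> p ^ 2 - A1 p * Y1 p ^ 2 * \<beta> p ^ 3" for p
  have D1: "hol_germ D1" unfolding D1_def[abs_def] by (intro hol_intros c1 hol AB b)
  have "\<forall>\<^sub>F p in nhds 0. f p = X1 p ^ 3 * A1 p + Y1 p ^ 4 * D1 p"
    using f hol_germ_nonzero[OF hol(4) assms(7)] hol_germ_nonzero[OF AB(2) A10]
  proof eventually_elim
    case (elim p)
    have C: "C p = 4 * D p * \<kappa> p" using elim(2) by (simp add: \<kappa>_def)
    have B1: "B1 p = 3 * A1 p * \<beta> p" using elim(3) by (simp add: \<beta>_def)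
    have Y: "Y p = Y1 p - \<kappa> p * X p" by (simp add: Y1_def)
    have "f p = D p * Y1 p ^ 4 + X p ^ 3 * (A1 p - B1 p * (X p * \<kappa> p ^ 2 - 2 * Y1 p * \<kappa> p)) + X p ^ 2 * Y p ^ 2 * B1 p"
      unfolding elim(1) C A1_def B1_def Y by algebra
    also have "\<dots> = D p * Y1 p ^ 4 + X p ^ 3 * A1 p + X p ^ 2 * Y1 p ^ 2 * B1 p"
      unfolding Y by algebra
    also have "\<dots> = X1 p ^ 3 * A1 p + Y1 p ^ 4 * D1 p"
      unfolding B1 X1_def D1_def by algebra
    finally show ?case .
  qed
  from contact_equivalent_powers[OF ch2 AB(2) D1 A10 _ _ _ this] assms(7) c c1
  have "contact_equivalent f (\<lambda>p. (p $ 1) ^ 3 + (p $ 2) ^ 4)" by (simp add: D1_def)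
  thus ?thesis unfolding simple_germ_def by blast
qed

text \<open>
  Putting \<open>X = Y^2 s\<close> turns the equation into \<open>Y^5\<close> times a polynomial
  in \<open>s\<close> with leading part \<open>D + C s\<close>, which has a simple root:
  \<open>f\<close> has a smooth branch \<open>X1 = X - Y^2 s\<close>. In the cofactor of
  \<open>X1\<close> the term with \<open>Y^2\<close> is removed by completing the cube of
  \<open>Y\<close>.
\<close>

lemma simple_E7:
  fixes f :: "complex ^ 2 \<Rightarrow> complex"
  assumes ch: "chart X Y" and hol: "hol_germ A" "hol_germ B" "hol_germ C" "hol_germ D"
    and "A 0 \<noteq> 0" "C 0 \<noteq> 0"
    and f: "\<forall>\<^sub>F p in nhds 0. f p = X p ^ 3 * A p + X p ^ 2 * Y p ^ 2 * B p + X p * Y p ^ 3 * C p + Y p ^ 5 * D p"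
  shows "simple_germ f"
proof -
  note c = chartD[OF ch]
  have YB: "hol_germ (\<lambda>p. Y p * B p)" "hol_germ (\<lambda>p. Y p * A p)" by (intro hol_intros c hol)+
  obtain s E where s: "hol_germ s" "s 0 = - D 0 / C 0" "hol_germ E"
    "\<forall>\<^sub>F p in nhds 0. D p + C p * s p + Y p * B p * s p ^ 2 + Y p * A p * s p ^ 3 = (X p - Y p ^ 2 * s p) * E p"
    by (rule chart_branch[OF ch hol(4) hol(3) YB, of 2 "- D 0 / C 0"]) (use assms(7) c in simp_all)
  define X1 where "X1 p = X p - Y p ^ 2 * s p" for p
  have "hol_germ (\<lambda>p. - (Y p * s p))" by (intro hol_intros c s)
  from chart_shift[OF ch this] have ch1: "chart X1 Y"
    by (simp add: X1_def[abs_def] power2_eq_square mult_ac)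
  note c1 = chartD[OF ch1]
  define B1 where "B1 p = B p + 3 * s p * A p" for p
  define C1 where "C1 p = C p + 2 * s p * Y p * B p + 3 * s p ^ 2 * Y p * A p + Y p ^ 2 * E p" for p
  have BC: "hol_germ B1" "hol_germ C1"
    unfolding B1_def[abs_def] C1_def[abs_def] by (intro hol_intros c hol s)+
  have C10: "C1 0 \<noteq> 0" using c assms(7) by (simp add: C1_def)
  \<comment> \<open>Chosen such that \<open>C1 (Y + \<kappa> X1)^3\<close> contains the term
     \<open>X1 Y^2 B1\<close>.\<close>
  define \<kappa> where "\<kappa> p = B1 p / (3 * C1 p)" for p
  have k: "hol_germ \<kappa>" unfolding \<kappa>_def[abs_def] by (intro hol_intros BC) (use C10 in simp)
  define Y1 where "Y1 p = Y p + \<kappa> p * X1 p" for p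
  have ch2: "chart X1 Y1"
    using chart_shift[OF chart_sym[OF ch1] k] by (simp add: Y1_def[abs_def] chart_sym)
  note c2 = chartD[OF ch2]
  define A1 where "A1 p = A p - 3 * C1 p * Y p * \<kappa> p ^ 2 - C1 p * X1 p * \<kappa> p ^ 3" for p
  have A1: "hol_germ A1" unfolding A1_def[abs_def] by (intro hol_intros c1 BC k hol)
  have A10: "A1 0 \<noteq> 0" using c c1 assms(6) by (simp add: A1_def)
  have fx: "\<forall>\<^sub>F p in nhds 0. f p = X1 p * (X1 p ^ 2 * A1 p + Y1 p ^ 3 * C1 p)"
    using f s(4) hol_germ_nonzero[OF BC(2) C10]
  proof eventually_elim
    case (elim p)
    have X: "X p = X1 p + Y p ^ 2 * s p" by (simp add: X1_def)
    have B1': "B1 p = 3 * C1 p * \<kappa> p" using elim(3) by (simp add: \<kappa>_def)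
    have s4: "D p + C p * s p + Y p * B p * s p ^ 2 + Y p * A p * s p ^ 3 = X1 p * E p"
      using elim(2) by (simp add: X1_def)
    have "f p = X1 p ^ 3 * A p + X1 p ^ 2 * Y p ^ 2 * B1 p + X1 p * Y p ^ 3 * (C1 p - Y p ^ 2 * E p)
       + Y p ^ 5 * (D p + C p * s p + Y p * B p * s p ^ 2 + Y p * A p * s p ^ 3)"
      unfolding elim(1) X B1_def C1_def by algebra
    also have "\<dots> = X1 p * (X1 p ^ 2 * A p + X1 p * Y p ^ 2 * B1 p + Y p ^ 3 * C1 p)"
      unfolding s4 by algebra
    also have "\<dots> = X1 p * (X1 p ^ 2 * A1 p + Y1 p ^ 3 * C1 p)"
      unfolding B1' A1_def Y1_def by algebra
    finally show ?case .
  qed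
  \<comment> \<open>\<open>X1\<close> and \<open>Y1\<close> are rescaled by \<open>\<eta>\<close>
     and \<open>\<theta>\<close> with \<open>\<eta>^3 = A1\<close> and \<open>\<eta> \<theta>^3 =
     C1\<close>.\<close>
  obtain \<eta> where e: "hol_germ \<eta>" "\<eta> 0 \<noteq> 0" "\<forall>\<^sub>F x in nhds 0. \<eta> x ^ 3 = A1 x"
    using hol_germ_root[OF A1 A10, of 3] by auto
  have Ce: "hol_germ (\<lambda>p. C1 p / \<eta> p)" "C1 0 / \<eta> 0 \<noteq> 0" using BC(2) C10 e by (auto intro!: hol_intros)
  obtain \<theta> where h: "hol_germ \<theta>" "\<theta> 0 \<noteq> 0" "\<forall>\<^sub>F x in nhds 0. \<theta> x ^ 3 = C1 x / \<eta> x"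
    using hol_germ_root[OF Ce, of 3] by auto
  have "contact_equivalent f (\<lambda>p. (p $ 1) ^ 3 + p $ 1 * (p $ 2) ^ 3)"
  proof (rule chart_contact_equivalent[OF chart_units[OF ch2 e(1) h(1) e(2) h(2)]])
    show "\<forall>\<^sub>F p in nhds 0. f p = (vector [\<eta> p * X1 p, \<theta> p * Y1 p] :: complex ^ 2) $ 1 ^ 3 +
        (vector [\<eta> p * X1 p, \<theta> p * Y1 p] :: complex ^ 2) $ 1 * (vector [\<eta> p * X1 p, \<theta> p * Y1 p] :: complex ^ 2) $ 2 ^ 3"
      using fx e(3) h(3) hol_germ_nonzero[OF e(1,2)]
    proof eventually_elim
      case (elim p)
      have "\<eta> p * \<theta> p ^ 3 = C1 p" using elim(3,4) by simp
      have "(\<eta> p * X1 p) ^ 3 + (\<eta> p * X1 p) * (\<theta> p * Y1 p) ^ 3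
          = X1 p ^ 3 * \<eta> p ^ 3 + X1 p * Y1 p ^ 3 * (\<eta> p * \<theta> p ^ 3)"
        by (simp add: power_mult_distrib)
      also have "\<dots> = X1 p ^ 3 * A1 p + X1 p * Y1 p ^ 3 * C1 p"
        by (simp only: \<open>\<eta> p * \<theta> p ^ 3 = C1 p\<close> elim(2))
      also have "\<dots> = f p" unfolding elim(1) by algebra
      finally show ?case by simp
    qed
  qed
  thus ?thesis unfolding simple_germ_def by blast
qed

text \<open>
  Completing the cube of \<open>X\<close> removes \<open>X^2 Y^2\<close>, completing the fifth
  power of \<open>Y\<close> removes \<open>X Y^4\<close> at the cost of a new term \<open>X^2
  Y^3\<close>, and completing the cube once more removes that.
\<close>

lemma simple_E8:
  fixes f :: "complex ^ 2 \<Rightarrow> complex"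
  assumes ch: "chart X Y" and hol: "hol_germ A" "hol_germ B" "hol_germ C" "hol_germ D"
    and "A 0 \<noteq> 0" "D 0 \<noteq> 0"
    and f: "\<forall>\<^sub>F p in nhds 0. f p = X p ^ 3 * A p + X p ^ 2 * Y p ^ 2 * B p + X p * Y p ^ 4 * C p + Y p ^ 5 * D p"
  shows "simple_germ f"
proof -
  note c = chartD[OF ch]
  \<comment> \<open>Chosen such that \<open>A (X + Y^2 \<beta>)^3\<close> contains the term
     \<open>X^2 Y^2 B\<close>.\<close>
  define \<beta> where "\<beta> p = B p / (3 * A p)" for p
  have b: "hol_germ \<beta>" unfolding \<beta>_def[abs_def] by (intro hol_intros hol) (use assms(6) in simp)
  define X1 where "X1 p = X p + (Y p * \<beta> p) * Y p" for p
  have ch1: "chart X1 Y"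
    unfolding X1_def[abs_def] by (rule chart_shift[OF ch]) (intro hol_intros c b)
  note c1 = chartD[OF ch1]
  define C1 where "C1 p = C p - 3 * A p * \<beta> p ^ 2" for p
  define D1 where "D1 p = D p - A p * Y p * \<beta> p ^ 3 - Y p * \<beta> p * C1 p" for p
  have C1: "hol_germ C1" unfolding C1_def[abs_def] by (intro hol_intros hol b)
  have D1: "hol_germ D1" unfolding D1_def[abs_def] by (intro hol_intros hol b c C1)
  have D10: "D1 0 \<noteq> 0" using c assms(7) by (simp add: D1_def)
  \<comment> \<open>Chosen such that \<open>D1 (Y + \<kappa> X1)^5\<close> contains the term
     \<open>X1 Y^4 C1\<close>.\<close>
  define \<kappa> where "\<kappa> p = C1 p / (5 * D1 p)" for p
  have k: "hol_germ \<kappa>" unfolding \<kappa>_def[abs_def] by (intro hol_intros C1 D1) (use D10 in simp)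
  define Y1 where "Y1 p = Y p + \<kappa> p * X1 p" for p
  have ch2: "chart X1 Y1"
    using chart_shift[OF chart_sym[OF ch1] k] by (simp add: Y1_def[abs_def] chart_sym)
  note c2 = chartD[OF ch2]
  define B2 where "B2 p = - 10 * D1 p * \<kappa> p ^ 2" for p
  define A2 where "A2 p = A p - D1 p * (10 * Y p ^ 2 * \<kappa> p ^ 3 + 5 * Y p * X1 p * \<kappa> p ^ 4 + X1 p ^ 2 * \<kappa> p ^ 5)
     + B2 p * (3 * Y1 p * X1 p * \<kappa> p ^ 2 - 3 * Y1 p ^ 2 * \<kappa> p - X1 p ^ 2 * \<kappa> p ^ 3)" for p
  have B2: "hol_germ B2" unfolding B2_def[abs_def] by (intro hol_intros D1 k)
  have A2: "hol_germ A2" unfolding A2_def[abs_def] by (intro hol_intros hol D1 B2 c c1 c2 k)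
  have A20: "A2 0 \<noteq> 0" using c c1 c2 assms(6) by (simp add: A2_def)
  \<comment> \<open>Chosen such that \<open>A2 (X1 + Y1^3 \<gamma>)^3\<close> contains the term
     \<open>X1^2 Y1^3 B2\<close>.\<close>
  define \<gamma> where "\<gamma> p = B2 p / (3 * A2 p)" for p
  have g: "hol_germ \<gamma>" unfolding \<gamma>_def[abs_def] by (intro hol_intros A2 B2) (use A20 in simp)
  define X2 where "X2 p = X1 p + (Y1 p ^ 2 * \<gamma> p) * Y1 p" for p
  have ch3: "chart X2 Y1"
    unfolding X2_def[abs_def] by (rule chart_shift[OF ch2]) (intro hol_intros c2 g)
  define D2 where "D2 p = D1 p - 3 * A2 p * X1 p * Y1 p * \<gamma> p ^ 2 - A2 p * Y1 p ^ 4 * \<gamma> p ^ 3" for p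
  have D2: "hol_germ D2" unfolding D2_def[abs_def] by (intro hol_intros D1 A2 c2 g)
  have "\<forall>\<^sub>F p in nhds 0. f p = X2 p ^ 3 * A2 p + Y1 p ^ 5 * D2 p"
    using f hol_germ_nonzero[OF hol(1) assms(6)] hol_germ_nonzero[OF D1 D10] hol_germ_nonzero[OF A2 A20]
  proof eventually_elim
    case (elim p)
    have B: "B p = 3 * A p * \<beta> p" using elim(2) by (simp add: \<beta>_def)
    have C1': "C1 p = 5 * D1 p * \<kappa> p" using elim(3) by (simp add: \<kappa>_def)
    have B2': "B2 p = 3 * A2 p * \<gamma> p" using elim(4) by (simp add: \<gamma>_def)
    have X: "X p = X1 p - Y p ^ 2 * \<beta> p" by (simp add: X1_def power2_eq_square)
    have Y: "Y p = Y1 p - \<kappa> p * X1 p" by (simp add: Y1_def)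
    have "f p = X1 p ^ 3 * A p + X1 p * Y p ^ 4 * C1 p + Y p ^ 5 * D1 p"
      unfolding elim(1) B X C1_def D1_def by algebra
    also have "\<dots> = Y1 p ^ 5 * D1 p + X1 p ^ 3 * (A p - D1 p * (10 * Y p ^ 2 * \<kappa> p ^ 3 + 5 * Y p * X1 p * \<kappa> p ^ 4 + X1 p ^ 2 * \<kappa> p ^ 5))
        + X1 p ^ 2 * Y p ^ 3 * B2 p"
      unfolding C1' B2_def Y1_def by algebra
    also have "X1 p ^ 2 * Y p ^ 3 * B2 p = X1 p ^ 2 * Y1 p ^ 3 * B2 p
        + X1 p ^ 3 * B2 p * (3 * Y1 p * X1 p * \<kappa> p ^ 2 - 3 * Y1 p ^ 2 * \<kappa> p - X1 p ^ 2 * \<kappa> p ^ 3)"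
      unfolding Y by algebra
    finally have "f p = Y1 p ^ 5 * D1 p + X1 p ^ 3 * A2 p + X1 p ^ 2 * Y1 p ^ 3 * B2 p"
      unfolding A2_def by (simp add: algebra_simps)
    also have "\<dots> = X2 p ^ 3 * A2 p + Y1 p ^ 5 * D2 p"
      unfolding B2' X2_def D2_def by algebra
    finally show ?case .
  qed
  from contact_equivalent_powers[OF ch3 A2 D2 A20 _ _ _ this] D10 c1 c2
  have "contact_equivalent f (\<lambda>p. (p $ 1) ^ 3 + (p $ 2) ^ 5)" by (simp add: D2_def)
  thus ?thesis unfolding simple_germ_def by blast
qed

section \<open>Orders and Taylor coefficients of one-variable germs\<close>

text \<open>
  Extracts the coefficient of \<open>t^m\<close>: a bound by a higher power of \<open>t\<close>
  forces it to be zero.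
\<close>

lemma vanish_factor:
  fixes w :: "complex \<Rightarrow> complex"
  assumes "vanish (Suc k) (\<lambda>t. t ^ m * w t)" "w analytic_on {0}" "m \<le> k"
  shows "w 0 = 0"
proof -
  obtain c where c: "c \<ge> 0" "\<forall>\<^sub>F t in nhds 0. norm (t ^ m * w t) \<le> c * norm t ^ Suc m"
    using vanish_mono[OF assms(1), of "Suc m"] assms(3) by (auto elim: vanishE)
  have "\<forall>\<^sub>F t in at 0. norm (w t) \<le> c * norm t"
    using c(2) unfolding eventually_at_filter
  proof eventually_elim
    case (elim t)
    show ?case
    proof (intro impI)
      assume "t \<noteq> 0" "t \<in> UNIV"
      have "norm t ^ m * norm (w t) \<le> norm t ^ m * (c * norm t)"
        using elim by (simp add: norm_mult norm_power mult_ac)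
      thus "norm (w t) \<le> c * norm t" using \<open>t \<noteq> 0\<close> by (subst (asm) mult_le_cancel_left_pos) simp_all
    qed
  qed
  moreover have "((\<lambda>t :: complex. c * norm t) \<longlongrightarrow> 0) (at 0)"
    by (auto intro!: tendsto_eq_intros)
  ultimately have "(w \<longlongrightarrow> 0) (at 0)" by (rule Lim_null_comparison)
  moreover have "(w \<longlongrightarrow> w 0) (at 0)"
    using analytic_at_imp_isCont[OF assms(2)] by (simp add: isCont_def)
  ultimately show ?thesis by (metis tendsto_unique trivial_limit_at)
qed

lemma vanish_t_power: "vanish n (\<lambda>t :: complex. t ^ n)"
  unfolding vanish_def by (rule exI[of _ 1]) (simp add: norm_power)

lemma vanishing_order_ge_iff:
  fixes h :: "complex \<Rightarrow> complex"
  assumes "h analytic_on {0}"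
  shows "enat i \<le> vanishing_order h \<longleftrightarrow> vanish i h"
proof (cases "\<forall>\<^sub>F t in nhds 0. h t = 0")
  case True
  hence "vanish i h" using vanish_cong[OF vanish_0[of i]] by (auto elim: eventually_mono)
  thus ?thesis using True by (simp add: vanishing_order_def)
next
  case False
  obtain m w where w: "w analytic_on {0}" "w 0 \<noteq> 0" "\<forall>\<^sub>F t in nhds 0. h t = t ^ m * w t" "m = nat (zorder h 0)"
    using analytic_factor_order[OF assms False] by blast
  have eq: "vanishing_order h = enat m" using False w(4) by (simp add: vanishing_order_def)
  have "vanish (m + 0) (\<lambda>t. t ^ m * w t)"
    by (rule vanish_mult[OF vanish_t_power vanish_bounded[OF analytic_tendsto_nhds[OF w(1)]]])
  hence m: "vanish m h" using vanish_cong[of m "\<lambda>t. t ^ m * w t" h] w(3) by (simp add: eq_commute)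
  have "i \<le> m" if v: "vanish i h"
  proof (rule ccontr)
    assume "\<not> i \<le> m"
    hence "vanish (Suc m) h" using v by (auto intro: vanish_mono)
    hence "vanish (Suc m) (\<lambda>t. t ^ m * w t)" using w(3) by (rule vanish_cong)
    from vanish_factor[OF this w(1)] w(2) show False by simp
  qed
  thus ?thesis using m vanish_mono[OF m] by (auto simp: eq)
qed

lemma vanish_imp_deriv_0:
  fixes h :: "complex \<Rightarrow> complex"
  assumes "h analytic_on {0}" "vanish (Suc k) h" "j \<le> k"
  shows "(deriv ^^ j) h 0 = 0"
proof (cases "\<forall>\<^sub>F t in nhds 0. h t = 0")
  case True
  hence "(deriv ^^ j) h 0 = (deriv ^^ j) (\<lambda>_. 0) 0"
    by (intro higher_deriv_cong_ev) auto
  thus ?thesis by simp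
next
  case False
  obtain m w where w: "w analytic_on {0}" "w 0 \<noteq> 0" "\<forall>\<^sub>F t in nhds 0. h t = t ^ m * w t"
    using analytic_factor_order[OF assms(1) False] by blast
  have "vanish (Suc k) (\<lambda>t. t ^ m * w t)" using assms(2) w(3) by (rule vanish_cong)
  hence m: "m > k" using vanish_factor[OF _ w(1)] w(2) by force
  have "(\<lambda>t. t ^ m * w t) has_fps_expansion fps_X ^ m * fps_expansion w 0"
    using analytic_at_imp_has_fps_expansion_0[OF w(1)] by (intro fps_expansion_intros)
  from fps_nth_fps_expansion[OF this, of j] m assms(3)
  have "(deriv ^^ j) (\<lambda>t. t ^ m * w t) 0 = 0" by (simp add: fps_X_power_mult_nth)
  moreover have "(deriv ^^ j) h 0 = (deriv ^^ j) (\<lambda>t. t ^ m * w t) 0"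
    by (intro higher_deriv_cong_ev w(3)) auto
  ultimately show ?thesis by simp
qed

text \<open>
  Identifies the coefficients in the definition of \<open>jet\<close>, where they appear as
  iterated derivatives, with those of any polynomial approximation.
\<close>

lemma taylor_coefficient_unique:
  fixes h :: "complex \<Rightarrow> complex"
  assumes "h analytic_on {0}" "vanish (Suc k) (\<lambda>t. h t - (\<Sum>i\<le>k. a i * t ^ i))" "j \<le> k"
  shows "(deriv ^^ j) h 0 / fact j = a j"
proof -
  let ?p = "\<lambda>t. \<Sum>i\<le>k. a i * t ^ i"
  let ?F = "\<Sum>i\<le>k. fps_const (a i) * fps_X ^ i"
  have p: "?p has_fps_expansion ?F" by (intro fps_expansion_intros)
  have Z: "(deriv ^^ j) (\<lambda>t. h t - ?p t) 0 = 0"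
    by (rule vanish_imp_deriv_0[OF _ assms(2,3)]) (intro analytic_intros assms(1))
  have E: "(\<lambda>t. h t - ?p t) has_fps_expansion fps_expansion h 0 - ?F"
    using analytic_at_imp_has_fps_expansion_0[OF assms(1)] p by (intro fps_expansion_intros)
  have "fps_nth (fps_expansion h 0 - ?F) j = 0"
    unfolding fps_nth_fps_expansion[OF E] Z by simp
  hence "fps_nth (fps_expansion h 0) j = fps_nth ?F j" by simp
  also have "fps_nth ?F j = (\<Sum>i\<le>k. if j = i then a i else 0)"
    by (simp add: fps_sum_nth fps_X_power_nth if_distrib cong: if_cong)
  also have "\<dots> = a j" using assms(3) by simp
  finally show ?thesis by (simp add: fps_expansion_def)
qed

lemma vanish_compose_curve:
  fixes \<phi> :: "complex \<Rightarrow> complex ^ 'n"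
  assumes "vanish k f" "\<And>i. (\<lambda>t. \<phi> t $ i) analytic_on {0}" "\<phi> 0 = 0"
  shows "vanish k (\<lambda>t. f (\<phi> t))"
proof -
  have "\<exists>c. \<forall>\<^sub>F t in nhds 0. norm (\<phi> t $ i) \<le> c * norm t" for i
  proof -
    obtain g where g: "g analytic_on {0}" "\<forall>\<^sub>F t in nhds 0. \<phi> t $ i = t * g t"
      using analytic_divide_t[OF assms(2)[of i]] assms(3) by auto
    have "vanish (1 + 0) (\<lambda>t. t ^ 1 * g t)"
      by (rule vanish_mult[OF vanish_t_power vanish_bounded[OF analytic_tendsto_nhds[OF g(1)]]])
    hence "vanish 1 (\<lambda>t. \<phi> t $ i)"
      using vanish_cong[of 1 "\<lambda>t. t * g t" "\<lambda>t. \<phi> t $ i"] g(2) by (simp add: eq_commute)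
    thus ?thesis by (simp add: vanish_def)
  qed
  then obtain c where c: "\<And>i. \<forall>\<^sub>F t in nhds 0. norm (\<phi> t $ i) \<le> c i * norm t" by metis
  have 1: "\<forall>\<^sub>F t in nhds 0. norm (\<phi> t) \<le> (\<Sum>i\<in>UNIV. c i) * norm t"
  proof -
    have "\<forall>\<^sub>F t in nhds 0. \<forall>i. norm (\<phi> t $ i) \<le> c i * norm t"
      using c by (rule eventually_all_finite)
    thus ?thesis
    proof eventually_elim
      case (elim t)
      have "norm (\<phi> t) \<le> (\<Sum>i\<in>UNIV. norm (\<phi> t $ i))" unfolding norm_vec_def by (rule L2_set_le_sum) simp
      also have "\<dots> \<le> (\<Sum>i\<in>UNIV. c i * norm t)" by (rule sum_mono) (use elim in simp)
      finally show ?case by (simp add: sum_distrib_right)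
    qed
  qed
  obtain d where d: "d \<ge> 0" "\<forall>\<^sub>F x in nhds 0. norm (f x) \<le> d * norm x ^ k" using assms(1) by (rule vanishE)
  have "\<forall>\<^sub>F t in nhds 0. norm (f (\<phi> t)) \<le> d * norm (\<phi> t) ^ k"
    using curve_tendsto[OF assms(2,3)] d(2) unfolding filterlim_iff by blast
  hence "\<forall>\<^sub>F t in nhds 0. norm (f (\<phi> t)) \<le> (d * (\<Sum>i\<in>UNIV. c i) ^ k) * norm t ^ k"
    using 1
  proof eventually_elim
    case (elim t)
    have "norm (\<phi> t) ^ k \<le> ((\<Sum>i\<in>UNIV. c i) * norm t) ^ k" by (rule power_mono) (use elim in auto)
    hence "d * norm (\<phi> t) ^ k \<le> d * ((\<Sum>i\<in>UNIV. c i) * norm t) ^ k" using d(1) by (rule mult_left_mono)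
    thus ?case using elim by (simp add: power_mult_distrib mult.assoc)
  qed
  thus ?thesis unfolding vanish_def by blast
qed

lemma line_curve:
  fixes x :: "complex ^ 'n"
  shows "(\<lambda>t. (t *s x) $ i) analytic_on {0}" "0 *s x = 0"
  by (auto intro!: analytic_intros)

section \<open>Homogeneous polynomials and jets\<close>

text \<open>
  Homogeneous polynomial functions without multi-indices. The rules match the way in which
  Hadamard's lemma produces leading terms.
\<close>

inductive hpoly :: "nat \<Rightarrow> (complex ^ 'n \<Rightarrow> complex) \<Rightarrow> bool" where
  hpoly_const: "hpoly 0 (\<lambda>_. c)"
| hpoly_coord: "hpoly k s \<Longrightarrow> hpoly (Suc k) (\<lambda>x. x $ i * s x)"
| hpoly_add: "hpoly k s \<Longrightarrow> hpoly k t \<Longrightarrow> hpoly k (\<lambda>x. s x + t x)"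

lemma hpoly_0: "hpoly k (\<lambda>_ :: complex ^ 'n. 0)"
proof (induction k)
  case (Suc k) thus ?case using hpoly_coord[OF Suc, of undefined] by simp
qed (rule hpoly_const)

lemma hpoly_sum: "(\<And>i. i \<in> A \<Longrightarrow> hpoly k (s i)) \<Longrightarrow> hpoly k (\<lambda>x. \<Sum>i\<in>A. s i x)"
  by (induction A rule: infinite_finite_induct) (auto intro: hpoly_0 hpoly_add)

lemma hpoly_homogeneous: "hpoly k s \<Longrightarrow> s (c *s x) = c ^ k * s x"
  by (induction rule: hpoly.induct) (auto simp: algebra_simps)

lemma hpoly_hol_germ: "hpoly k s \<Longrightarrow> hol_germ s"
  by (induction rule: hpoly.induct) (auto intro: hol_intros)

lemma hpoly_vanish: "hpoly k s \<Longrightarrow> vanish k s"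
  by (induction rule: hpoly.induct) (use vanish_mult[OF vanish_coord] in \<open>auto intro: vanish_const vanish_add\<close>)

text \<open>
  Iteration of Hadamard's lemma.
\<close>

lemma taylor_expansion:
  fixes f :: "complex ^ 'n \<Rightarrow> complex"
  assumes "hol_germ f"
  shows "\<exists>g. (\<forall>j. hpoly j (g j)) \<and> vanish (Suc N) (\<lambda>x. f x - (\<Sum>j\<le>N. g j x))"
  using assms
proof (induction N arbitrary: f)
  case 0
  have "vanish 1 (\<lambda>x. f x - f 0)"
    by (rule vanish_hol_germ_zero) (use 0 in \<open>auto intro: hol_intros\<close>)
  thus ?case by (intro exI[of _ "\<lambda>j. if j = 0 then (\<lambda>_. f 0) else (\<lambda>_. 0)"]) (auto intro: hpoly_const hpoly_0)
next
  case (Suc N)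
  obtain h where h: "\<And>i. hol_germ (h i)" "\<forall>\<^sub>F x in nhds 0. f x = f 0 + (\<Sum>i\<in>UNIV. x $ i * h i x)"
    using hol_germ_hadamard[OF Suc.prems] by blast
  have "\<forall>i. \<exists>g. (\<forall>j. hpoly j (g j)) \<and> vanish (Suc N) (\<lambda>x. h i x - (\<Sum>j\<le>N. g j x))"
    using Suc.IH[OF h(1)] by blast
  then obtain g where g: "\<And>i j. hpoly j (g i j)" "\<And>i. vanish (Suc N) (\<lambda>x. h i x - (\<Sum>j\<le>N. g i j x))"
    by metis
  define G where "G j = (case j of 0 \<Rightarrow> (\<lambda>_. f 0) | Suc j \<Rightarrow> (\<lambda>x. \<Sum>i\<in>UNIV. x $ i * g i j x))" for j
  have "hpoly j (G j)" for j
    by (cases j) (auto simp: G_def intro!: hpoly_const hpoly_sum hpoly_coord g)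
  moreover have "vanish (Suc (Suc N)) (\<lambda>x. f x - (\<Sum>j\<le>Suc N. G j x))"
  proof -
    have "vanish (1 + Suc N) (\<lambda>x. x $ i * (h i x - (\<Sum>j\<le>N. g i j x)))" for i
      by (rule vanish_mult[OF vanish_coord g(2)])
    hence "vanish (Suc (Suc N)) (\<lambda>x. \<Sum>i\<in>UNIV. x $ i * (h i x - (\<Sum>j\<le>N. g i j x)))"
      by (intro vanish_sum) simp
    thus ?thesis
    proof (rule vanish_cong)
      show "\<forall>\<^sub>F x in nhds 0. (\<Sum>i\<in>UNIV. x $ i * (h i x - (\<Sum>j\<le>N. g i j x))) = f x - (\<Sum>j\<le>Suc N. G j x)"
        using h(2)
      proof eventually_elim
        case (elim x)
        have "(\<Sum>j\<le>Suc N. G j x) = f 0 + (\<Sum>j\<le>N. \<Sum>i\<in>UNIV. x $ i * g i j x)"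
          by (subst sum.atMost_Suc_shift) (simp add: G_def)
        also have "(\<Sum>j\<le>N. \<Sum>i\<in>UNIV. x $ i * g i j x) = (\<Sum>i\<in>UNIV. x $ i * (\<Sum>j\<le>N. g i j x))"
          by (subst sum.swap) (simp add: sum_distrib_left)
        finally show ?case using elim by (simp add: right_diff_distrib sum_subtractf)
      qed
    qed
  qed
  ultimately show ?case by blast
qed

text \<open>
  It suffices to compare coefficients along every line through 0.
\<close>

lemma jet_unique:
  fixes f :: "complex ^ 'n \<Rightarrow> complex"
  assumes "hol_germ f" "\<And>j. hpoly j (g j)" "vanish (Suc k) (\<lambda>x. f x - (\<Sum>j\<le>k. g j x))"
  shows "jet k f = (\<lambda>x. \<Sum>j\<le>k. g j x)"
proof
  fix x
  have "(deriv ^^ j) (\<lambda>t. f (t *s x)) 0 / fact j = g j x" if "j \<le> k" for j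
  proof (rule taylor_coefficient_unique[OF _ _ that])
    show "(\<lambda>t. f (t *s x)) analytic_on {0}"
      by (rule analytic_compose_hol_germ[OF assms(1) line_curve])
    have "vanish (Suc k) (\<lambda>t. f (t *s x) - (\<Sum>j\<le>k. g j (t *s x)))"
      using vanish_compose_curve[OF assms(3) line_curve] by simp
    thus "vanish (Suc k) (\<lambda>t. f (t *s x) - (\<Sum>i\<le>k. g i x * t ^ i))"
      by (simp add: hpoly_homogeneous[OF assms(2)] mult.commute)
  qed
  thus "jet k f x = (\<Sum>j\<le>k. g j x)" unfolding jet_def by simp
qed

lemma jet_eq_0_iff:
  fixes f :: "complex ^ 'n \<Rightarrow> complex"
  assumes "hol_germ f"
  shows "jet k f = (\<lambda>_. 0) \<longleftrightarrow> vanish (Suc k) f"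
proof
  assume j: "jet k f = (\<lambda>_. 0)"
  obtain g where g: "\<And>j. hpoly j (g j)" "vanish (Suc k) (\<lambda>x. f x - (\<Sum>j\<le>k. g j x))"
    using taylor_expansion[OF assms, of k] by blast
  have "(\<Sum>j\<le>k. g j x) = 0" for x using jet_unique[OF assms g] j by (metis)
  thus "vanish (Suc k) f" using g(2) by simp
next
  assume "vanish (Suc k) f"
  thus "jet k f = (\<lambda>_. 0)" using jet_unique[OF assms, of "\<lambda>_ _. 0" k] by (simp add: hpoly_0)
qed

section \<open>Expansions of plane germs in coordinates\<close>

lemma chart_hadamard_pair:
  assumes "chart X Y" "hol_germ f"
  shows "\<exists>UW. hol_germ (fst UW) \<and> hol_germ (snd UW) \<and> (\<forall>\<^sub>F p in nhds 0. f p = f 0 + X p * fst UW p + Y p * snd UW p)"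
proof -
  obtain U W where "hol_germ U" "hol_germ W" "\<forall>\<^sub>F p in nhds 0. f p = f 0 + X p * U p + Y p * W p"
    by (rule chart_hadamard[OF assms])
  thus ?thesis by (intro exI[of _ "(U, W)"]) simp
qed

text \<open>
  If all coefficients of an expansion of degree \<open>k\<close> vanish at 0, Hadamard's lemma
  writes each of them as \<open>X U + Y W\<close>; collecting terms gives an expansion of degree
  \<open>k + 1\<close>.
\<close>

lemma raise_expansion_degree:
  fixes A :: "nat \<Rightarrow> complex ^ 2 \<Rightarrow> complex"
  assumes ch: "chart X Y" and A: "\<And>j. hol_germ (A j)" "\<And>j. j \<le> k \<Longrightarrow> A j 0 = 0"
    and f: "\<forall>\<^sub>F p in nhds 0. f p = (\<Sum>j\<le>k. X p ^ j * Y p ^ (k - j) * A j p)"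
  shows "\<exists>A'. (\<forall>j. hol_germ (A' j)) \<and> (\<forall>\<^sub>F p in nhds 0. f p = (\<Sum>j\<le>Suc k. X p ^ j * Y p ^ (Suc k - j) * A' j p))"
proof -
  define P where "P j UW \<longleftrightarrow> hol_germ (fst UW) \<and> hol_germ (snd UW) \<and>
    (\<forall>\<^sub>F p in nhds 0. A j p = A j 0 + X p * fst UW p + Y p * snd UW p)" for j UW
  have "\<forall>j. \<exists>UW. P j UW" unfolding P_def using chart_hadamard_pair[OF ch A(1)] by simp
  from choice[OF this] obtain UW where PUW: "\<forall>j. P j (UW j)" by blast
  define U W where "U j = fst (UW j)" and "W j = snd (UW j)" for j
  have UW: "hol_germ (U j)" "hol_germ (W j)" "\<forall>\<^sub>F p in nhds 0. A j p = A j 0 + X p * U j p + Y p * W j p" for j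
    using PUW unfolding P_def U_def W_def by simp_all
  define A' where "A' j p = (if j = 0 then 0 else U (j - 1) p) + (if j \<le> k then W j p else 0)" for j p
  have "hol_germ (A' j)" for j
    unfolding A'_def[abs_def] by (cases "j = 0"; cases "j \<le> k") (auto intro!: hol_intros UW)
  moreover have "\<forall>\<^sub>F p in nhds 0. \<forall>j\<in>{..k}. A j p = A j 0 + X p * U j p + Y p * W j p"
    using UW(3) by (simp add: eventually_ball_finite)
  hence "\<forall>\<^sub>F p in nhds 0. f p = (\<Sum>j\<le>Suc k. X p ^ j * Y p ^ (Suc k - j) * A' j p)"
    using f
  proof eventually_elim
    case (elim p)
    have "(\<Sum>j\<le>Suc k. X p ^ j * Y p ^ (Suc k - j) * A' j p) =
       (\<Sum>j\<le>Suc k. X p ^ j * Y p ^ (Suc k - j) * (if j = 0 then 0 else U (j - 1) p)) +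
       (\<Sum>j\<le>Suc k. X p ^ j * Y p ^ (Suc k - j) * (if j \<le> k then W j p else 0))"
      by (simp add: A'_def distrib_left sum.distrib)
    also have "(\<Sum>j\<le>Suc k. X p ^ j * Y p ^ (Suc k - j) * (if j = 0 then 0 else U (j - 1) p)) =
       (\<Sum>j\<le>k. X p ^ j * Y p ^ (k - j) * (X p * U j p))"
      by (subst sum.atMost_Suc_shift) (simp add: mult_ac)
    also have "(\<Sum>j\<le>Suc k. X p ^ j * Y p ^ (Suc k - j) * (if j \<le> k then W j p else 0)) =
       (\<Sum>j\<le>k. X p ^ j * Y p ^ (k - j) * (Y p * W j p))"
      by (simp add: Suc_diff_le mult_ac)
    also have "(\<Sum>j\<le>k. X p ^ j * Y p ^ (k - j) * (X p * U j p)) + (\<Sum>j\<le>k. X p ^ j * Y p ^ (k - j) * (Y p * W j p))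
       = (\<Sum>j\<le>k. X p ^ j * Y p ^ (k - j) * A j p)"
      unfolding sum.distrib[symmetric]
      by (rule sum.cong) (use elim(1) A(2) in \<open>simp_all add: distrib_left[symmetric]\<close>)
    finally show ?case using elim(2) by simp
  qed
  ultimately show ?thesis by blast
qed

lemma chart_vanish:
  assumes "chart X Y" "\<And>j. j \<le> k \<Longrightarrow> hol_germ (A j)"
    "\<forall>\<^sub>F p in nhds 0. f p = (\<Sum>j\<le>k. X p ^ j * Y p ^ (k - j) * A j p)"
  shows "vanish k f"
proof (rule vanish_cong)
  note C = chartD[OF assms(1)]
  show "vanish k (\<lambda>p. \<Sum>j\<le>k. X p ^ j * Y p ^ (k - j) * A j p)"
  proof (rule vanish_sum)
    fix j assume "j \<in> {..k}"
    have "vanish (1 * j + 1 * (k - j) + 0) (\<lambda>p. X p ^ j * Y p ^ (k - j) * A j p)"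
      by (intro vanish_mult vanish_power vanish_hol_germ_zero C vanish_hol_germ assms(2))
         (use \<open>j \<in> {..k}\<close> in simp)
    thus "vanish k (\<lambda>p. X p ^ j * Y p ^ (k - j) * A j p)" using \<open>j \<in> {..k}\<close> by simp
  qed
  show "\<forall>\<^sub>F p in nhds 0. (\<Sum>j\<le>k. X p ^ j * Y p ^ (k - j) * A j p) = f p"
    using assms(3) by (auto elim: eventually_mono)
qed

text \<open>
  On the line through \<open>(\<alpha>, 1)\<close> the coefficient of \<open>t^k\<close> is the
  polynomial in \<open>\<alpha>\<close> with coefficients \<open>A j 0\<close>. It vanishes for
  all \<open>\<alpha>\<close>.
\<close>

lemma leading_coefficients_0:
  fixes A :: "nat \<Rightarrow> complex ^ 2 \<Rightarrow> complex"
  assumes A: "\<And>j. hol_germ (A j)" and f: "\<forall>\<^sub>F p in nhds 0. f p = (\<Sum>j\<le>k. p $ 1 ^ j * p $ 2 ^ (k - j) * A j p)"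
    and "vanish (Suc k) f" "j \<le> k"
  shows "A j 0 = 0"
proof -
  have "(\<Sum>j\<le>k. A j 0 * \<alpha> ^ j) = 0" for \<alpha>
  proof -
    let ?x = "vector [\<alpha>, 1] :: complex ^ 2"
    define w where "w t = (\<Sum>j\<le>k. \<alpha> ^ j * A j (t *s ?x))" for t
    have "w analytic_on {0}" unfolding w_def
      by (intro analytic_intros analytic_compose_hol_germ[OF A line_curve])
    moreover have "vanish (Suc k) (\<lambda>t. f (t *s ?x))"
      by (rule vanish_compose_curve[OF assms(3) line_curve])
    moreover have "\<forall>\<^sub>F t in nhds 0. f (t *s ?x) = t ^ k * w t"
    proof -
      have "\<forall>\<^sub>F t in nhds 0. (\<lambda>p. f p = (\<Sum>j\<le>k. p $ 1 ^ j * p $ 2 ^ (k - j) * A j p)) (t *s ?x)"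
        using curve_tendsto[OF line_curve, of ?x] f unfolding filterlim_iff by blast
      thus ?thesis
      proof eventually_elim
        case (elim t)
        have "(t * \<alpha>) ^ j * t ^ (k - j) * c = t ^ k * (\<alpha> ^ j * c)" if "j \<le> k" for j c
        proof -
          have "t ^ k = t ^ j * t ^ (k - j)" using power_add[of t j "k - j"] that by simp
          thus ?thesis by (simp add: power_mult_distrib mult_ac)
        qed
        hence "(\<Sum>j\<le>k. (t * \<alpha>) ^ j * t ^ (k - j) * A j (t *s ?x)) = (\<Sum>j\<le>k. t ^ k * (\<alpha> ^ j * A j (t *s ?x)))"
          by (intro sum.cong) simp_all
        thus ?case using elim by (simp add: w_def sum_distrib_left)
      qed
    qed
    ultimately show ?thesis
      using vanish_factor[OF vanish_cong[of "Suc k" "\<lambda>t. f (t *s ?x)"], of k w] by (simp add: w_def mult.commute)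
  qed
  hence "\<forall>x. (\<Sum>j\<le>k. A j 0 * x ^ j) = (\<Sum>j\<le>k. 0 * x ^ j)" by simp
  thus ?thesis unfolding polyfun_eq_coeffs using assms(4) by simp
qed

text \<open>
  Each factor of a sum of products of germs vanishing at 0 is a combination of the two
  coordinates.
\<close>

lemma max_ideal_square_expansion:
  fixes f :: "complex ^ 2 \<Rightarrow> complex"
  assumes "f \<in> max_ideal_square"
  shows "\<exists>A. (\<forall>j. hol_germ (A j)) \<and> (\<forall>\<^sub>F p in nhds 0. f p = (\<Sum>j\<le>2. p $ 1 ^ j * p $ 2 ^ (2 - j) * A j p))"
proof -
  obtain N :: nat and a b where N: "\<And>j. j < N \<Longrightarrow> a j \<in> max_ideal \<and> b j \<in> max_ideal"
    "\<forall>\<^sub>F x in nhds 0. f x = (\<Sum>j<N. a j x * b j x)"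
    using assms unfolding max_ideal_square_def by blast
  define P where "P g UW \<longleftrightarrow> hol_germ (fst UW) \<and> hol_germ (snd UW) \<and>
    (\<forall>\<^sub>F p in nhds 0. g p = p $ 1 * fst UW p + p $ 2 * snd UW p)" for g :: "complex ^ 2 \<Rightarrow> complex" and UW
  have H: "\<exists>UW. P g UW" if "g \<in> max_ideal" for g :: "complex ^ 2 \<Rightarrow> complex"
    using chart_hadamard_pair[OF chart_standard, of g] that by (simp add: max_ideal_def P_def)
  have "\<forall>j. \<exists>UW. j < N \<longrightarrow> P (a j) UW" using H N(1) by blast
  from choice[OF this] obtain UW where PUW: "\<forall>j. j < N \<longrightarrow> P (a j) (UW j)" by blast
  have "\<forall>j. \<exists>UW. j < N \<longrightarrow> P (b j) UW" using H N(1) by blast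
  from choice[OF this] obtain UW' where PUW': "\<forall>j. j < N \<longrightarrow> P (b j) (UW' j)" by blast
  define U W U' W' where "U j = fst (UW j)" and "W j = snd (UW j)" and "U' j = fst (UW' j)" and "W' j = snd (UW' j)" for j
  have UW: "hol_germ (U j)" "hol_germ (W j)" "\<forall>\<^sub>F p in nhds 0. a j p = p $ 1 * U j p + p $ 2 * W j p"
    and UW': "hol_germ (U' j)" "hol_germ (W' j)" "\<forall>\<^sub>F p in nhds 0. b j p = p $ 1 * U' j p + p $ 2 * W' j p"
    if "j < N" for j
    using PUW PUW' that unfolding P_def U_def W_def U'_def W'_def by simp_all
  define A where "A i p = (if i = (2::nat) then \<Sum>j<N. U j p * U' j p else if i = 1 then \<Sum>j<N. U j p * W' j p + W j p * U' j p
     else \<Sum>j<N. W j p * W' j p)" for i p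
  have "hol_germ (A i)" for i
    unfolding A_def[abs_def] by (cases "i = 2"; cases "i = 1") (auto intro!: hol_intros UW UW')
  moreover have "\<forall>\<^sub>F p in nhds 0. \<forall>j\<in>{..<N}. a j p = p $ 1 * U j p + p $ 2 * W j p \<and> b j p = p $ 1 * U' j p + p $ 2 * W' j p"
    using UW(3) UW'(3) by (intro eventually_ball_finite) (auto intro: eventually_conj)
  hence "\<forall>\<^sub>F p in nhds 0. f p = (\<Sum>j\<le>2. p $ 1 ^ j * p $ 2 ^ (2 - j) * A j p)"
    using N(2)
  proof eventually_elim
    case (elim p)
    have "f p = (\<Sum>j<N. p $ 1 ^ 2 * (U j p * U' j p) + p $ 1 * p $ 2 * (U j p * W' j p + W j p * U' j p)
         + p $ 2 ^ 2 * (W j p * W' j p))"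
      unfolding elim(2) by (rule sum.cong) (use elim(1) in \<open>auto simp: power2_eq_square algebra_simps\<close>)
    also have "\<dots> = p $ 1 ^ 2 * (\<Sum>j<N. U j p * U' j p) + p $ 1 * p $ 2 * (\<Sum>j<N. U j p * W' j p + W j p * U' j p)
         + p $ 2 ^ 2 * (\<Sum>j<N. W j p * W' j p)"
      by (simp only: sum_distrib_left sum.distrib[symmetric])
    also have "\<dots> = (\<Sum>j\<le>2. p $ 1 ^ j * p $ 2 ^ (2 - j) * A j p)"
      by (simp add: numeral_2_eq_2 A_def)
    finally show ?case .
  qed
  ultimately show ?thesis by blast
qed

section \<open>Classification of triple points of plane curves\<close>

text \<open>
  With weight 2 for \<open>X\<close> and 1 for \<open>Y\<close> every term has weight at least
  6, the weighted degree of the family \<open>J_(2,i)\<close>, and the term \<open>X^3\<close>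
  is present. All classes \<open>J_(k,i)\<close>, \<open>E_(6k)\<close>,
  \<open>E_(6k+1)\<close>, \<open>E_(6k+2)\<close> with \<open>k \<ge> 2\<close> are covered by
  this one condition.
\<close>

definition weight6_form :: "(complex ^ 2 \<Rightarrow> complex) \<Rightarrow> bool" where
  "weight6_form f \<longleftrightarrow> (\<exists>X Y A B C D. chart X Y \<and> hol_germ A \<and> hol_germ B \<and> hol_germ C \<and> hol_germ D \<and> A 0 \<noteq> 0 \<and>
     (\<forall>\<^sub>F p in nhds 0. f p = X p ^ 3 * A p + X p ^ 2 * Y p ^ 2 * B p + X p * Y p ^ 4 * C p + Y p ^ 6 * D p))"

lemma hadamard_zero:
  assumes "chart X Y" "hol_germ f" "f 0 = 0"
  shows "\<exists>U W. hol_germ U \<and> hol_germ W \<and> (\<forall>\<^sub>F p in nhds 0. f p = X p * U p + Y p * W p)"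
  by (rule chart_hadamard[OF assms(1,2)]) (use assms(3) in auto)

text \<open>
  The cubic leading form is a cube. Rewriting the coefficients by Hadamard's lemma, the terms
  \<open>Y^4\<close>, \<open>X Y^3\<close>, \<open>Y^5\<close> are met in the order of their
  weight for the weights 2, 1 of \<open>X, Y\<close>, namely 4, 5, 5. The first one with
  non-zero coefficient gives type \<open>E6\<close>, \<open>E7\<close>, \<open>E8\<close>; if
  all three coefficients vanish, the weight is at least 6.
\<close>

lemma triple_line_classification:
  fixes f :: "complex ^ 2 \<Rightarrow> complex"
  assumes ch: "chart X Y" and hol: "hol_germ A" "hol_germ B" "hol_germ C" "hol_germ D"
    and "A 0 \<noteq> 0" "B 0 = 0" "C 0 = 0" "D 0 = 0"
    and f: "\<forall>\<^sub>F p in nhds 0. f p = X p ^ 3 * A p + X p ^ 2 * Y p * B p + X p * Y p ^ 2 * C p + Y p ^ 3 * D p"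
  shows "simple_germ f \<or> weight6_form f"
proof -
  note c = chartD[OF ch]
  obtain B1 B2 where B: "hol_germ B1" "hol_germ B2" "\<forall>\<^sub>F p in nhds 0. B p = X p * B1 p + Y p * B2 p"
    using hadamard_zero[OF ch hol(2) assms(7)] by blast
  obtain C1 C2 where C: "hol_germ C1" "hol_germ C2" "\<forall>\<^sub>F p in nhds 0. C p = X p * C1 p + Y p * C2 p"
    using hadamard_zero[OF ch hol(3) assms(8)] by blast
  obtain D1 D2 where D: "hol_germ D1" "hol_germ D2" "\<forall>\<^sub>F p in nhds 0. D p = X p * D1 p + Y p * D2 p"
    using hadamard_zero[OF ch hol(4) assms(9)] by blast
  define A' B' C' where "A' p = A p + Y p * B1 p" and "B' p = B2 p + C1 p" and "C' p = C2 p + D1 p" for p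
  have h': "hol_germ A'" "hol_germ B'" "hol_germ C'"
    unfolding A'_def[abs_def] B'_def[abs_def] C'_def[abs_def] by (intro hol_intros hol c B C D)+
  have A0: "A' 0 \<noteq> 0" using c assms(6) by (simp add: A'_def)
  have f1: "\<forall>\<^sub>F p in nhds 0. f p = X p ^ 3 * A' p + X p ^ 2 * Y p ^ 2 * B' p + X p * Y p ^ 3 * C' p + Y p ^ 4 * D2 p"
    using f B(3) C(3) D(3)
  proof eventually_elim
    case (elim p)
    show ?case unfolding elim A'_def B'_def C'_def by algebra
  qed
  show ?thesis
  proof (cases "D2 0 = 0")
    case False
    with simple_E6[OF ch h' D(2) A0 _ f1] show ?thesis by simp
  next
    case True
    obtain E1 E2 where E: "hol_germ E1" "hol_germ E2" "\<forall>\<^sub>F p in nhds 0. D2 p = X p * E1 p + Y p * E2 p"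
      using hadamard_zero[OF ch D(2) True] by blast
    define C'' where "C'' p = C' p + Y p * E1 p" for p
    have C'': "hol_germ C''" unfolding C''_def[abs_def] by (intro hol_intros h' c E)
    have f2: "\<forall>\<^sub>F p in nhds 0. f p = X p ^ 3 * A' p + X p ^ 2 * Y p ^ 2 * B' p + X p * Y p ^ 3 * C'' p + Y p ^ 5 * E2 p"
      using f1 E(3)
    proof eventually_elim
      case (elim p)
      show ?case unfolding elim C''_def by algebra
    qed
    show ?thesis
    proof (cases "C'' 0 = 0")
      case False
      with simple_E7[OF ch h'(1,2) C'' E(2) A0 _ f2] show ?thesis by simp
    next
      case True
      obtain G1 G2 where G: "hol_germ G1" "hol_germ G2" "\<forall>\<^sub>F p in nhds 0. C'' p = X p * G1 p + Y p * G2 p"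
        using hadamard_zero[OF ch C'' True] by blast
      define B'' where "B'' p = B' p + Y p * G1 p" for p
      have B'': "hol_germ B''" unfolding B''_def[abs_def] by (intro hol_intros h' c G)
      have f3: "\<forall>\<^sub>F p in nhds 0. f p = X p ^ 3 * A' p + X p ^ 2 * Y p ^ 2 * B'' p + X p * Y p ^ 4 * G2 p + Y p ^ 5 * E2 p"
        using f2 G(3)
      proof eventually_elim
        case (elim p)
        show ?case unfolding elim B''_def by algebra
      qed
      show ?thesis
      proof (cases "E2 0 = 0")
        case False
        with simple_E8[OF ch h'(1) B'' G(2) E(2) A0 _ f3] show ?thesis by simp
      next
        case True
        obtain H1 H2 where H: "hol_germ H1" "hol_germ H2" "\<forall>\<^sub>F p in nhds 0. E2 p = X p * H1 p + Y p * H2 p"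
          using hadamard_zero[OF ch E(2) True] by blast
        define G' where "G' p = G2 p + Y p * H1 p" for p
        have G': "hol_germ G'" unfolding G'_def[abs_def] by (intro hol_intros c G H)
        have "\<forall>\<^sub>F p in nhds 0. f p = X p ^ 3 * A' p + X p ^ 2 * Y p ^ 2 * B'' p + X p * Y p ^ 4 * G' p + Y p ^ 6 * H2 p"
          using f3 H(3)
        proof eventually_elim
          case (elim p)
          show ?case unfolding elim G'_def by algebra
        qed
        hence "weight6_form f" unfolding weight6_form_def using ch h'(1) B'' G' H(2) A0 by blast
        thus ?thesis ..
      qed
    qed
  qed
qed

lemma sum_le_2: "(\<Sum>j\<le>2. g j) = g 0 + g 1 + g (2::nat)" for g :: "nat \<Rightarrow> complex"
  by (simp add: numeral_2_eq_2)

lemma sum_le_3: "(\<Sum>j\<le>3. g j) = g 0 + g 1 + g 2 + g (3::nat)" for g :: "nat \<Rightarrow> complex"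
  by (simp add: numeral_2_eq_2 numeral_3_eq_3)

text \<open>
  The line \<open>X = l Y\<close> becomes the first coordinate axis.
\<close>

lemma turn_chart:
  assumes "chart X Y"
  shows "chart Y (\<lambda>p. X p - l * Y p)"
proof -
  have "chart (\<lambda>p. X p + - l * Y p) Y" by (rule chart_shift[OF assms hol_germ_const])
  thus ?thesis by (simp add: chart_sym)
qed

text \<open>
  The hypothesis on \<open>A\<close> puts one line of the cubic leading form on the axis
  \<open>Y = 0\<close>, and the cases are its multiplicity. If the line is simple, or double, in
  which case the third line is simple, a simple line can be used to recognise type
  \<open>D\<close>. A triple line was treated above.
\<close>

lemma cubic_classification_aux:
  fixes f :: "complex ^ 2 \<Rightarrow> complex"
  assumes ch: "chart X Y" and hol: "hol_germ A" "hol_germ B" "hol_germ C" "hol_germ D"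
    and "A 0 = 0" "reduced_germ f" "\<not> vanish 4 f"
    and f: "\<forall>\<^sub>F p in nhds 0. f p = X p ^ 3 * A p + X p ^ 2 * Y p * B p + X p * Y p ^ 2 * C p + Y p ^ 3 * D p"
  shows "simple_germ f \<or> weight6_form f"
proof (cases "B 0 = 0")
  case False
  thus ?thesis using simple_D[OF ch hol assms(6) _ assms(7) f] by simp
next
  case B0: True
  show ?thesis
  proof (cases "C 0 = 0")
    case False
    \<comment> \<open>The cubic form is \<open>Y^2 (C X + D Y)\<close>, and \<open>X = l Y\<close>
       is its simple line.\<close>
    define l where "l = - D 0 / C 0"
    define Y' where "Y' p = X p - l * Y p" for p
    have ch': "chart Y Y'" unfolding Y'_def[abs_def] by (rule turn_chart[OF ch])
    define A' B' C' where "A' p = l ^ 3 * A p + l ^ 2 * B p + l * C p + D p"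
      and "B' p = 3 * l ^ 2 * A p + 2 * l * B p + C p" and "C' p = 3 * l * A p + B p" for p
    have h': "hol_germ A'" "hol_germ B'" "hol_germ C'"
      unfolding A'_def[abs_def] B'_def[abs_def] C'_def[abs_def] by (intro hol_intros hol)+
    have "\<forall>\<^sub>F p in nhds 0. f p = Y p ^ 3 * A' p + Y p ^ 2 * Y' p * B' p + Y p * Y' p ^ 2 * C' p + Y' p ^ 3 * A p"
      using f
    proof eventually_elim
      case (elim p)
      show ?case unfolding elim A'_def B'_def C'_def Y'_def by algebra
    qed
    from simple_D[OF ch' h' hol(1) _ _ assms(7) this] show ?thesis
      using False assms(6) B0 by (simp add: A'_def B'_def l_def)
  next
    case C0: True
    show ?thesis
    proof (cases "D 0 = 0")
      case False
      have "\<forall>\<^sub>F p in nhds 0. f p = Y p ^ 3 * D p + Y p ^ 2 * X p * C p + Y p * X p ^ 2 * B p + X p ^ 3 * A p"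
        using f by eventually_elim simp
      from triple_line_classification[OF chart_sym[OF ch] hol(4,3,2,1) False C0 B0 assms(6) this]
      show ?thesis .
    next
      case True
      define K where "K j = (if j = 0 then D else if j = 1 then C else if j = 2 then B else A)" for j :: nat
      have K: "hol_germ (K j)" "K j 0 = 0" for j
        using hol assms(6) B0 C0 True by (auto simp: K_def)
      have "\<forall>\<^sub>F p in nhds 0. f p = (\<Sum>j\<le>3. X p ^ j * Y p ^ (3 - j) * K j p)"
        using f by eventually_elim (simp add: K_def sum_le_3 algebra_simps)
      from raise_expansion_degree[OF ch K this] obtain K' where K': "\<And>j. hol_germ (K' j)"
        "\<forall>\<^sub>F p in nhds 0. f p = (\<Sum>j\<le>Suc 3. X p ^ j * Y p ^ (Suc 3 - j) * K' j p)" by blast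
      from chart_vanish[OF ch K'(1) K'(2)] have "vanish 4 f" by simp
      thus ?thesis using assms(8) by simp
    qed
  qed
qed

text \<open>
  A linear factor of the cubic leading form, which exists over the complex numbers, is moved to
  a coordinate axis.
\<close>

lemma cubic_classification:
  fixes f :: "complex ^ 2 \<Rightarrow> complex"
  assumes ch: "chart X Y" and hol: "hol_germ A" "hol_germ B" "hol_germ C" "hol_germ D"
    and "reduced_germ f" "\<not> vanish 4 f"
    and f: "\<forall>\<^sub>F p in nhds 0. f p = X p ^ 3 * A p + X p ^ 2 * Y p * B p + X p * Y p ^ 2 * C p + Y p ^ 3 * D p"
  shows "simple_germ f \<or> weight6_form f"
proof (cases "A 0 = 0")
  case True
  thus ?thesis by (rule cubic_classification_aux[OF ch hol _ assms(6,7) f])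
next
  case False
  have "\<not> constant (poly [:D 0, C 0, B 0, A 0:])"
    using False by (simp add: constant_degree)
  then obtain l where l: "poly [:D 0, C 0, B 0, A 0:] l = 0"
    using fundamental_theorem_of_algebra by blast
  define Y' where "Y' p = X p - l * Y p" for p
  have ch': "chart Y Y'" unfolding Y'_def[abs_def] by (rule turn_chart[OF ch])
  define A' B' C' where "A' p = l ^ 3 * A p + l ^ 2 * B p + l * C p + D p"
    and "B' p = 3 * l ^ 2 * A p + 2 * l * B p + C p" and "C' p = 3 * l * A p + B p" for p
  have h': "hol_germ A'" "hol_germ B'" "hol_germ C'"
    unfolding A'_def[abs_def] B'_def[abs_def] C'_def[abs_def] by (intro hol_intros hol)+
  have "\<forall>\<^sub>F p in nhds 0. f p = Y p ^ 3 * A' p + Y p ^ 2 * Y' p * B' p + Y p * Y' p ^ 2 * C' p + Y' p ^ 3 * A p"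
    using f
  proof eventually_elim
    case (elim p)
    show ?case unfolding elim A'_def B'_def C'_def Y'_def by algebra
  qed
  moreover have "A' 0 = 0"
    using l by (simp add: A'_def power2_eq_square power3_eq_cube algebra_simps)
  ultimately show ?thesis by (intro cubic_classification_aux[OF ch' h' hol(1) _ assms(6,7)])
qed

text \<open>
  A quadratic leading form that is not zero takes a non-zero value in one of the directions
  \<open>(1, 0)\<close>, \<open>(0, 1)\<close>, \<open>(1, 1)\<close>, and completing the square
  there gives type \<open>A\<close>. So a germ that is not simple has order at least 3, and
  exactly 3 if its 3-jet is not zero.
\<close>

theorem nonsimple_weight6_form:
  fixes f :: "complex ^ 2 \<Rightarrow> complex"
  assumes "plane_curve_singularity f" "jet 3 f \<noteq> (\<lambda>_. 0)" "\<not> simple_germ f"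
  shows "weight6_form f"
proof -
  have f: "hol_germ f" "f \<in> max_ideal_square" "reduced_germ f"
    using assms(1) by (auto simp: plane_curve_singularity_def)
  have nv: "\<not> vanish 4 f" using assms(2) jet_eq_0_iff[OF f(1), of 3] by simp
  obtain K where K: "\<And>j. hol_germ (K j)" "\<forall>\<^sub>F p in nhds 0. f p = (\<Sum>j\<le>2. p $ 1 ^ j * p $ 2 ^ (2 - j) * K j p)"
    using max_ideal_square_expansion[OF f(2)] by blast
  have K2: "\<forall>\<^sub>F p in nhds 0. f p = p $ 1 ^ 2 * K 2 p + p $ 1 * p $ 2 * K 1 p + p $ 2 ^ 2 * K 0 p"
    using K(2) by eventually_elim (simp add: sum_le_2 algebra_simps)
  have z: "K j 0 = 0" if j: "j \<le> 2" for j
  proof (rule ccontr)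
    assume ne: "K j 0 \<noteq> 0"
    have "simple_germ f"
    proof (cases "K 2 0 = 0")
      case False
      show ?thesis by (rule simple_A[OF chart_standard f(1) K(1) K(1) K(1) False f(3) K2])
    next
      case K20: True
      show ?thesis
      proof (cases "K 0 0 = 0")
        case False
        have "\<forall>\<^sub>F p in nhds 0. f p = p $ 2 ^ 2 * K 0 p + p $ 2 * p $ 1 * K 1 p + p $ 1 ^ 2 * K 2 p"
          using K2 by eventually_elim simp
        from simple_A[OF chart_sym[OF chart_standard] f(1) K(1) K(1) K(1) False f(3) this] show ?thesis .
      next
        case K00: True
        have "j = 0 \<or> j = 1 \<or> j = 2" using j by auto
        hence "K 1 0 \<noteq> 0" using ne K20 K00 by auto
        \<comment> \<open>Here the quadratic form is a multiple of the product of the coordinates;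
           the diagonal is moved to the first axis.\<close>
        have ch: "chart (\<lambda>p. p $ 1) (\<lambda>p. p $ 2 - 1 * p $ 1)" by (rule turn_chart[OF chart_sym[OF chart_standard]])
        have h: "hol_germ (\<lambda>p. K 2 p + K 1 p + K 0 p)" "hol_germ (\<lambda>p. K 1 p + 2 * K 0 p)" by (intro hol_intros K)+
        have "\<forall>\<^sub>F p in nhds 0. f p = p $ 1 ^ 2 * (K 2 p + K 1 p + K 0 p) +
            p $ 1 * (p $ 2 - 1 * p $ 1) * (K 1 p + 2 * K 0 p) + (p $ 2 - 1 * p $ 1) ^ 2 * K 0 p"
          using K2
        proof eventually_elim
          case (elim p)
          show ?case unfolding elim by algebra
        qed
        from simple_A[OF ch f(1) h K(1) _ f(3) this] show ?thesis
          using \<open>K 1 0 \<noteq> 0\<close> K20 K00 by simp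
      qed
    qed
    thus False using assms(3) by simp
  qed
  from raise_expansion_degree[OF chart_standard K(1) z K(2)] obtain L where L: "\<And>j. hol_germ (L j)"
    "\<forall>\<^sub>F p in nhds 0. f p = (\<Sum>j\<le>Suc 2. p $ 1 ^ j * p $ 2 ^ (Suc 2 - j) * L j p)" by blast
  have "\<forall>\<^sub>F p in nhds 0. f p = p $ 1 ^ 3 * L 3 p + p $ 1 ^ 2 * p $ 2 * L 2 p + p $ 1 * p $ 2 ^ 2 * L 1 p + p $ 2 ^ 3 * L 0 p"
    using L(2) by eventually_elim (simp add: sum_le_3 algebra_simps)
  from cubic_classification[OF chart_standard L(1) L(1) L(1) L(1) f(3) nv this] assms(3)
  show ?thesis by simp
qed

section \<open>The arc filtration\<close>

lemma arcsD:
  assumes "\<phi> \<in> arcs_on V"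
  shows "(\<lambda>t. \<phi> t $ i) analytic_on {0}" "\<phi> 0 = 0" "\<forall>\<^sub>F t in nhds 0. \<phi> t \<in> V"
  using assms by (auto simp: arcs_on_def)

text \<open>
  Membership tested arc by arc as a growth bound; the infimum over all arcs disappears.
\<close>

lemma arc_filtration_iff:
  "g \<in> arc_filtration V i \<longleftrightarrow> hol_germ g \<and> (\<forall>\<phi>\<in>arcs_on V. vanish i (\<lambda>t. g (\<phi> t)))"
proof (cases "hol_germ g")
  case True
  have "enat i \<le> vanishing_order (g \<circ> \<phi>) \<longleftrightarrow> vanish i (\<lambda>t. g (\<phi> t))" if "\<phi> \<in> arcs_on V" for \<phi>
    using vanishing_order_ge_iff[OF analytic_compose_hol_germ[OF True arcsD(1,2)[OF that]], of i]
    by (simp add: o_def)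
  thus ?thesis using True by (simp add: arc_filtration_def arc_order_def le_INF_iff)
qed (simp add: arc_filtration_def)

lemma arc_filtration_hol: "g \<in> arc_filtration V i \<Longrightarrow> hol_germ g"
  by (simp add: arc_filtration_iff)

lemma arc_filtration_add:
  "g \<in> arc_filtration V i \<Longrightarrow> h \<in> arc_filtration V i \<Longrightarrow> (\<lambda>x. g x + h x) \<in> arc_filtration V i"
  by (auto simp: arc_filtration_iff intro: hol_intros vanish_add)

lemma arc_filtration_mult:
  assumes "g \<in> arc_filtration V i" "hol_germ h" shows "(\<lambda>x. h x * g x) \<in> arc_filtration V i"
proof -
  have "vanish i (\<lambda>t. h (\<phi> t) * g (\<phi> t))" if "\<phi> \<in> arcs_on V" for \<phi>
  proof (rule vanish_mult_left)
    show "vanish i (\<lambda>t. g (\<phi> t))" using assms that by (simp add: arc_filtration_iff)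
    show "vanish 0 (\<lambda>t. h (\<phi> t))"
      by (rule vanish_compose_curve[OF vanish_hol_germ[OF assms(2)] arcsD(1,2)[OF that]])
  qed
  thus ?thesis using assms by (auto simp: arc_filtration_iff intro: hol_intros)
qed

lemma arc_filtration_diff:
  assumes "g \<in> arc_filtration V i" "h \<in> arc_filtration V i"
  shows "(\<lambda>x. g x - h x) \<in> arc_filtration V i"
  using arc_filtration_add[OF assms(1) arc_filtration_mult[OF assms(2) hol_germ_const[of "-1"]]] by simp

lemma arc_filtration_zero: "(\<lambda>_. 0) \<in> arc_filtration V i"
  by (simp add: arc_filtration_iff vanish_0 hol_intros)

lemma arc_filtration_sum:
  "(\<And>j. j \<in> J \<Longrightarrow> g j \<in> arc_filtration V i) \<Longrightarrow> (\<lambda>x. \<Sum>j\<in>J. g j x) \<in> arc_filtration V i"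
  by (induction J rule: infinite_finite_induct) (auto intro: arc_filtration_zero arc_filtration_add)

lemma arc_filtration_mono: "g \<in> arc_filtration V i \<Longrightarrow> j \<le> i \<Longrightarrow> g \<in> arc_filtration V j"
  by (auto simp: arc_filtration_iff intro: vanish_mono)

lemma arc_filtration_cong:
  assumes "g \<in> arc_filtration V i" "hol_germ h" "\<forall>\<^sub>F x in nhds 0. x \<in> V \<longrightarrow> g x = h x"
  shows "h \<in> arc_filtration V i"
  using assms arc_order_cong[OF assms(3)] by (simp add: arc_filtration_def)

text \<open>
  Allows an indexed family in place of a set of representatives; injectivity of the family
  follows from independence modulo \<open>W\<close>.
\<close>

lemma quotient_has_dimI:
  fixes e :: "'i \<Rightarrow> 'a \<Rightarrow> complex"
  assumes "finite I" "card I = n" "\<And>i. i \<in> I \<Longrightarrow> e i \<in> U" "(\<lambda>_. 0) \<in> W"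
    and ind: "\<And>c i. (\<lambda>x. \<Sum>i\<in>I. c i * e i x) \<in> W \<Longrightarrow> i \<in> I \<Longrightarrow> c i = 0"
    and span: "\<And>u. u \<in> U \<Longrightarrow> \<exists>c. (\<lambda>x. u x - (\<Sum>i\<in>I. c i * e i x)) \<in> W"
  shows "quotient_has_dim U W n"
proof -
  have inj: "inj_on e I"
  proof (rule inj_onI, rule ccontr)
    fix i j assume ij: "i \<in> I" "j \<in> I" "e i = e j" "i \<noteq> j"
    \<comment> \<open>A coincidence \<open>e i = e j\<close> would be a linear relation.\<close>
    let ?c = "\<lambda>k. (if k = i then 1 else 0) - (if k = j then 1 else 0 :: complex)"
    have "(\<Sum>k\<in>I. ?c k * e k x) = 0" for x
    proof -
      have "(\<Sum>k\<in>I. ?c k * e k x) = (\<Sum>k\<in>I. (if k = i then e k x else 0) - (if k = j then e k x else 0))"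
        by (rule sum.cong) auto
      thus ?thesis using ij assms(1) by (simp add: sum_subtractf)
    qed
    hence "(\<lambda>x. \<Sum>k\<in>I. ?c k * e k x) \<in> W" using assms(4) by simp
    from ind[OF this ij(1)] ij(4) show False by simp
  qed
  have re: "(\<Sum>b\<in>e ` I. c b * b x) = (\<Sum>i\<in>I. c (e i) * e i x)" for c x
    using sum.reindex[OF inj, of "\<lambda>b. c b * b x"] by simp
  show ?thesis unfolding quotient_has_dim_def
  proof (intro exI[of _ "e ` I"] conjI allI impI ballI)
    fix c b assume "(\<lambda>x. \<Sum>b\<in>e ` I. c b * b x) \<in> W" "b \<in> e ` I"
    thus "c b = 0" using ind[of "\<lambda>i. c (e i)"] by (auto simp: re)
  next
    fix u assume "u \<in> U"
    from span[OF this] obtain c where c: "(\<lambda>x. u x - (\<Sum>i\<in>I. c i * e i x)) \<in> W" by blast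
    have "(\<Sum>i\<in>I. c (the_inv_into I e (e i)) * e i x) = (\<Sum>i\<in>I. c i * e i x)" for x
      by (rule sum.cong) (simp_all add: the_inv_into_f_f[OF inj])
    thus "\<exists>c. (\<lambda>x. u x - (\<Sum>b\<in>e ` I. c b * b x)) \<in> W"
      using c by (intro exI[of _ "\<lambda>b. c (the_inv_into I e b)"]) (simp add: re)
  qed (use assms inj in \<open>auto simp: card_image\<close>)
qed

lemma vanish_sqrt:
  assumes "vanish (2 * k) (\<lambda>t. z t ^ 2)" shows "vanish k z"
proof -
  obtain c where c: "c \<ge> 0" "\<forall>\<^sub>F x in nhds 0. norm (z x ^ 2) \<le> c * norm x ^ (2 * k)"
    using assms by (rule vanishE)
  have "\<forall>\<^sub>F x in nhds 0. norm (z x) \<le> sqrt c * norm x ^ k"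
    using c(2)
  proof eventually_elim
    case (elim x)
    have "(norm (z x))\<^sup>2 \<le> (sqrt c * norm x ^ k)\<^sup>2"
      using elim c(1) by (simp add: norm_power power_mult_distrib power_mult mult.commute[of 2 k])
    thus ?case by (rule power2_le_imp_le) (use c(1) in simp)
  qed
  thus ?thesis unfolding vanish_def by blast
qed

lemma analytic_sqrt:
  fixes u :: "complex \<Rightarrow> complex"
  assumes "u analytic_on {0}" "\<gamma>0 ^ 2 = u 0" "u 0 \<noteq> 0"
  shows "\<exists>\<gamma>. \<gamma> analytic_on {0} \<and> \<gamma> 0 = \<gamma>0 \<and> (\<forall>\<^sub>F t in nhds 0. \<gamma> t ^ 2 = u t)"
proof -
  let ?g = "\<lambda>t. \<gamma>0 * exp (Ln (u t / u 0) / 2)"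
  have "(\<lambda>t. u t / u 0) analytic_on {0}" using assms by (intro analytic_intros) auto
  hence "?g analytic_on {0}"
    using assms by (intro analytic_intros) auto
  moreover have "\<forall>\<^sub>F t in nhds 0. u t \<noteq> 0"
    using topological_tendstoD[OF analytic_tendsto_nhds[OF assms(1)], of "- {0}"] assms(3) by (simp add: open_Compl)
  hence "\<forall>\<^sub>F t in nhds 0. ?g t ^ 2 = u t"
  proof eventually_elim
    case (elim t)
    have "exp (Ln (u t / u 0) / 2) ^ 2 = exp (2 * (Ln (u t / u 0) / 2))"
      by (simp only: exp_double)
    also have "\<dots> = u t / u 0" using elim assms(3) by simp
    finally show ?case using assms(2,3) by (simp add: power_mult_distrib)
  qed
  ultimately show ?thesis using assms(3) by (intro exI[of _ ?g]) simp
qed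

section \<open>Double covers of the plane with a weighted leading form\<close>

definition plane_part :: "complex ^ 3 \<Rightarrow> complex ^ 2" where "plane_part p = vector [p $ 1, p $ 2]"

lemma plane_part: "hol_map_germ plane_part" "plane_part 0 = 0"
  by (auto simp: hol_map_germ_def plane_part_def forall_2 hol_intros zero_vec2)

lemma in_zero_set_stabilization: "p \<in> zero_set (stabilization f) \<longleftrightarrow> f (plane_part p) = p $ 3 ^ 2"
  by (simp add: zero_set_def stabilization_def plane_part_def)

lemma arc_plane_part:
  assumes "\<phi> \<in> arcs_on (V :: (complex ^ 3) set)"
  shows "(\<lambda>t. plane_part (\<phi> t) $ i) analytic_on {0}" "plane_part (\<phi> 0) = 0"
  using arcsD[OF assms] exhaust_2[of i] plane_part(2) by (auto simp: plane_part_def)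

text \<open>
  The surface \<open>z^2 = f\<close> with weights \<open>w\<close>, 1, \<open>v\<close> for
  \<open>X, Y, z\<close>, where \<open>f\<close> has weighted order \<open>2 v\<close>. The
  bound on \<open>w M\<close> makes the truncated difference in the exponent of \<open>Y\<close>
  an honest one. Only the lower bound for the order of \<open>X\<close> on arcs is a hypothesis;
  the one for \<open>z\<close> follows from the equation (\<open>arc_orders\<close>).
\<close>

locale weighted_surface =
  fixes f X Y :: "complex ^ 2 \<Rightarrow> complex" and A :: "nat \<Rightarrow> complex ^ 2 \<Rightarrow> complex" and w v M :: nat
  assumes chart: "chart X Y" and hol: "\<And>j. hol_germ (A j)"
    and w: "w \<ge> 1" and v: "v \<ge> 1" and wM: "w * M \<le> 2 * v"
    and expansion: "\<forall>\<^sub>F p in nhds 0. f p = (\<Sum>j\<le>M. X p ^ j * Y p ^ (2 * v - w * j) * A j p)"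
    and leading: "\<exists>j\<le>M. A j 0 \<noteq> 0"
    and arc_X: "\<And>\<phi>. \<phi> \<in> arcs_on (zero_set (stabilization f)) \<Longrightarrow> vanish w (\<lambda>t. X (plane_part (\<phi> t)))"
begin

abbreviation "V \<equiv> zero_set (stabilization f)"
abbreviation "F \<equiv> arc_filtration V"

definition "XX p = X (plane_part p)"
definition "YY p = Y (plane_part p)"
definition "zz p = (p :: complex ^ 3) $ 3"

lemma hol_XYz: "hol_germ XX" "hol_germ YY" "hol_germ zz"
  unfolding XX_def[abs_def] YY_def[abs_def] zz_def[abs_def]
  using chartD[OF chart] plane_part by (auto intro: hol_germ_compose hol_intros)

lemma arc_orders:
  assumes "\<phi> \<in> arcs_on V"
  shows "vanish w (\<lambda>t. XX (\<phi> t))" "vanish 1 (\<lambda>t. YY (\<phi> t))" "vanish v (\<lambda>t. zz (\<phi> t))"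
proof -
  note c = chartD[OF chart]
  show X: "vanish w (\<lambda>t. XX (\<phi> t))" unfolding XX_def by (rule arc_X[OF assms])
  show Y: "vanish 1 (\<lambda>t. YY (\<phi> t))" unfolding YY_def
    by (rule vanish_compose_curve[OF vanish_hol_germ_zero[OF c(2,4)] arc_plane_part[OF assms]])
  have "vanish (2 * v) (\<lambda>t. \<Sum>j\<le>M. XX (\<phi> t) ^ j * YY (\<phi> t) ^ (2 * v - w * j) * A j (plane_part (\<phi> t)))"
  proof (rule vanish_sum)
    fix j assume j: "j \<in> {..M}"
    have "w * j \<le> w * M" using j by simp
    hence "w * j + 1 * (2 * v - w * j) + 0 = 2 * v" using wM by linarith
    moreover have "vanish (w * j + 1 * (2 * v - w * j) + 0) (\<lambda>t. XX (\<phi> t) ^ j * YY (\<phi> t) ^ (2 * v - w * j) * A j (plane_part (\<phi> t)))"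
      by (intro vanish_mult vanish_power X Y vanish_compose_curve[OF vanish_hol_germ[OF hol] arc_plane_part[OF assms]])
    ultimately show "vanish (2 * v) (\<lambda>t. XX (\<phi> t) ^ j * YY (\<phi> t) ^ (2 * v - w * j) * A j (plane_part (\<phi> t)))"
      by simp
  qed
  moreover have "\<forall>\<^sub>F t in nhds 0. (\<Sum>j\<le>M. XX (\<phi> t) ^ j * YY (\<phi> t) ^ (2 * v - w * j) * A j (plane_part (\<phi> t))) = zz (\<phi> t) ^ 2"
  proof -
    have "\<forall>\<^sub>F t in nhds 0. (\<lambda>p. f p = (\<Sum>j\<le>M. X p ^ j * Y p ^ (2 * v - w * j) * A j p)) (plane_part (\<phi> t))"
      using curve_tendsto[of "\<lambda>t. plane_part (\<phi> t)", OF arc_plane_part[OF assms]] expansion unfolding filterlim_iff by blast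
    thus ?thesis using arcsD(3)[OF assms]
      by eventually_elim (simp add: XX_def YY_def zz_def in_zero_set_stabilization)
  qed
  ultimately have "vanish (2 * v) (\<lambda>t. zz (\<phi> t) ^ 2)" by (rule vanish_cong)
  thus "vanish v (\<lambda>t. zz (\<phi> t))" by (rule vanish_sqrt)
qed

definition "scaled_monomial j k l g p = XX p ^ j * YY p ^ k * zz p ^ l * g p"

lemma hol_scaled_monomial: "hol_germ g \<Longrightarrow> hol_germ (scaled_monomial j k l g)"
  unfolding scaled_monomial_def[abs_def] by (intro hol_intros hol_XYz)

lemma scaled_monomial_in_F:
  assumes "hol_germ g" "w * j + k + v * l \<ge> i" shows "scaled_monomial j k l g \<in> F i"
proof -
  have "vanish i (\<lambda>t. scaled_monomial j k l g (\<phi> t))" if "\<phi> \<in> arcs_on V" for \<phi>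
  proof -
    have "vanish (w * j + 1 * k + v * l + 0) (\<lambda>t. scaled_monomial j k l g (\<phi> t))"
      unfolding scaled_monomial_def
      by (intro vanish_mult vanish_power arc_orders[OF that] vanish_compose_curve[OF vanish_hol_germ[OF assms(1)] arcsD(1,2)[OF that]])
    thus ?thesis using assms(2) by (auto intro: vanish_mono)
  qed
  thus ?thesis using hol_scaled_monomial[OF assms(1)] by (simp add: arc_filtration_iff)
qed

lemma hadamard3:
  assumes "hol_germ g"
  shows "\<exists>h1 h2 h3. hol_germ h1 \<and> hol_germ h2 \<and> hol_germ h3 \<and>
    (\<forall>\<^sub>F p in nhds 0. g p = g 0 + XX p * h1 p + YY p * h2 p + zz p * h3 p)"
proof -
  obtain h where h: "\<And>i. hol_germ (h i)" "\<forall>\<^sub>F x in nhds 0. g x = g 0 + (\<Sum>i\<in>UNIV. x $ i * h i x)"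
    using hol_germ_hadamard[OF assms] by blast
  obtain U1 W1 where 1: "hol_germ U1" "hol_germ W1" "\<forall>\<^sub>F p in nhds 0. p $ 1 = X p * U1 p + Y p * W1 p"
    using hadamard_zero[OF chart hol_germ_coord[of 1] zero_index] by blast
  obtain U2 W2 where 2: "hol_germ U2" "hol_germ W2" "\<forall>\<^sub>F p in nhds 0. p $ 2 = X p * U2 p + Y p * W2 p"
    using hadamard_zero[OF chart hol_germ_coord[of 2] zero_index] by blast
  have "\<forall>\<^sub>F p in nhds 0. g p = g 0 + XX p * (U1 (plane_part p) * h 1 p + U2 (plane_part p) * h 2 p)
       + YY p * (W1 (plane_part p) * h 1 p + W2 (plane_part p) * h 2 p) + zz p * h 3 p"
    using h(2) eventually_compose[OF plane_part 1(3)] eventually_compose[OF plane_part 2(3)]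
  proof eventually_elim
    case (elim p)
    have "p $ 1 = XX p * U1 (plane_part p) + YY p * W1 (plane_part p)" "p $ 2 = XX p * U2 (plane_part p) + YY p * W2 (plane_part p)"
      using elim(2,3) by (simp_all add: plane_part_def XX_def YY_def)
    thus ?case using elim(1) by (simp add: sum_3 zz_def algebra_simps)
  qed
  moreover have "hol_germ (\<lambda>p. U1 (plane_part p) * h 1 p + U2 (plane_part p) * h 2 p)"
    "hol_germ (\<lambda>p. W1 (plane_part p) * h 1 p + W2 (plane_part p) * h 2 p)"
    by (rule hol_germ_add hol_germ_mult hol_germ_compose[OF plane_part] h 1 2)+
  ultimately show ?thesis using h(1) by blast
qed

text \<open>
  The pair \<open>(j, l)\<close> stands for the monomial \<open>X^j Y^k z^l\<close> of weight
  \<open>e\<close>, the exponent \<open>k = e - w j - v l\<close> being determined. Only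
  \<open>l \<le> 1\<close> is admitted because \<open>z^2\<close> equals \<open>f\<close> on the
  surface.
\<close>

definition "exps e = {(j, l) \<in> {..e} \<times> {..1::nat}. w * j + v * l \<le> e}"
definition "mon e jl = scaled_monomial (fst jl) (e - w * fst jl - v * snd jl) (snd jl) (\<lambda>_. 1)"
definition "comb c e p = (\<Sum>jl\<in>exps e. c jl * mon e jl p)"
text \<open>
  All weights up to \<open>i\<close> are treated at once, because the expansion of a germ
  produces monomials of every weight.
\<close>

definition "spanned i = {g. hol_germ g \<and> (\<exists>c. (\<lambda>p. g p - (\<Sum>e\<le>i. comb (c e) e p)) \<in> F (i + 1))}"

lemma finite_exps: "finite (exps e)"
  by (rule finite_subset[of _ "{..e} \<times> {..1}"]) (auto simp: exps_def)

lemma hol_mon: "hol_germ (mon e jl)" unfolding mon_def by (rule hol_scaled_monomial[OF hol_germ_const])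

lemma hol_comb: "hol_germ (comb c e)"
  unfolding comb_def[abs_def] by (intro hol_intros hol_mon)

lemma mon_in_F: "jl \<in> exps e \<Longrightarrow> mon e jl \<in> F e"
  unfolding mon_def by (rule scaled_monomial_in_F[OF hol_germ_const]) (auto simp: exps_def)

lemma spanned_add: assumes "g \<in> spanned i" "h \<in> spanned i" shows "(\<lambda>p. g p + h p) \<in> spanned i"
proof -
  obtain c d where "(\<lambda>p. g p - (\<Sum>e\<le>i. comb (c e) e p)) \<in> F (i + 1)" "(\<lambda>p. h p - (\<Sum>e\<le>i. comb (d e) e p)) \<in> F (i + 1)"
    using assms unfolding spanned_def by blast
  from arc_filtration_add[OF this]
  have "(\<lambda>p. (g p + h p) - (\<Sum>e\<le>i. comb (\<lambda>jl. c e jl + d e jl) e p)) \<in> F (i + 1)"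
    by (simp add: comb_def sum.distrib algebra_simps)
  thus ?thesis using assms unfolding spanned_def by (auto intro: hol_intros)
qed

lemma F_in_spanned: assumes "g \<in> F (i + 1)" shows "g \<in> spanned i"
  using assms arc_filtration_hol[OF assms] unfolding spanned_def
  by (auto intro!: exI[of _ "\<lambda>_ _. 0"] simp: comb_def)

lemma spanned_sum: "finite J \<Longrightarrow> (\<And>j. j \<in> J \<Longrightarrow> g j \<in> spanned i) \<Longrightarrow> (\<lambda>p. \<Sum>j\<in>J. g j p) \<in> spanned i"
  by (induction J rule: finite_induct) (auto intro: spanned_add F_in_spanned arc_filtration_zero)

lemma spanned_cong:
  assumes "g \<in> spanned i" "hol_germ h" "\<forall>\<^sub>F p in nhds 0. p \<in> V \<longrightarrow> g p = h p" shows "h \<in> spanned i"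
proof -
  obtain c where c: "(\<lambda>p. g p - (\<Sum>e\<le>i. comb (c e) e p)) \<in> F (i + 1)"
    using assms unfolding spanned_def by blast
  have "(\<lambda>p. h p - (\<Sum>e\<le>i. comb (c e) e p)) \<in> F (i + 1)"
    by (rule arc_filtration_cong[OF c]) (use assms in \<open>auto intro!: hol_intros hol_comb elim: eventually_mono\<close>)
  thus ?thesis using assms(2) unfolding spanned_def by blast
qed

lemma monomial_in_spanned:
  assumes "l \<le> 1" shows "scaled_monomial j k l (\<lambda>_. a) \<in> spanned i"
proof (cases "w * j + k + v * l \<le> i")
  case False
  thus ?thesis by (intro F_in_spanned scaled_monomial_in_F hol_germ_const) simp
next
  case True
  define e where "e = w * j + k + v * l"
  have "j \<le> w * j" using w by simp
  hence "j \<le> e" "w * j + v * l \<le> e" unfolding e_def by linarith+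
  hence exps: "(j, l) \<in> exps e" using assms by (simp add: exps_def)
  define c where "c e' jl = (if e' = e \<and> jl = (j, l) then a else 0)" for e' :: nat and jl :: "nat \<times> nat"
  have c0: "comb (c e') e' p = 0" if "e' \<noteq> e" for e' p using that by (simp add: comb_def c_def)
  have ce: "comb (c e) e p = scaled_monomial j k l (\<lambda>_. a) p" for p
  proof -
    have "comb (c e) e p = (\<Sum>jl\<in>exps e. if jl = (j, l) then a * mon e jl p else 0)"
      unfolding comb_def by (rule sum.cong) (auto simp: c_def)
    also have "\<dots> = a * mon e (j, l) p" using exps by (simp add: finite_exps)
    finally show ?thesis by (simp add: mon_def scaled_monomial_def e_def)
  qed
  have "(\<Sum>e'\<le>i. comb (c e') e' p) = (\<Sum>e'\<le>i. if e' = e then scaled_monomial j k l (\<lambda>_. a) p else 0)" for p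
    by (rule sum.cong) (use c0 ce in auto)
  hence "(\<Sum>e'\<le>i. comb (c e') e' p) = scaled_monomial j k l (\<lambda>_. a) p" for p using True by (simp add: e_def)
  thus ?thesis unfolding spanned_def using hol_scaled_monomial[OF hol_germ_const]
    by (auto intro!: exI[of _ c] simp: arc_filtration_zero)
qed

text \<open>
  Descending induction on the weight, and for fixed weight induction on the exponent of
  \<open>z\<close>. By Hadamard's lemma the cofactor \<open>g\<close> may be replaced by its
  value at 0, since the other terms have larger weight. If \<open>z^2\<close> divides the
  monomial, it is replaced by the expansion of \<open>f\<close>, which does not lower the weight
  and reduces the exponent of \<open>z\<close> by 2.
\<close>

lemma spanning_step:
  assumes IH: "\<And>j k l g. hol_germ g \<Longrightarrow> w * j + k + v * l \<ge> Suc d \<Longrightarrow> scaled_monomial j k l g \<in> spanned i"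
  shows "hol_germ g \<Longrightarrow> w * j + k + v * l \<ge> d \<Longrightarrow> scaled_monomial j k l g \<in> spanned i"
proof (induction l arbitrary: j k g rule: less_induct)
  case (less l)
  obtain h1 h2 h3 where h: "hol_germ h1" "hol_germ h2" "hol_germ h3"
    "\<forall>\<^sub>F p in nhds 0. g p = g 0 + XX p * h1 p + YY p * h2 p + zz p * h3 p"
    using hadamard3[OF less.prems(1)] by blast
  have c: "scaled_monomial j k l (\<lambda>_. g 0) \<in> spanned i"
  proof (cases "l \<le> 1")
    case False
    have "(\<lambda>p. \<Sum>m\<le>M. scaled_monomial (j + m) (k + (2 * v - w * m)) (l - 2) (\<lambda>p. A m (plane_part p) * g 0) p) \<in> spanned i"
    proof (rule spanned_sum)
      fix m assume "m \<in> {..M}"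
      hence "w * m \<le> 2 * v" using le_trans[OF mult_le_mono2 wM, of m] by simp
      moreover have "v * l = v * (l - 2) + 2 * v" using False by (cases l; cases "l - 1") (auto simp: algebra_simps)
      ultimately have "d \<le> w * (j + m) + (k + (2 * v - w * m)) + v * (l - 2)"
        using less.prems(2) by (simp add: algebra_simps)
      thus "scaled_monomial (j + m) (k + (2 * v - w * m)) (l - 2) (\<lambda>p. A m (plane_part p) * g 0) \<in> spanned i"
        using False by (intro less.IH hol_germ_mult[OF hol_germ_compose[OF plane_part hol] hol_germ_const]) auto
    qed simp
    moreover have "\<forall>\<^sub>F p in nhds 0. p \<in> V \<longrightarrow>
      (\<Sum>m\<le>M. scaled_monomial (j + m) (k + (2 * v - w * m)) (l - 2) (\<lambda>p. A m (plane_part p) * g 0) p) = scaled_monomial j k l (\<lambda>_. g 0) p"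
      using eventually_compose[OF plane_part expansion]
    proof eventually_elim
      case (elim p)
      show ?case
      proof
        assume "p \<in> V"
        have "l = (l - 2) + 2" using False by simp
        hence "zz p ^ l = zz p ^ (l - 2) * zz p ^ 2" by (metis power_add)
        also have "zz p ^ 2 = f (plane_part p)" using \<open>p \<in> V\<close> by (simp add: in_zero_set_stabilization zz_def)
        finally have "scaled_monomial j k l (\<lambda>_. g 0) p = XX p ^ j * YY p ^ k * zz p ^ (l - 2) * g 0 * f (plane_part p)"
          by (simp add: scaled_monomial_def)
        thus "(\<Sum>m\<le>M. scaled_monomial (j + m) (k + (2 * v - w * m)) (l - 2) (\<lambda>p. A m (plane_part p) * g 0) p) = scaled_monomial j k l (\<lambda>_. g 0) p"
          unfolding elim by (simp add: scaled_monomial_def XX_def YY_def power_add sum_distrib_left mult_ac)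
      qed
    qed
    ultimately show ?thesis by (intro spanned_cong[OF _ hol_scaled_monomial[OF hol_germ_const]])
  qed (rule monomial_in_spanned)
  have "scaled_monomial (Suc j) k l h1 \<in> spanned i" "scaled_monomial j (Suc k) l h2 \<in> spanned i" "scaled_monomial j k (Suc l) h3 \<in> spanned i"
    using less.prems(2) w v by (auto intro!: IH h)
  from spanned_add[OF spanned_add[OF spanned_add[OF c this(1)] this(2)] this(3)]
  show ?case
  proof (rule spanned_cong[OF _ hol_scaled_monomial[OF less.prems(1)]])
    show "\<forall>\<^sub>F p in nhds 0. p \<in> V \<longrightarrow> scaled_monomial j k l (\<lambda>_. g 0) p + scaled_monomial (Suc j) k l h1 p + scaled_monomial j (Suc k) l h2 p + scaled_monomial j k (Suc l) h3 p = scaled_monomial j k l g p"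
      using h(4)
    proof eventually_elim
      case (elim p)
      show ?case unfolding scaled_monomial_def elim by (simp add: algebra_simps)
    qed
  qed
qed

lemma spanning:
  assumes "hol_germ g" shows "g \<in> spanned i"
proof -
  \<comment> \<open>The induction runs over the distance of the weight from \<open>i + 1\<close>,
     where membership in \<open>F (i + 1)\<close> starts it.\<close>
  have "\<forall>j k l g. hol_germ g \<longrightarrow> w * j + k + v * l \<ge> Suc i - n \<longrightarrow> scaled_monomial j k l g \<in> spanned i" for n
  proof (induction n)
    case 0 thus ?case by (auto intro!: F_in_spanned scaled_monomial_in_F)
  next
    case (Suc n)
    show ?case
    proof (cases "n \<le> i")
      case True
      hence "Suc (Suc i - Suc n) = Suc i - n" by simp
      thus ?thesis using spanning_step[of "Suc i - Suc n"] Suc by auto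
    next
      case False
      hence "Suc i - Suc n = Suc i - n" by simp
      thus ?thesis using Suc by simp
    qed
  qed
  from this[of "Suc i"] have "scaled_monomial 0 0 0 g \<in> spanned i" using assms by simp
  thus ?thesis by (simp add: scaled_monomial_def[abs_def])
qed

end

lemma poly_sum_monom: "poly (\<Sum>j\<le>n. monom (a j) j) x = (\<Sum>j\<le>n. a j * x ^ j)"
  for a :: "nat \<Rightarrow> complex"
  by (simp add: poly_sum poly_monom)

lemma coeff_sum_monom: "j \<le> n \<Longrightarrow> coeff (\<Sum>j\<le>n. monom (a j) j) j = a j"
  by (simp add: coeff_sum)

context weighted_surface
begin

text \<open>
  Over the curve \<open>X = \<alpha> t^w, Y = t\<close> the function \<open>f\<close> is
  \<open>t^(2v)\<close> times a unit, as soon as its leading part does not vanish at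
  \<open>(\<alpha>, 1)\<close>. A square root of the unit gives the coordinate \<open>z\<close>
  of an arc, with either sign.
\<close>

lemma test_arc:
  assumes "\<gamma>0 ^ 2 = (\<Sum>j\<le>M. A j 0 * \<alpha> ^ j)" "\<gamma>0 \<noteq> 0"
  shows "\<exists>\<phi> \<gamma>. \<phi> \<in> arcs_on V \<and> \<gamma> analytic_on {0} \<and> \<gamma> 0 = \<gamma>0 \<and>
    (\<forall>\<^sub>F t in nhds 0. XX (\<phi> t) = \<alpha> * t ^ w \<and> YY (\<phi> t) = t \<and> zz (\<phi> t) = t ^ v * \<gamma> t)"
proof -
  obtain \<Phi> :: "complex ^ 2 \<Rightarrow> complex ^ 2" where \<Phi>: "hol_map_germ \<Phi>" "\<Phi> 0 = 0"
    "\<forall>\<^sub>F p in nhds 0. X (\<Phi> p) = p $ 1" "\<forall>\<^sub>F p in nhds 0. Y (\<Phi> p) = p $ 2"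
    using chart_inverse[OF chart] by blast
  define \<psi> where "\<psi> t = (vector [\<alpha> * t ^ w, t] :: complex ^ 2)" for t
  have \<psi>: "(\<lambda>t. \<psi> t $ i) analytic_on {0}" "\<psi> 0 = 0" for i
    using exhaust_2[of i] w by (auto simp: \<psi>_def intro!: analytic_intros vec2_eqI)
  define q where "q t = \<Phi> (\<psi> t)" for t
  have q: "(\<lambda>t. q t $ i) analytic_on {0}" "q 0 = 0" for i
    unfolding q_def using analytic_compose_hol_germ[OF _ \<psi>, of "\<lambda>p. \<Phi> p $ i"] \<Phi>(1,2) \<psi>(2)
    by (auto simp: hol_map_germ_def)
  have ev: "\<forall>\<^sub>F t in nhds 0. Q (\<psi> t)" if "\<forall>\<^sub>F p in nhds 0. Q p" for Q
    using curve_tendsto[OF \<psi>] that unfolding filterlim_iff by blast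
  have XY: "\<forall>\<^sub>F t in nhds 0. X (q t) = \<alpha> * t ^ w \<and> Y (q t) = t"
    using ev[OF \<Phi>(3)] ev[OF \<Phi>(4)] by eventually_elim (simp add: q_def, simp add: \<psi>_def)
  define u where "u t = (\<Sum>j\<le>M. A j (q t) * \<alpha> ^ j)" for t
  have u: "u analytic_on {0}" unfolding u_def
    by (intro analytic_intros analytic_compose_hol_germ[OF hol q])
  have u0: "u 0 = \<gamma>0 ^ 2" using assms(1) by (simp add: u_def q(2))
  have "u 0 \<noteq> 0" using u0 assms(2) by simp
  from analytic_sqrt[OF u u0[symmetric] this] obtain \<gamma> where
    g: "\<gamma> analytic_on {0}" "\<gamma> 0 = \<gamma>0" "\<forall>\<^sub>F t in nhds 0. \<gamma> t ^ 2 = u t" by blast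
  define \<phi> where "\<phi> t = (vector [q t $ 1, q t $ 2, t ^ v * \<gamma> t] :: complex ^ 3)" for t
  have b: "plane_part (\<phi> t) = q t" for t unfolding plane_part_def \<phi>_def by (simp add: vector2_eta)
  have "\<forall>\<^sub>F t in nhds 0. (\<lambda>p. f p = (\<Sum>j\<le>M. X p ^ j * Y p ^ (2 * v - w * j) * A j p)) (q t)"
    using curve_tendsto[OF q] expansion unfolding filterlim_iff by blast
  hence "\<forall>\<^sub>F t in nhds 0. \<phi> t \<in> V"
    using XY g(3)
  proof eventually_elim
    case (elim t)
    have "f (q t) = (\<Sum>j\<le>M. t ^ (2 * v) * (A j (q t) * \<alpha> ^ j))"
      unfolding elim(1)
    proof (rule sum.cong[OF refl])
      fix j assume "j \<in> {..M}"
      hence "w * j \<le> 2 * v" using le_trans[OF mult_le_mono2 wM, of j] by simp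
      hence "t ^ (2 * v) = t ^ (w * j) * t ^ (2 * v - w * j)" by (simp flip: power_add)
      moreover have "X (q t) ^ j = \<alpha> ^ j * t ^ (w * j)"
        using elim(2) by (simp add: power_mult_distrib power_mult)
      ultimately show "X (q t) ^ j * Y (q t) ^ (2 * v - w * j) * A j (q t) = t ^ (2 * v) * (A j (q t) * \<alpha> ^ j)"
        using elim(2) by simp
    qed
    also have "\<dots> = t ^ (2 * v) * u t" by (simp add: u_def sum_distrib_left)
    also have "\<dots> = (t ^ v * \<gamma> t) ^ 2" using elim(3) by (simp add: power_mult_distrib power_mult[symmetric] mult.commute)
    finally show ?case by (simp add: in_zero_set_stabilization b) (simp add: \<phi>_def)
  qed
  moreover have "(\<lambda>t. \<phi> t $ i) analytic_on {0}" for i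
    using exhaust_3[of i] q g(1) by (auto simp: \<phi>_def intro!: analytic_intros)
  moreover have "\<phi> 0 = 0" using q(2) v by (simp add: \<phi>_def vec_eq_iff forall_3)
  ultimately have "\<phi> \<in> arcs_on V" by (simp add: arcs_on_def)
  moreover have "\<forall>\<^sub>F t in nhds 0. XX (\<phi> t) = \<alpha> * t ^ w \<and> YY (\<phi> t) = t \<and> zz (\<phi> t) = t ^ v * \<gamma> t"
    using XY by eventually_elim (simp add: XX_def YY_def b, simp add: zz_def \<phi>_def)
  ultimately show ?thesis using g by blast
qed

text \<open>
  The cofactor of \<open>t^e\<close> in \<open>comb c e\<close> along the test arc given by
  \<open>\<alpha>\<close> and \<open>g\<close>.
\<close>

definition "arc_coeff c e \<alpha> g = (\<Sum>jl\<in>exps e. c jl * (\<alpha> ^ fst jl * g ^ snd jl :: complex))"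

lemma comb_along_arc:
  assumes "XX p = \<alpha> * t ^ w" "YY p = t" "zz p = t ^ v * g"
  shows "comb c e p = t ^ e * arc_coeff c e \<alpha> g"
  unfolding comb_def arc_coeff_def sum_distrib_left
proof (rule sum.cong[OF refl])
  fix jl assume "jl \<in> exps e"
  hence "t ^ e = t ^ (w * fst jl) * t ^ (v * snd jl) * t ^ (e - w * fst jl - v * snd jl)"
    by (auto simp: exps_def simp flip: power_add)
  thus "c jl * mon e jl p = t ^ e * (c jl * (\<alpha> ^ fst jl * g ^ snd jl))"
    by (simp add: mon_def scaled_monomial_def assms power_mult_distrib power_mult mult_ac)
qed

lemma arc_coeff_split:
  "arc_coeff c e \<alpha> g = (\<Sum>j\<le>e. (if w * j \<le> e then c (j, 0) else 0) * \<alpha> ^ j) +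
     g * (\<Sum>j\<le>e. (if w * j + v \<le> e then c (j, 1) else 0) * \<alpha> ^ j)"
proof -
  have exps: "exps e = {jl \<in> {..e} \<times> {..1}. w * fst jl + v * snd jl \<le> e}" by (auto simp: exps_def)
  have "arc_coeff c e \<alpha> g = (\<Sum>jl\<in>{..e} \<times> {..1}. if w * fst jl + v * snd jl \<le> e then c jl * (\<alpha> ^ fst jl * g ^ snd jl) else 0)"
    unfolding arc_coeff_def exps by (rule sum.inter_filter) simp
  also have "\<dots> = (\<Sum>j\<le>e. \<Sum>l\<le>1. if w * j + v * l \<le> e then c (j, l) * (\<alpha> ^ j * g ^ l) else 0)"
    unfolding sum.cartesian_product by (rule sum.cong) auto
  also have "\<dots> = (\<Sum>j\<le>e. (if w * j \<le> e then c (j, 0) else 0) * \<alpha> ^ j +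
     g * ((if w * j + v \<le> e then c (j, 1) else 0) * \<alpha> ^ j))"
    by (rule sum.cong) auto
  finally show ?thesis by (simp only: sum.distrib sum_distrib_left)
qed

text \<open>
  The coefficient has the form \<open>a(\<alpha>) + g b(\<alpha>)\<close> with polynomials
  \<open>a, b\<close>. The two square roots \<open>g\<close> and \<open>- g\<close> separate
  \<open>a\<close> from \<open>b\<close>, and both vanish wherever the leading part of
  \<open>f\<close> does not.
\<close>

lemma arc_coeff_zero_imp:
  assumes "\<And>\<alpha> g. g \<noteq> 0 \<Longrightarrow> g ^ 2 = (\<Sum>j\<le>M. A j 0 * \<alpha> ^ j) \<Longrightarrow> arc_coeff c e \<alpha> g = 0" "jl \<in> exps e"
  shows "c jl = 0"
proof -
  define P where "P = (\<Sum>j\<le>M. monom (A j 0) j)"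
  define a b where "a j = (if w * j \<le> e then c (j, 0) else 0)" and "b j = (if w * j + v \<le> e then c (j, 1) else 0)" for j
  define pa pb where "pa = (\<Sum>j\<le>e. monom (a j) j)" and "pb = (\<Sum>j\<le>e. monom (b j) j)"
  have arc_coeff: "arc_coeff c e \<alpha> g = poly pa \<alpha> + g * poly pb \<alpha>" for \<alpha> g
    unfolding arc_coeff_split pa_def pb_def poly_sum_monom a_def b_def ..
  have "P \<noteq> 0"
  proof
    assume "P = 0"
    obtain j where "j \<le> M" "A j 0 \<noteq> 0" using leading by blast
    thus False using coeff_sum_monom[of j M "\<lambda>j. A j 0"] \<open>P = 0\<close> by (simp add: P_def)
  qed
  have "poly pa \<alpha> = 0 \<and> poly pb \<alpha> = 0" if "poly P \<alpha> \<noteq> 0" for \<alpha>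
  proof -
    \<comment> \<open>Both square roots are admissible values for the test arcs.\<close>
    define g where "g = csqrt (poly P \<alpha>)"
    have g: "g \<noteq> 0" "g ^ 2 = (\<Sum>j\<le>M. A j 0 * \<alpha> ^ j)"
      using that by (simp_all add: g_def P_def poly_sum_monom)
    have 1: "poly pa \<alpha> + g * poly pb \<alpha> = 0" using assms(1)[OF g] arc_coeff by simp
    have 2: "poly pa \<alpha> + (- g) * poly pb \<alpha> = 0" using assms(1)[of "- g" \<alpha>] g arc_coeff by simp
    have "poly pa \<alpha> = 0" using 1 2 by algebra
    thus ?thesis using 1 g(1) by simp
  qed
  hence "poly (pa * P) \<alpha> = 0" "poly (pb * P) \<alpha> = 0" for \<alpha> by (auto simp: poly_mult)
  hence "pa * P = 0" "pb * P = 0" using poly_all_0_iff_0 by blast+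
  hence pab: "pa = 0" "pb = 0" using \<open>P \<noteq> 0\<close> by simp_all
  obtain j l where jl: "jl = (j, l)" "j \<le> e" "l \<le> 1" "w * j + v * l \<le> e"
    using assms(2) by (auto simp: exps_def)
  have "a j = 0" "b j = 0"
    using coeff_sum_monom[OF jl(2), of a] coeff_sum_monom[OF jl(2), of b] pab by (simp_all add: pa_def pb_def)
  moreover have "l = 0 \<or> l = 1" using jl(3) by auto
  ultimately show ?thesis using jl(1,4) by (auto simp: a_def b_def)
qed

text \<open>
  Induction on the weight \<open>e\<close>: once the coefficients of smaller weight are zero,
  the coefficient of \<open>t^e\<close> along every test arc only involves those of weight
  \<open>e\<close>.
\<close>

lemma independence:
  assumes S: "(\<lambda>p. \<Sum>e\<le>i. comb (c e) e p) \<in> F d" and d: "d \<le> i + 1"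
  shows "e < d \<Longrightarrow> jl \<in> exps e \<Longrightarrow> c e jl = 0"
proof (induction e arbitrary: jl rule: less_induct)
  case (less e)
  show ?case
  proof (rule arc_coeff_zero_imp[OF _ less.prems(2)])
    fix \<alpha> g0 assume g0: "g0 \<noteq> 0" "g0 ^ 2 = (\<Sum>j\<le>M. A j 0 * \<alpha> ^ j)"
    obtain \<phi> \<gamma> where \<phi>: "\<phi> \<in> arcs_on V" "\<gamma> analytic_on {0}" "\<gamma> 0 = g0"
      "\<forall>\<^sub>F t in nhds 0. XX (\<phi> t) = \<alpha> * t ^ w \<and> YY (\<phi> t) = t \<and> zz (\<phi> t) = t ^ v * \<gamma> t"
      using test_arc[OF g0(2,1)] by blast
    \<comment> \<open>The whole sum has order at least \<open>d > e\<close> along the arc, and the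
       terms of weight below \<open>e\<close> are zero.\<close>
    have v1: "vanish (Suc e) (\<lambda>t. \<Sum>e\<le>i. comb (c e) e (\<phi> t))"
      using S \<phi>(1) less.prems(1) by (auto simp: arc_filtration_iff intro: vanish_mono)
    define W where "W t = (\<Sum>e'\<in>{e..i}. t ^ (e' - e) * arc_coeff (c e') e' \<alpha> (\<gamma> t))" for t
    have low: "comb (c e') e' p = 0" if "e' < e" for e' p
      unfolding comb_def using less.IH[OF that] that less.prems(1) by (intro sum.neutral) simp
    have "\<forall>\<^sub>F t in nhds 0. (\<Sum>e\<le>i. comb (c e) e (\<phi> t)) = t ^ e * W t"
      using \<phi>(4)
    proof eventually_elim
      case (elim t)
      have "(\<Sum>e'\<le>i. comb (c e') e' (\<phi> t)) = (\<Sum>e'\<in>{e..i}. comb (c e') e' (\<phi> t))"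
        by (rule sum.mono_neutral_right) (auto simp: low)
      also have "\<dots> = (\<Sum>e'\<in>{e..i}. t ^ e * (t ^ (e' - e) * arc_coeff (c e') e' \<alpha> (\<gamma> t)))"
      proof (rule sum.cong[OF refl])
        fix e' assume "e' \<in> {e..i}"
        hence "t ^ e' = t ^ e * t ^ (e' - e)" by (simp flip: power_add)
        moreover have "comb (c e') e' (\<phi> t) = t ^ e' * arc_coeff (c e') e' \<alpha> (\<gamma> t)"
          by (rule comb_along_arc) (use elim in auto)
        ultimately show "comb (c e') e' (\<phi> t) = t ^ e * (t ^ (e' - e) * arc_coeff (c e') e' \<alpha> (\<gamma> t))"
          by (simp add: mult.assoc)
      qed
      finally show ?case by (simp add: W_def sum_distrib_left)
    qed
    from vanish_cong[OF v1 this] have "W 0 = 0"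
    proof (rule vanish_factor)
      show "W analytic_on {0}" unfolding W_def arc_coeff_def by (intro analytic_intros \<phi>(2))
    qed simp
    moreover have "W 0 = (\<Sum>e'\<in>{e..i}. if e' = e then arc_coeff (c e) e \<alpha> g0 else 0)"
      unfolding W_def by (rule sum.cong) (auto simp: \<phi>(3))
    moreover have "e \<le> i" using less.prems(1) d by simp
    ultimately show "arc_coeff (c e) e \<alpha> g0 = 0" by simp
  qed
qed

lemma card_exps: "card (exps e) = (e div w + 1) + (if v \<le> e then (e - v) div w + 1 else 0)"
proof -
  have d: "w * j \<le> n \<longleftrightarrow> j \<le> n div w" for j n
    using w by (simp add: less_eq_div_iff_mult_less_eq mult.commute)
  have w': "j \<le> w * j" for j using w by simp
  have exps: "exps e = (\<lambda>j. (j, 0)) ` {..e div w} \<union> (\<lambda>j. (j, 1)) ` (if v \<le> e then {..(e - v) div w} else {})"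
  proof (rule set_eqI)
    fix jl :: "nat \<times> nat"
    obtain j l where jl: "jl = (j, l)" by fastforce
    have j: "j \<le> e" if "w * j \<le> e" using w'[of j] that by linarith
    have "l = 0 \<or> l = 1 \<or> l > 1" by auto
    thus "jl \<in> exps e \<longleftrightarrow> jl \<in> (\<lambda>j. (j, 0)) ` {..e div w} \<union> (\<lambda>j. (j, 1)) ` (if v \<le> e then {..(e - v) div w} else {})"
      using j d[of j e] d[of j "e - v"] by (auto simp: exps_def jl)
  qed
  show ?thesis unfolding exps
    by (subst card_Un_disjoint) (auto simp: card_image inj_on_def)
qed

text \<open>
  A germ in \<open>F i\<close> is a combination of monomials of weight at most \<open>i\<close>
  modulo \<open>F (i + 1)\<close>, and independence shows that those of weight below
  \<open>i\<close> do not occur.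
\<close>

lemma quotient_dim: "quotient_has_dim (F i) (F (i + 1)) (card (exps i))"
proof (rule quotient_has_dimI[where I = "exps i" and e = "mon i"])
  fix c jl assume c: "(\<lambda>x. \<Sum>jl\<in>exps i. c jl * mon i jl x) \<in> F (i + 1)" "jl \<in> exps i"
  define c' where "c' e = (if e = i then c else (\<lambda>_. 0))" for e
  have "(\<Sum>e\<le>i. comb (c' e) e p) = (\<Sum>e\<le>i. if e = i then comb c i p else 0)" for p
    by (rule sum.cong) (auto simp: c'_def comb_def)
  hence "(\<lambda>p. \<Sum>e\<le>i. comb (c' e) e p) \<in> F (i + 1)" using c(1) by (simp add: comb_def)
  from independence[OF this, of i jl] c(2) show "c jl = 0" by (simp add: c'_def)
next
  fix u assume u: "u \<in> F i"
  obtain c where c: "(\<lambda>p. u p - (\<Sum>e\<le>i. comb (c e) e p)) \<in> F (i + 1)"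
    using spanning[OF arc_filtration_hol[OF u], of i] unfolding spanned_def by blast
  have "(\<lambda>p. u p - (u p - (\<Sum>e\<le>i. comb (c e) e p))) \<in> F i"
    by (rule arc_filtration_diff[OF u arc_filtration_mono[OF c]]) simp
  hence "(\<lambda>p. \<Sum>e\<le>i. comb (c e) e p) \<in> F i" by simp
  from independence[OF this] have z: "c e jl = 0" if "e < i" "jl \<in> exps e" for e jl using that by simp
  have "(\<Sum>e\<le>i. comb (c e) e p) = (\<Sum>e\<le>i. if e = i then comb (c i) i p else 0)" for p
    by (rule sum.cong) (auto simp: comb_def z)
  hence "(\<Sum>e\<le>i. comb (c e) e p) = comb (c i) i p" for p by simp
  thus "\<exists>c. (\<lambda>x. u x - (\<Sum>jl\<in>exps i. c jl * mon i jl x)) \<in> F (i + 1)"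
    using c by (auto simp: comb_def)
qed (simp_all add: finite_exps mon_in_F arc_filtration_zero)

text \<open>
  The monomials of weight \<open>i\<close> without \<open>z\<close> have generating function
  \<open>1 / ((1 - t) (1 - t^w))\<close>; those containing \<open>z\<close> are shifted by
  \<open>v\<close>, which contributes the factor \<open>1 + t^v = (1 - t^(2v)) / (1 -
  t^v)\<close>.
\<close>

theorem Poincare_series:
  "has_arc_Poincare_series V ((1 - fps_X ^ (2 * v)) / ((1 - fps_X) * (1 - fps_X ^ w) * (1 - fps_X ^ v)))"
proof -
  define n where "n = Abs_fps (\<lambda>i. real (i div w + 1))"
  define P where "P = Abs_fps (\<lambda>i. real (card (exps i)))"
  have P: "P = n * (1 + fps_X ^ v)"
    by (rule fps_ext) (auto simp: P_def n_def card_exps distrib_left fps_X_power_mult_right_nth)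
  have 1: "n * (1 - fps_X ^ w) = Abs_fps (\<lambda>_. 1)"
  proof (rule fps_ext)
    fix i
    have "i div w = Suc ((i - w) div w)" if "w \<le> i" using w that by (simp add: le_div_geq)
    thus "fps_nth (n * (1 - fps_X ^ w)) i = fps_nth (Abs_fps (\<lambda>_. 1)) i"
      by (auto simp: n_def right_diff_distrib fps_X_power_mult_right_nth)
  qed
  have 2: "Abs_fps (\<lambda>_. 1) * (1 - fps_X) = (1 :: real fps)"
  proof (rule fps_ext)
    fix i show "fps_nth (Abs_fps (\<lambda>_. 1) * (1 - fps_X)) i = fps_nth (1 :: real fps) i"
      using fps_X_power_mult_right_nth[of "Abs_fps (\<lambda>_. 1 :: real)" 1 i]
      by (simp add: right_diff_distrib)
  qed
  have "P * ((1 - fps_X) * (1 - fps_X ^ w) * (1 - fps_X ^ v)) =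
     (n * (1 - fps_X ^ w) * (1 - fps_X)) * ((1 + fps_X ^ v) * (1 - fps_X ^ v))"
    unfolding P by (simp only: mult_ac)
  also have "n * (1 - fps_X ^ w) * (1 - fps_X) = 1" unfolding 1 2 ..
  also have "1 * ((1 + fps_X ^ v) * (1 - fps_X ^ v)) = (1 - fps_X ^ (2 * v) :: real fps)"
  proof -
    have "(1 + x) * (1 - x) = 1 - x * x" for x :: "real fps" by (simp add: algebra_simps)
    thus ?thesis by (simp only: mult_1_left mult_2 power_add)
  qed
  finally have PD: "P * ((1 - fps_X) * (1 - fps_X ^ w) * (1 - fps_X ^ v)) = 1 - fps_X ^ (2 * v)" .
  have nz: "(1 - fps_X ^ k :: real fps) \<noteq> 0" if "k \<ge> 1" for k
  proof
    assume "1 - fps_X ^ k = (0 :: real fps)"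
    hence "fps_nth (1 - fps_X ^ k :: real fps) 0 = fps_nth 0 0" by (rule arg_cong)
    moreover have "fps_nth (1 - fps_X ^ k :: real fps) 0 = 1"
      unfolding fps_sub_nth fps_X_power_nth using that by simp
    ultimately show False by simp
  qed
  have "(1 - fps_X) * (1 - fps_X ^ w) * (1 - fps_X ^ v) \<noteq> (0 :: real fps)"
    using nz[of 1] nz[OF w] nz[OF v] by simp
  hence "(1 - fps_X ^ (2 * v)) / ((1 - fps_X) * (1 - fps_X ^ w) * (1 - fps_X ^ v)) = P"
    unfolding PD[symmetric] by (rule nonzero_mult_div_cancel_right)
  thus ?thesis unfolding has_arc_Poincare_series_def P_def using quotient_dim by (intro exI[of _ "\<lambda>i. card (exps i)"]) simp
qed

end

lemma analytic_divide_ex: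
  "f analytic_on {0} \<Longrightarrow> f 0 = 0 \<Longrightarrow> \<exists>g. g analytic_on {0} \<and> (\<forall>\<^sub>F t in nhds 0. f t = t * g (t :: complex))"
  by (rule analytic_divide_t) blast+

section \<open>Stabilizations of triple and quadruple points\<close>

text \<open>
  The point is that \<open>X\<close> has order at least 2 along every arc. Since \<open>z^2 =
  f\<close> has order at least 3, \<open>z\<close> has order at least 2 and \<open>f\<close>
  order at least 4. But if \<open>X\<close> had order 1, the term \<open>X^3 A\<close> would
  give \<open>f\<close> order 3.
\<close>

theorem triple_point_series:
  assumes "weight6_form f"
  shows "has_arc_Poincare_series (zero_set (stabilization f)) ((1 - fps_X ^ 6) / ((1 - fps_X) * (1 - fps_X ^ 2) * (1 - fps_X ^ 3)))"
proof -
  obtain X Y A B C D where ch: "chart X Y" and hol: "hol_germ A" "hol_germ B" "hol_germ C" "hol_germ D"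
    and A0: "A 0 \<noteq> 0"
    and f: "\<forall>\<^sub>F p in nhds 0. f p = X p ^ 3 * A p + X p ^ 2 * Y p ^ 2 * B p + X p * Y p ^ 4 * C p + Y p ^ 6 * D p"
    using assms unfolding weight6_form_def by blast
  define K where "K j = (if j = 0 then D else if j = 1 then C else if j = 2 then B else A)" for j :: nat
  have "weighted_surface f X Y K 2 3 3"
  proof
    show "hol_germ (K j)" for j using hol by (auto simp: K_def)
    show "\<forall>\<^sub>F p in nhds 0. f p = (\<Sum>j\<le>3. X p ^ j * Y p ^ (2 * 3 - 2 * j) * K j p)"
      using f by eventually_elim (simp add: K_def sum_le_3 algebra_simps)
    show "\<exists>j\<le>3. K j 0 \<noteq> 0" using A0 by (intro exI[of _ 3]) (simp add: K_def)
    fix \<phi> assume \<phi>: "\<phi> \<in> arcs_on (zero_set (stabilization f))"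
    note bc = arc_plane_part[OF \<phi>] note c = chartD[OF ch]
    have an: "(\<lambda>t. g (plane_part (\<phi> t))) analytic_on {0}" if "hol_germ g" for g
      by (rule analytic_compose_hol_germ[OF that bc])
    obtain x where x: "x analytic_on {0}" "\<forall>\<^sub>F t in nhds 0. X (plane_part (\<phi> t)) = t * x t"
      using analytic_divide_ex[OF an[OF c(1)]] bc(2) c(3) by auto
    obtain y where y: "y analytic_on {0}" "\<forall>\<^sub>F t in nhds 0. Y (plane_part (\<phi> t)) = t * y t"
      using analytic_divide_ex[OF an[OF c(2)]] bc(2) c(4) by auto
    obtain z where z: "z analytic_on {0}" "\<forall>\<^sub>F t in nhds 0. \<phi> t $ 3 = t * z t"
      using analytic_divide_ex[OF arcsD(1)[OF \<phi>, of 3]] arcsD(2)[OF \<phi>] by auto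
    \<comment> \<open>\<open>f\<close> along the arc divided by \<open>t^3\<close>; its value at 0
       is \<open>x 0 ^ 3 * A 0\<close>.\<close>
    define L where "L t = x t ^ 3 * A (plane_part (\<phi> t)) + t * (x t ^ 2 * y t ^ 2 * B (plane_part (\<phi> t)))
        + t ^ 2 * (x t * y t ^ 4 * C (plane_part (\<phi> t))) + t ^ 3 * (y t ^ 6 * D (plane_part (\<phi> t)))" for t
    have L: "L analytic_on {0}"
      unfolding L_def by (intro analytic_intros x(1) y(1) an[OF hol(1)] an[OF hol(2)] an[OF hol(3)] an[OF hol(4)])
    have z2: "(\<lambda>t. z t ^ 2) analytic_on {0}" by (intro analytic_intros z(1))
    have "\<forall>\<^sub>F t in nhds 0. (\<lambda>p. f p = X p ^ 3 * A p + X p ^ 2 * Y p ^ 2 * B p + X p * Y p ^ 4 * C p + Y p ^ 6 * D p) (plane_part (\<phi> t))"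
      using curve_tendsto[of "\<lambda>t. plane_part (\<phi> t)", OF bc] f unfolding filterlim_iff by blast
    hence eq: "\<forall>\<^sub>F t in nhds 0. t ^ 2 * z t ^ 2 = t ^ 3 * L t"
      using x(2) y(2) z(2) arcsD(3)[OF \<phi>]
    proof eventually_elim
      case (elim t)
      have "t ^ 2 * z t ^ 2 = f (plane_part (\<phi> t))"
        using elim(4,5) by (simp add: in_zero_set_stabilization power_mult_distrib)
      also have "\<dots> = t ^ 3 * L t" unfolding elim(1-3) L_def by algebra
      finally show ?case .
    qed
    have "vanish (3 + 0) (\<lambda>t. t ^ 3 * L t)"
      by (rule vanish_mult[OF vanish_t_power vanish_bounded[OF analytic_tendsto_nhds[OF L]]])
    hence "vanish (Suc 2) (\<lambda>t. t ^ 2 * z t ^ 2)"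
      using vanish_cong[of 3 "\<lambda>t. t ^ 3 * L t" "\<lambda>t. t ^ 2 * z t ^ 2"] eq by (simp add: eq_commute)
    from vanish_factor[OF this z2] have "z 0 = 0" by simp
    then obtain z' where z': "z' analytic_on {0}" "\<forall>\<^sub>F t in nhds 0. z t = t * z' t"
      using analytic_divide_ex[OF z(1)] by blast
    have "vanish (4 + 0) (\<lambda>t. t ^ 4 * z' t ^ 2)"
      by (rule vanish_mult[OF vanish_t_power vanish_bounded[OF analytic_tendsto_nhds]]) (intro analytic_intros z'(1))
    moreover have "\<forall>\<^sub>F t in nhds 0. t ^ 4 * z' t ^ 2 = t ^ 3 * L t"
      using eq z'(2)
    proof eventually_elim
      case (elim t)
      have "t ^ 4 * z' t ^ 2 = t ^ 2 * z t ^ 2" unfolding elim(2) by algebra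
      thus ?case using elim(1) by simp
    qed
    ultimately have "vanish (Suc 3) (\<lambda>t. t ^ 3 * L t)"
      using vanish_cong[of 4 "\<lambda>t. t ^ 4 * z' t ^ 2"] by simp
    from vanish_factor[OF this L] have "L 0 = 0" by simp
    hence "x 0 = 0" using A0 bc(2) by (simp add: L_def)
    then obtain x' where x': "x' analytic_on {0}" "\<forall>\<^sub>F t in nhds 0. x t = t * x' t"
      using analytic_divide_ex[OF x(1)] by blast
    have "vanish (2 + 0) (\<lambda>t. t ^ 2 * x' t)"
      by (rule vanish_mult[OF vanish_t_power vanish_bounded[OF analytic_tendsto_nhds[OF x'(1)]]])
    moreover have "\<forall>\<^sub>F t in nhds 0. t ^ 2 * x' t = X (plane_part (\<phi> t))"
      using x(2) x'(2) by eventually_elim (simp add: power2_eq_square)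
    ultimately show "vanish 2 (\<lambda>t. X (plane_part (\<phi> t)))" using vanish_cong by fastforce
  qed (use ch in simp_all)
  from weighted_surface.Poincare_series[OF this] show ?thesis by simp
qed

text \<open>
  All weights in the plane are 1, so that the condition on the order of \<open>X\<close> only
  says that arcs start at 0.
\<close>

theorem quadruple_point_series:
  fixes f :: "complex ^ 2 \<Rightarrow> complex"
  assumes "hol_germ f" "f \<in> max_ideal_square" "jet 3 f = (\<lambda>_. 0)" "jet 4 f \<noteq> (\<lambda>_. 0)"
  shows "has_arc_Poincare_series (zero_set (stabilization f)) ((1 - fps_X ^ 4) / ((1 - fps_X) ^ 2 * (1 - fps_X ^ 2)))"
proof -
  have v4: "vanish 4 f" using jet_eq_0_iff[OF assms(1), of 3] assms(3) by simp
  have v5: "\<not> vanish 5 f" using jet_eq_0_iff[OF assms(1), of 4] assms(4) by simp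
  have raise: "\<exists>A'. (\<forall>j. hol_germ (A' j)) \<and> (\<forall>\<^sub>F p in nhds 0. f p = (\<Sum>j\<le>Suc k. p $ 1 ^ j * p $ 2 ^ (Suc k - j) * A' j p))"
    if "\<And>j. hol_germ (A j)" "\<forall>\<^sub>F p in nhds 0. f p = (\<Sum>j\<le>k. p $ 1 ^ j * p $ 2 ^ (k - j) * A j p)" "k < 4" for A k
  proof (rule raise_expansion_degree[OF chart_standard that(1) _ that(2)])
    show "A j 0 = 0" if "j \<le> k" for j
      by (rule leading_coefficients_0[OF \<open>\<And>j. hol_germ (A j)\<close> \<open>\<forall>\<^sub>F p in nhds 0. f p = _ p\<close> vanish_mono[OF v4] that])
        (use \<open>k < 4\<close> in simp)
  qed
  obtain A where A: "\<And>j. hol_germ (A j)" "\<forall>\<^sub>F p in nhds 0. f p = (\<Sum>j\<le>2. p $ 1 ^ j * p $ 2 ^ (2 - j) * A j p)"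
    using max_ideal_square_expansion[OF assms(2)] by blast
  obtain B where B: "\<And>j. hol_germ (B j)" "\<forall>\<^sub>F p in nhds 0. f p = (\<Sum>j\<le>Suc 2. p $ 1 ^ j * p $ 2 ^ (Suc 2 - j) * B j p)"
    using raise[OF A] by auto
  obtain C where C: "\<And>j. hol_germ (C j)"
    "\<forall>\<^sub>F p in nhds 0. f p = (\<Sum>j\<le>Suc (Suc 2). p $ 1 ^ j * p $ 2 ^ (Suc (Suc 2) - j) * C j p)"
    using raise[OF B] by auto
  have C4: "\<forall>\<^sub>F p in nhds 0. f p = (\<Sum>j\<le>4. p $ 1 ^ j * p $ 2 ^ (4 - j) * C j p)"
    using C(2) by (simp only: numeral_eq_Suc pred_numeral_simps Num.BitM.simps)
  have "weighted_surface f (\<lambda>p. p $ 1) (\<lambda>p. p $ 2) C 1 2 4"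
  proof
    show "\<forall>\<^sub>F p in nhds 0. f p = (\<Sum>j\<le>4. p $ 1 ^ j * p $ 2 ^ (2 * 2 - 1 * j) * C j p)" using C4 by simp
    show "\<exists>j\<le>4. C j 0 \<noteq> 0"
    proof (rule ccontr)
      assume "\<not> ?thesis"
      hence "C j 0 = 0" if "j \<le> 4" for j using that by blast
      from raise_expansion_degree[OF chart_standard C(1) this C4] obtain D where D: "\<And>j. hol_germ (D j)"
        "\<forall>\<^sub>F p in nhds 0. f p = (\<Sum>j\<le>Suc 4. p $ 1 ^ j * p $ 2 ^ (Suc 4 - j) * D j p)" by blast
      from chart_vanish[OF chart_standard D(1) D(2)] v5 show False by simp
    qed
    fix \<phi> assume \<phi>: "\<phi> \<in> arcs_on (zero_set (stabilization f))"
    show "vanish 1 (\<lambda>t. plane_part (\<phi> t) $ 1)"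
      by (rule vanish_compose_curve[OF vanish_coord arc_plane_part[OF \<phi>]])
  qed (use C(1) chart_standard in simp_all)
  from weighted_surface.Poincare_series[OF this] show ?thesis by (simp add: power2_eq_square)
qed

section \<open>Points on hypersurfaces\<close>

text \<open>
  The set \<open>E\<close> plays the role of the points of the affine space whose coordinate
  ring is the given ring. A polynomial ring in three variables is an iterated polynomial ring,
  and in this form one adds a variable to all statements about points at once, whatever the
  coefficient ring.
\<close>

definition evaluations :: "(complex \<Rightarrow> 'a::comm_ring_1) \<Rightarrow> ('a \<Rightarrow> complex) set \<Rightarrow> bool" where
  "evaluations \<iota> E \<longleftrightarrow> (\<forall>e\<in>E. (\<forall>x y. e (x + y) = e x + e y \<and> e (x * y) = e x * e y) \<and> e 0 = 0 \<and> (\<forall>c. e (\<iota> c) = c))"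

definition separates_zero :: "('a::comm_ring_1 \<Rightarrow> complex) set \<Rightarrow> bool" where
  "separates_zero E \<longleftrightarrow> (\<forall>s. s \<noteq> 0 \<longrightarrow> (\<exists>e\<in>E. e s \<noteq> 0))"

text \<open>
  The Nullstellensatz for hypersurfaces: on the zero set of a prime element only its multiples
  vanish identically.
\<close>

definition separates_primes :: "('a::comm_ring_1 \<Rightarrow> complex) set \<Rightarrow> bool" where
  "separates_primes E \<longleftrightarrow> (\<forall>\<pi> s. prime_elem \<pi> \<longrightarrow> \<not> \<pi> dvd s \<longrightarrow> (\<exists>e\<in>E. e \<pi> = 0 \<and> e s \<noteq> 0))"

definition poly_evaluations :: "(complex \<Rightarrow> 'a::comm_ring_1) \<Rightarrow> ('a \<Rightarrow> complex) set \<Rightarrow> ('a poly \<Rightarrow> complex) set" where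
  "poly_evaluations \<iota> E = {\<lambda>p. e (poly p (\<iota> c)) |e c. e \<in> E}"

lemma poly_evaluationsI: "e \<in> E \<Longrightarrow> (\<lambda>p. e (poly p (\<iota> c))) \<in> poly_evaluations \<iota> E"
  unfolding poly_evaluations_def by (rule CollectI) (rule exI, rule exI, rule conjI[OF refl])

lemma evaluationsD:
  assumes "evaluations \<iota> E" "e \<in> E"
  shows "e (x + y) = e x + e y" "e (x * y) = e x * e y" "e 0 = 0" "e (\<iota> c) = c"
  using assms by (auto simp: evaluations_def)

lemma evaluations_poly:
  assumes "evaluations \<iota> E"
  shows "evaluations (\<lambda>c. [:\<iota> c:]) (poly_evaluations \<iota> E)"
  using assms by (auto simp: evaluations_def poly_evaluations_def)

text \<open>
  After the evaluation of the coefficients a one-variable polynomial over the complex numbers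
  remains.
\<close>

lemma eval_map_poly:
  assumes "evaluations \<iota> E" "e \<in> E"
  shows "e (poly p (\<iota> c)) = poly (map_poly e p) c"
proof (induction p)
  case 0 thus ?case using evaluationsD[OF assms] by simp
next
  case (pCons a p)
  thus ?case using evaluationsD[OF assms] by (simp add: map_poly_pCons)
qed

text \<open>
  Over the fraction field of the coefficients \<open>\<pi>\<close> and \<open>s\<close> are
  coprime, and \<open>d\<close> is a common denominator in Bezout's identity. To avoid the
  fraction field, a non-zero combination of least degree is taken; by pseudo-division it divides
  multiples of \<open>\<pi>\<close> and of \<open>s\<close> by constants, so that primality of
  \<open>\<pi>\<close> forces its degree to be 0.
\<close>

lemma pseudo_bezout:
  fixes \<pi> s :: "'a::idom_divide poly"
  assumes "prime_elem \<pi>" "\<not> \<pi> dvd s" "degree \<pi> > 0"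
  shows "\<exists>A B d. d \<noteq> 0 \<and> A * \<pi> + B * s = [:d:]"
proof -
  define J where "J = {m. m \<noteq> 0 \<and> (\<exists>A B. m = A * \<pi> + B * s)}"
  have "\<pi> \<in> J"
  proof -
    have "\<pi> = 1 * \<pi> + 0 * s" "\<pi> \<noteq> 0" using assms(1) by (simp_all add: prime_elem_def)
    thus ?thesis unfolding J_def by blast
  qed
  then obtain m where m: "m \<in> J" "\<And>m'. m' \<in> J \<Longrightarrow> degree m \<le> degree m'"
    using exists_least_iff[of "\<lambda>n. \<exists>m\<in>J. degree m = n"] by (metis not_less)
  obtain A B where AB: "m = A * \<pi> + B * s" "m \<noteq> 0" using m(1) by (auto simp: J_def)
  have red: "\<exists>a q. a \<noteq> 0 \<and> smult a (C * \<pi> + D * s) = m * q" for C D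
  proof -
    obtain a q where aq: "a \<noteq> 0" "smult a (C * \<pi> + D * s) = m * q + pseudo_mod (C * \<pi> + D * s) m"
      using pseudo_mod(1)[OF AB(2)] by blast
    have "pseudo_mod (C * \<pi> + D * s) m = 0"
    proof (rule ccontr)
      assume r: "pseudo_mod (C * \<pi> + D * s) m \<noteq> 0"
      hence "degree (pseudo_mod (C * \<pi> + D * s) m) < degree m" using pseudo_mod(2)[OF AB(2)] by blast
      moreover have "pseudo_mod (C * \<pi> + D * s) m = (smult a C - q * A) * \<pi> + (smult a D - q * B) * s"
        using aq(2) unfolding AB(1) by (simp add: algebra_simps smult_add_right)
      hence "pseudo_mod (C * \<pi> + D * s) m \<in> J" using r unfolding J_def by blast
      ultimately show False using m(2) by fastforce
    qed
    thus ?thesis using aq by auto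
  qed
  obtain a q where aq: "a \<noteq> 0" "smult a \<pi> = m * q" using red[of 1 0] by auto
  obtain b q' where bq: "b \<noteq> 0" "smult b s = m * q'" using red[of 0 1] by auto
  have "degree m = 0"
  proof -
    have "\<pi> dvd m * q" by (metis aq(2) dvd_refl dvd_smult)
    hence "\<pi> dvd m \<or> \<pi> dvd q" by (rule prime_elem_dvd_multD[OF assms(1)])
    thus ?thesis
    proof
      assume "\<pi> dvd q"
      then obtain q2 where "q = \<pi> * q2" by (rule dvdE)
      hence "\<pi> * [:a:] = \<pi> * (m * q2)" using aq(2) by (simp add: mult_ac)
      moreover have "\<pi> \<noteq> 0" using assms(1) by (simp add: prime_elem_def)
      ultimately have "[:a:] = m * q2" using mult_left_cancel by blast
      hence "degree (m * q2) = 0" "m * q2 \<noteq> 0" using aq(1) by (metis degree_pCons_0, metis pCons_eq_0_iff)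
      thus ?thesis by (simp add: degree_mult_eq)
    next
      assume "\<pi> dvd m"
      hence "\<pi> dvd [:b:] * s" using bq(2) by (simp add: dvd_mult2)
      from prime_elem_dvd_multD[OF assms(1) this] have "\<pi> dvd [:b:]" using assms(2) by blast
      hence "degree \<pi> \<le> degree [:b:]" using bq(1) by (intro dvd_imp_degree_le) auto
      thus ?thesis using assms(3) by simp
    qed
  qed
  then obtain d where "m = [:d:]" by (rule degree_eq_zeroE)
  thus ?thesis using AB by (metis pCons_eq_0_iff)
qed

lemma separates_zero_poly:
  assumes "evaluations \<iota> E" "separates_zero E"
  shows "separates_zero (poly_evaluations \<iota> E)"
  unfolding separates_zero_def
proof (intro allI impI)
  fix s :: "'a poly" assume "s \<noteq> 0"
  hence "lead_coeff s \<noteq> 0" by simp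
  then obtain e where e: "e \<in> E" "e (lead_coeff s) \<noteq> 0" using assms(2) unfolding separates_zero_def by blast
  have "coeff (map_poly e s) (degree s) \<noteq> 0"
    using e evaluationsD(3)[OF assms(1) e(1)] by (simp add: coeff_map_poly)
  hence "map_poly e s \<noteq> 0" by auto
  then obtain c where "poly (map_poly e s) c \<noteq> 0" using poly_all_0_iff_0 by blast
  hence "e (poly s (\<iota> c)) \<noteq> 0" using eval_map_poly[OF assms(1) e(1)] by simp
  thus "\<exists>e\<in>poly_evaluations \<iota> E. e s \<noteq> 0"
    by (intro bexI[of _ "\<lambda>p. e (poly p (\<iota> c))"] poly_evaluationsI e(1))
qed

text \<open>
  If \<open>\<pi>\<close> involves the new variable, choose a point of the coefficient space
  where neither the constant of the Bezout identity nor the leading coefficient of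
  \<open>\<pi>\<close> vanishes; a root of \<open>\<pi>\<close> over this point is not a root of
  \<open>s\<close>. Otherwise \<open>\<pi>\<close> is a prime of the coefficient ring that does
  not divide some coefficient of \<open>s\<close>.
\<close>

lemma separates_primes_poly:
  fixes \<iota> :: "complex \<Rightarrow> 'a::idom_divide"
  assumes "evaluations \<iota> E" "separates_zero E" "separates_primes E"
  shows "separates_primes (poly_evaluations \<iota> E)"
  unfolding separates_primes_def
proof (intro allI impI)
  fix \<pi> s :: "'a poly" assume p: "prime_elem \<pi>" "\<not> \<pi> dvd s"
  show "\<exists>e\<in>poly_evaluations \<iota> E. e \<pi> = 0 \<and> e s \<noteq> 0"
  proof (cases "degree \<pi> = 0")
    case False
    obtain A B d where d: "d \<noteq> 0" "A * \<pi> + B * s = [:d:]" using pseudo_bezout[OF p] False by auto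
    have "d * lead_coeff \<pi> \<noteq> 0" using d(1) False by auto
    then obtain e where e: "e \<in> E" "e (d * lead_coeff \<pi>) \<noteq> 0" using assms(2) unfolding separates_zero_def by blast
    note ev = evaluationsD[OF assms(1) e(1)]
    have e2: "e d \<noteq> 0" "e (lead_coeff \<pi>) \<noteq> 0" using e(2) by (auto simp: ev)
    have "degree (map_poly e \<pi>) \<noteq> 0"
    proof -
      have "coeff (map_poly e \<pi>) (degree \<pi>) \<noteq> 0" using e2 ev(3) by (simp add: coeff_map_poly)
      hence "degree \<pi> \<le> degree (map_poly e \<pi>)" by (rule le_degree)
      thus ?thesis using False by simp
    qed
    hence "\<not> constant (poly (map_poly e \<pi>))" by (simp add: constant_degree)
    then obtain c where c: "poly (map_poly e \<pi>) c = 0" using fundamental_theorem_of_algebra by blast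
    have z: "e (poly \<pi> (\<iota> c)) = 0" using c eval_map_poly[OF assms(1) e(1)] by simp
    have "e (poly (A * \<pi> + B * s) (\<iota> c)) = e d" unfolding d(2) by simp
    hence "e (poly s (\<iota> c)) \<noteq> 0" using z e2(1) by (auto simp: ev)
    thus ?thesis using z
      by (intro bexI[of _ "\<lambda>p. e (poly p (\<iota> c))"] conjI poly_evaluationsI e(1))
  next
    case True
    then obtain a where a: "\<pi> = [:a:]" by (rule degree_eq_zeroE)
    have "prime_elem a"
      unfolding prime_elem_def
    proof (intro conjI allI impI)
      show "a \<noteq> 0" using p(1) a by (auto simp: prime_elem_def)
      show "\<not> a dvd 1"
      proof
        assume "a dvd 1"
        hence "[:a:] dvd [:1:]" by (simp add: const_poly_dvd_const_poly_iff)
        thus False using p(1) a by (auto simp: prime_elem_def one_pCons)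
      qed
      fix x y assume "a dvd x * y"
      hence "\<pi> dvd [:x * y:]" by (simp add: a const_poly_dvd_const_poly_iff)
      hence "\<pi> dvd [:x:] * [:y:]" by (simp add: mult.commute)
      hence "\<pi> dvd [:x:] \<or> \<pi> dvd [:y:]" by (rule prime_elem_dvd_multD[OF p(1)])
      thus "a dvd x \<or> a dvd y" by (simp add: a const_poly_dvd_const_poly_iff)
    qed
    moreover obtain k where "\<not> a dvd coeff s k" using p(2) by (auto simp: a const_poly_dvd_iff)
    ultimately obtain e where e: "e \<in> E" "e a = 0" "e (coeff s k) \<noteq> 0"
      using assms(3) unfolding separates_primes_def by blast
    have "coeff (map_poly e s) k \<noteq> 0" using e evaluationsD(3)[OF assms(1) e(1)] by (simp add: coeff_map_poly)
    hence "map_poly e s \<noteq> 0" by auto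
    then obtain c where "poly (map_poly e s) c \<noteq> 0" using poly_all_0_iff_0 by blast
    hence "e (poly s (\<iota> c)) \<noteq> 0" using eval_map_poly[OF assms(1) e(1)] by simp
    moreover have "e (poly \<pi> (\<iota> c)) = 0" using e(2) a by simp
    ultimately show ?thesis
      by (intro bexI[of _ "\<lambda>p. e (poly p (\<iota> c))"] conjI poly_evaluationsI e(1))
  qed
qed

lemma evaluation_pderiv:
  fixes \<iota> :: "complex \<Rightarrow> 'a::idom"
  assumes "evaluations \<iota> E" "e \<in> E"
  shows "((\<lambda>c. e (poly p (\<iota> c))) has_field_derivative e (poly (pderiv p) (\<iota> c))) (at c)"
proof (induction p)
  case 0 thus ?case using evaluationsD[OF assms] by simp
next
  case (pCons a p)
  show ?case using pCons.IH evaluationsD[OF assms]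
    by (auto simp: pderiv_pCons intro!: derivative_eq_intros)
qed

text \<open>
  The points of the affine spaces of dimension 0 to 3.
\<close>

definition evals0 :: "(complex \<Rightarrow> complex) set" where "evals0 = {\<lambda>x. x}"
definition "evals1 = poly_evaluations (\<lambda>c. c) evals0"
definition "evals2 = poly_evaluations (\<lambda>c. [:c:]) evals1"
definition "evals3 = poly_evaluations (\<lambda>c. [:[:c:]:]) evals2"

lemma evaluations_evals: "evaluations (\<lambda>c. c) evals0" "evaluations (\<lambda>c. [:c:]) evals1" "evaluations (\<lambda>c. [:[:c:]:]) evals2"
proof -
  show 0: "evaluations (\<lambda>c. c) evals0" by (auto simp: evaluations_def evals0_def)
  show 1: "evaluations (\<lambda>c. [:c:]) evals1" unfolding evals1_def by (rule evaluations_poly[OF 0])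
  show "evaluations (\<lambda>c. [:[:c:]:]) evals2" unfolding evals2_def by (rule evaluations_poly[OF 1])
qed

lemma separates_evals3: "separates_zero evals3" "separates_primes evals3"
proof -
  have z0: "separates_zero evals0" by (auto simp: separates_zero_def evals0_def)
  have p0: "separates_primes evals0"
    unfolding separates_primes_def prime_elem_def by (metis dvd_field_iff)
  have z1: "separates_zero evals1" unfolding evals1_def by (rule separates_zero_poly[OF evaluations_evals(1) z0])
  have p1: "separates_primes evals1" unfolding evals1_def by (rule separates_primes_poly[OF evaluations_evals(1) z0 p0])
  have z2: "separates_zero evals2" unfolding evals2_def by (rule separates_zero_poly[OF evaluations_evals(2) z1])
  have p2: "separates_primes evals2" unfolding evals2_def by (rule separates_primes_poly[OF evaluations_evals(2) z1 p1])
  show z3: "separates_zero evals3" unfolding evals3_def by (rule separates_zero_poly[OF evaluations_evals(3) z2])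
  show "separates_primes evals3" unfolding evals3_def by (rule separates_primes_poly[OF evaluations_evals(3) z2 p2])
qed

definition ev1 :: "complex \<Rightarrow> complex poly \<Rightarrow> complex" where "ev1 z p = poly p z"
definition ev2 :: "complex \<Rightarrow> complex \<Rightarrow> complex poly poly \<Rightarrow> complex" where "ev2 y z p = poly (poly p [:y:]) z"
definition ev3 :: "complex \<Rightarrow> complex \<Rightarrow> complex \<Rightarrow> complex poly poly poly \<Rightarrow> complex" where
  "ev3 x y z p = poly (poly (poly p [:[:x:]:]) [:y:]) z"

lemma eval_poly3_ev3: "eval_poly3 p v = ev3 (v $ 1) (v $ 2) (v $ 3) p"
  by (simp add: eval_poly3_def ev3_def)

lemma evals1_eq: "evals1 = range ev1"
  by (auto simp: evals1_def poly_evaluations_def evals0_def ev1_def[abs_def])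

lemma ev2_ev1: "ev2 y z = (\<lambda>p. ev1 z (poly p [:y:]))"
  by (simp add: ev1_def ev2_def fun_eq_iff)

lemma ev3_ev2: "ev3 x y z = (\<lambda>p. ev2 y z (poly p [:[:x:]:]))"
  by (simp add: ev2_def ev3_def fun_eq_iff)

lemma ev1_in: "ev1 z \<in> evals1" by (simp add: evals1_eq)

lemma ev2_in: "ev2 y z \<in> evals2"
  unfolding evals2_def ev2_ev1 by (rule poly_evaluationsI[OF ev1_in])

lemma evals2_cases: assumes "e \<in> evals2" obtains y z where "e = ev2 y z"
proof -
  obtain e' c where e: "e = (\<lambda>p. e' (poly p [:c:]))" "e' \<in> evals1"
    using assms unfolding evals2_def poly_evaluations_def by (elim CollectE exE conjE)
  then obtain z where "e' = ev1 z" unfolding evals1_eq by (elim rangeE)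
  hence "e = ev2 c z" using e(1) by (simp add: ev2_ev1)
  thus ?thesis by (rule that)
qed

lemma evals3_cases: assumes "e \<in> evals3" obtains x y z where "e = ev3 x y z"
proof -
  obtain e' c where e: "e = (\<lambda>p. e' (poly p [:[:c:]:]))" "e' \<in> evals2"
    using assms unfolding evals3_def poly_evaluations_def by (elim CollectE exE conjE)
  obtain y z where "e' = ev2 y z" using e(2) by (rule evals2_cases)
  hence "e = ev3 c y z" using e(1) by (simp add: ev3_ev2)
  thus ?thesis by (rule that)
qed

lemma ev3_hom: "ev3 x y z (p + q) = ev3 x y z p + ev3 x y z q" "ev3 x y z (p * q) = ev3 x y z p * ev3 x y z q"
  "ev3 x y z 0 = 0"
  by (simp_all add: ev3_def)

lemma hol_at_poly:
  fixes \<iota> :: "complex \<Rightarrow> 'a::comm_ring_1"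
  assumes "\<And>a. hol_at (\<lambda>v. e v a) v" "\<And>v. evaluations \<iota> {e v}" 
  shows "hol_at (\<lambda>v. e v (poly p (\<iota> (v $ i)))) v"
proof (induction p)
  case 0
  have "e v 0 = 0" for v using assms(2) by (auto simp: evaluations_def)
  thus ?case by (simp add: hol_at_const)
next
  case (pCons a p)
  have "e v (poly (pCons a p) (\<iota> (v $ i))) = e v a + v $ i * e v (poly p (\<iota> (v $ i)))" for v
    using assms(2)[of v] by (simp add: evaluations_def)
  thus ?case using hol_at_add[OF assms(1) hol_at_mult[OF hol_at_coord pCons.IH]] by simp
qed

lemma evaluations_subset: "evaluations \<iota> E \<Longrightarrow> e \<in> E \<Longrightarrow> evaluations \<iota> {e}"
  by (simp add: evaluations_def)

lemma hol_at_eval_poly3: "hol_at (eval_poly3 p) v"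
proof -
  have "evaluations (\<lambda>c. [:c:]) {ev1 z}" for z
    by (rule evaluations_subset[OF evaluations_evals(2) ev1_in])
  moreover have "evaluations (\<lambda>c. [:[:c:]:]) {ev2 y z}" for y z
    by (rule evaluations_subset[OF evaluations_evals(3) ev2_in])
  moreover have 1: "hol_at (\<lambda>v. ev1 (v $ 3) a) v" for a and v :: "complex ^ 3"
    using hol_at_poly[of "\<lambda>_ x. x" v "\<lambda>c. c" a 3] by (simp add: ev1_def hol_at_const evaluations_def)
  ultimately have 2: "hol_at (\<lambda>v. ev2 (v $ 2) (v $ 3) a) v" for a and v :: "complex ^ 3"
    using hol_at_poly[of "\<lambda>v. ev1 (v $ 3)" v "\<lambda>c. [:c:]" a 2] by (simp add: ev1_def ev2_def)
  have "evaluations (\<lambda>c. [:[:c:]:]) {ev2 y z}" for y z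
    by (rule evaluations_subset[OF evaluations_evals(3) ev2_in])
  from hol_at_poly[of "\<lambda>v. ev2 (v $ 2) (v $ 3)" v "\<lambda>c. [:[:c:]:]" p 1, OF 2 this]
  show ?thesis by (simp add: ev2_def eval_poly3_def[abs_def])
qed

text \<open>
  Taking the derivative by a variable that occurs in \<open>\<pi>\<close> lowers the degree in
  this variable without giving 0, so the result is not a multiple of \<open>\<pi>\<close>. The
  variables are tried from the outermost one inwards.
\<close>

lemma prime_partial_derivative:
  fixes \<pi> :: "complex poly poly poly"
  assumes "prime_elem \<pi>"
  shows "\<exists>D i. (i = 1 \<or> i = 2 \<or> i = 3) \<and> \<not> \<pi> dvd D \<and> (\<forall>x y z. ((\<lambda>s. ev3 (x + (if i = 1 then s else 0)) (y + (if i = 2 then s else 0))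
     (z + (if i = (3::nat) then s else 0)) \<pi>) has_field_derivative ev3 x y z D) (at 0))"
proof -
  have shift: "((\<lambda>s. f (x + s)) has_field_derivative d) (at 0)" if "(f has_field_derivative d) (at x)" for f d and x :: complex
    using DERIV_shift[of f d 0 x] that by (simp add: add.commute)
  have nd: "\<not> p dvd pderiv p" if "degree p > 0" for p :: "'b::{idom,ring_char_0} poly"
  proof
    assume "p dvd pderiv p"
    moreover have "pderiv p \<noteq> 0" using that by (simp add: pderiv_eq_0_iff)
    ultimately have "degree p \<le> degree (pderiv p)" by (rule dvd_imp_degree_le)
    thus False using that by (simp add: degree_pderiv)
  qed
  show ?thesis
  proof (cases "degree \<pi> > 0")
    case True
    have "((\<lambda>s. ev3 (x + s) y z \<pi>) has_field_derivative ev3 x y z (pderiv \<pi>)) (at 0)" for x y z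
    proof (rule shift)
      from evaluation_pderiv[OF evaluations_evals(3) ev2_in, of y z \<pi> x]
      show "((\<lambda>x. ev3 x y z \<pi>) has_field_derivative ev3 x y z (pderiv \<pi>)) (at x)" by (simp add: ev3_def ev2_def)
    qed
    thus ?thesis using nd[OF True] by (intro exI[of _ "pderiv \<pi>"] exI[of _ 1]) simp
  next
    case False
    then obtain \<pi>1 where p1: "\<pi> = [:\<pi>1:]" using degree_eq_zeroE by blast
    show ?thesis
    proof (cases "degree \<pi>1 > 0")
      case True
      have "((\<lambda>s. ev3 x (y + s) z \<pi>) has_field_derivative ev3 x y z [:pderiv \<pi>1:]) (at 0)" for x y z
      proof (rule shift)
        from evaluation_pderiv[OF evaluations_evals(2) ev1_in, of z \<pi>1 y]
        show "((\<lambda>y. ev3 x y z \<pi>) has_field_derivative ev3 x y z [:pderiv \<pi>1:]) (at y)" by (simp add: ev3_def ev1_def p1)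
      qed
      moreover have "\<not> \<pi> dvd [:pderiv \<pi>1:]" using nd[OF True] by (simp add: p1 const_poly_dvd_const_poly_iff)
      ultimately show ?thesis by (intro exI[of _ "[:pderiv \<pi>1:]"] exI[of _ 2]) simp
    next
      case False
      then obtain \<pi>2 where p2: "\<pi>1 = [:\<pi>2:]" using degree_eq_zeroE by blast
      have d2: "degree \<pi>2 > 0"
      proof (rule ccontr)
        assume "\<not> degree \<pi>2 > 0"
        then obtain c where c: "\<pi>2 = [:c:]" using degree_eq_zeroE by blast
        hence "c \<noteq> 0" using assms p1 p2 by (auto simp: prime_elem_def)
        hence "\<pi> dvd 1" unfolding p1 p2 c by (simp add: is_unit_const_poly_iff dvd_field_iff)
        thus False using assms by (simp add: prime_elem_def)
      qed
      have "((\<lambda>s. ev3 x y (z + s) \<pi>) has_field_derivative ev3 x y z [:[:pderiv \<pi>2:]:]) (at 0)" for x y z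
      proof (rule shift)
        show "((\<lambda>z. ev3 x y z \<pi>) has_field_derivative ev3 x y z [:[:pderiv \<pi>2:]:]) (at z)"
          using poly_DERIV[of \<pi>2 z] by (simp add: ev3_def p1 p2)
      qed
      moreover have "\<not> \<pi> dvd [:[:pderiv \<pi>2:]:]" using nd[OF d2] by (simp add: p1 p2 const_poly_dvd_const_poly_iff)
      ultimately show ?thesis by (intro exI[of _ "[:[:pderiv \<pi>2:]:]"] exI[of _ 3]) simp
    qed
  qed
qed

text \<open>
  Some prime factor \<open>\<pi>\<close> of \<open>p = \<pi> r\<close> does not divide
  \<open>q\<close>, and \<open>\<pi>\<close> divides neither \<open>r\<close>, since
  \<open>p\<close> is squarefree, nor one of its own partial derivatives \<open>D\<close>. At a
  zero of \<open>\<pi>\<close> where \<open>q r D\<close> is not zero, the partial derivative of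
  \<open>p\<close> is \<open>r D \<noteq> 0\<close>.
\<close>

theorem squarefree_smooth_nullstellensatz:
  fixes p q :: "complex poly poly poly"
  assumes "squarefree p" "\<not> p dvd q"
  shows "\<exists>a i d. eval_poly3 p a = 0 \<and> eval_poly3 q a \<noteq> 0 \<and> d \<noteq> 0 \<and>
    ((\<lambda>s. eval_poly3 p (a + s *s axis i 1)) has_field_derivative d) (at 0)"
proof -
  have p0: "p \<noteq> 0" using assms(1) by auto
  obtain \<pi> where \<pi>: "prime \<pi>" "multiplicity \<pi> q < multiplicity \<pi> p"
    using multiplicity_le_imp_dvd[OF p0] assms(2) by (meson not_le)
  have "multiplicity \<pi> p \<le> 1" using assms(1) \<pi>(1) p0 by (simp add: squarefree_factorial_semiring'')
  hence m: "multiplicity \<pi> p = 1" "multiplicity \<pi> q = 0" using \<pi>(2) by auto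
  have q0: "q \<noteq> 0" using assms(2) by auto
  have pe: "prime_elem \<pi>" using \<pi>(1) by simp
  have nq: "\<not> \<pi> dvd q" using m(2) q0 pe by (metis multiplicity_eq_zero_iff prime_elem_def)
  obtain r where r: "p = \<pi> * r" using m(1) by (metis dvdE not_dvd_imp_multiplicity_0 zero_neq_one)
  have nr: "\<not> \<pi> dvd r"
  proof
    assume "\<pi> dvd r"
    hence "\<pi> ^ 2 dvd p" unfolding r power2_eq_square by (intro mult_dvd_mono) auto
    hence "\<pi> dvd 1" using assms(1) by (rule squarefreeD[rotated])
    thus False using pe by (simp add: prime_elem_def)
  qed
  obtain D i where i: "i = 1 \<or> i = 2 \<or> i = 3" and D: "\<not> \<pi> dvd D" "\<And>x y z. ((\<lambda>s. ev3 (x + (if i = 1 then s else 0)) (y + (if i = 2 then s else 0))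
     (z + (if i = (3::nat) then s else 0)) \<pi>) has_field_derivative ev3 x y z D) (at 0)"
    using prime_partial_derivative[OF pe] by blast
  \<comment> \<open>One evaluation has to meet three conditions at once; primality combines them
     into one.\<close>
  have "\<not> \<pi> dvd q * r * D" using nq nr D(1) pe by (simp add: prime_elem_dvd_mult_iff)
  then obtain e where e3: "e \<in> evals3" "e \<pi> = 0" "e (q * r * D) \<noteq> 0"
    using separates_evals3(2) pe unfolding separates_primes_def by blast
  obtain x y z where "e = ev3 x y z" using e3(1) by (rule evals3_cases)
  hence e: "ev3 x y z \<pi> = 0" "ev3 x y z (q * r * D) \<noteq> 0" using e3(2,3) by simp_all
  define a where "a = (vector [x, y, z] :: complex ^ 3)"
  have av: "a $ 1 = x" "a $ 2 = y" "a $ 3 = z" by (simp_all add: a_def)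
  obtain j :: 3 where j: "\<And>s t. eval_poly3 t (a + s *s axis j 1) = ev3 (x + (if i = 1 then s else 0))
      (y + (if i = 2 then s else 0)) (z + (if i = (3::nat) then s else 0)) t"
  proof -
    have "eval_poly3 t (a + s *s axis 1 1) = ev3 (x + s) y z t" "eval_poly3 t (a + s *s axis 2 1) = ev3 x (y + s) z t"
      "eval_poly3 t (a + s *s axis 3 1) = ev3 x y (z + s) t" for s t
      by (simp_all add: eval_poly3_ev3 av axis_def)
    thus ?thesis using i that[of "if i = 1 then 1 else if i = 2 then 2 else 3"] by (elim disjE) auto
  qed
  have d: "((\<lambda>s. ev3 (x + (if i = 1 then s else 0)) (y + (if i = 2 then s else 0)) (z + (if i = (3::nat) then s else 0)) t)
      has_field_derivative deriv (\<lambda>s. eval_poly3 t (a + s *s axis j 1)) 0) (at 0)" for t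
  proof -
    have "(\<lambda>s. eval_poly3 t (a + s *s axis j 1)) field_differentiable (at 0)"
      by (rule slice_differentiable, rule hol_at_eval_poly3)
    thus ?thesis unfolding j[symmetric] by (rule field_differentiable_derivI)
  qed
  have "((\<lambda>s. eval_poly3 p (a + s *s axis j 1)) has_field_derivative ev3 x y z D * ev3 x y z r) (at 0)"
    unfolding j r ev3_hom using DERIV_mult[OF D(2)[of x y z] d[of r]] e(1) by (simp add: mult.commute)
  moreover have "ev3 x y z D * ev3 x y z r \<noteq> 0" "eval_poly3 p a = 0" "eval_poly3 q a \<noteq> 0"
    using e by (simp_all add: eval_poly3_ev3 av r ev3_hom)
  ultimately show ?thesis by blast
qed

section \<open>Homogeneous polynomials in three variables\<close>

text \<open>
  Nested polynomials are a module over their coefficient ring \<open>C[z][y]\<close> only; the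
  scalars from the complex numbers have to be embedded for dimensions to make sense.
\<close>

definition poly_scale :: "complex \<Rightarrow> complex poly poly poly \<Rightarrow> complex poly poly poly" where
  "poly_scale c p = smult [:[:c:]:] p"

interpretation P3: vector_space poly_scale
  by unfold_locales (simp_all add: poly_scale_def smult_add_right smult_add_left[symmetric] one_pCons[symmetric])

definition monomial3 :: "nat \<times> nat \<times> nat \<Rightarrow> complex poly poly poly" where
  "monomial3 m = (case m of (a, b, c) \<Rightarrow> monom (monom (monom 1 c) b) a)"

definition exponents3 :: "nat \<Rightarrow> (nat \<times> nat \<times> nat) set" where
  "exponents3 k = {(a, b, c). a + b + c = k}"

definition homogeneous3 :: "nat \<Rightarrow> complex poly poly poly set" where
  "homogeneous3 k = P3.span (monomial3 ` exponents3 k)"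

lemma finite_exponents3: "finite (exponents3 k)"
  by (rule finite_subset[of _ "{..k} \<times> {..k} \<times> {..k}"]) (auto simp: exponents3_def)

lemma coeff_monomial3: "coeff (coeff (coeff (monomial3 (a, b, c)) i) j) k = (if (a, b, c) = (i, j, k) then 1 else 0)"
  by (auto simp: monomial3_def)

lemma monomial3_mult: "monomial3 (a, b, c) * monomial3 (a', b', c') = monomial3 (a + a', b + b', c + c')"
  by (simp add: monomial3_def mult_monom)

lemma coeff_poly_scale: "coeff (coeff (coeff (poly_scale u p) i) j) k = u * coeff (coeff (coeff p i) j) k"
  by (simp add: poly_scale_def)

lemma coeff3_sum: "coeff (coeff (coeff (\<Sum>m\<in>I. g m) i) j) k = (\<Sum>m\<in>I. coeff (coeff (coeff (g m) i) j) k)"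
  by (simp add: coeff_sum)

lemma monomial3_family_independent:
  assumes "finite I" "(\<Sum>m\<in>I. poly_scale (u m) (monomial3 m)) = 0" "m \<in> I" shows "u m = 0"
proof -
  obtain i j k where m: "m = (i, j, k)" by (cases m) auto
  have "0 = coeff (coeff (coeff (\<Sum>m\<in>I. poly_scale (u m) (monomial3 m)) i) j) k" using assms(2) by simp
  also have "\<dots> = (\<Sum>m'\<in>I. if m' = m then u m' else 0)"
    unfolding coeff3_sum by (rule sum.cong) (auto simp: coeff_poly_scale coeff_monomial3 m split: prod.splits if_splits)
  also have "\<dots> = u m" using assms(1,3) by simp
  finally show ?thesis by simp
qed

lemma independent_image:
  assumes "finite I" "inj_on e I" "\<And>u i. (\<Sum>i\<in>I. poly_scale (u i) (e i)) = 0 \<Longrightarrow> i \<in> I \<Longrightarrow> u i = 0"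
  shows "P3.independent (e ` I)"
proof (rule P3.independent_if_scalars_zero)
  fix f x assume f: "(\<Sum>x\<in>e ` I. poly_scale (f x) x) = 0" "x \<in> e ` I"
  obtain i where i: "i \<in> I" "x = e i" using f(2) by blast
  have "(\<Sum>i\<in>I. poly_scale (f (e i)) (e i)) = 0"
    using f(1) sum.reindex[OF assms(2), of "\<lambda>x. poly_scale (f x) x"] by simp
  from assms(3)[OF this i(1)] i(2) show "f x = 0" by simp
qed (use assms in simp)

lemma inj_monomial3: "inj monomial3"
proof (rule injI)
  fix m m' assume e: "monomial3 m = monomial3 m'"
  obtain i j k where m: "m = (i, j, k)" by (cases m) auto
  obtain a b c where m': "m' = (a, b, c)" by (cases m') auto
  have "coeff (coeff (coeff (monomial3 m') i) j) k = 1" unfolding e[symmetric] m by (simp add: coeff_monomial3)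
  thus "m = m'" by (simp add: m m' coeff_monomial3 split: if_splits)
qed

lemma independent_exponents3: "P3.independent (monomial3 ` exponents3 k)"
  by (rule independent_image[OF finite_exponents3 inj_on_subset[OF inj_monomial3]]) (auto intro: monomial3_family_independent[OF finite_exponents3])

lemma poly_scale_mult: "poly_scale c p * q = poly_scale c (p * q)" "q * poly_scale c p = poly_scale c (q * p)"
  by (simp_all add: poly_scale_def)

lemma independent_mult_exponents3:
  assumes "p \<noteq> 0" shows "P3.independent ((\<lambda>m. p * monomial3 m) ` exponents3 k)" "inj_on (\<lambda>m. p * monomial3 m) (exponents3 k)"
proof -
  show inj: "inj_on (\<lambda>m. p * monomial3 m) (exponents3 k)"
    using assms inj_monomial3 by (auto simp: inj_on_def)
  show "P3.independent ((\<lambda>m. p * monomial3 m) ` exponents3 k)"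
  proof (rule independent_image[OF finite_exponents3 inj])
    fix u m assume u: "(\<Sum>m\<in>exponents3 k. poly_scale (u m) (p * monomial3 m)) = 0" "m \<in> exponents3 k"
    have "p * (\<Sum>m\<in>exponents3 k. poly_scale (u m) (monomial3 m)) = 0"
      using u(1) by (simp add: sum_distrib_left poly_scale_mult)
    hence "(\<Sum>m\<in>exponents3 k. poly_scale (u m) (monomial3 m)) = 0" using assms by simp
    from monomial3_family_independent[OF finite_exponents3 this u(2)] show "u m = 0" .
  qed
qed

lemma homogeneous3_mult_span:
  assumes "q \<in> homogeneous3 k" shows "p * q \<in> P3.span ((\<lambda>m. p * monomial3 m) ` exponents3 k)"
  using assms unfolding homogeneous3_def
proof (induction rule: P3.span_induct_alt)
  case base thus ?case by (simp add: P3.span_zero)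
next
  case (step c x y)
  then obtain m where "x = monomial3 m" "m \<in> exponents3 k" by auto
  hence "p * x \<in> P3.span ((\<lambda>m. p * monomial3 m) ` exponents3 k)" by (auto intro: P3.span_base)
  thus ?case using step.IH by (simp add: distrib_left poly_scale_mult P3.span_add P3.span_scale)
qed

lemma monomial3_in_homogeneous3: "m \<in> exponents3 k \<Longrightarrow> monomial3 m \<in> homogeneous3 k"
  unfolding homogeneous3_def by (rule P3.span_base) simp

lemma homogeneous3_mult: assumes "p \<in> homogeneous3 k" "q \<in> homogeneous3 l" shows "p * q \<in> homogeneous3 (k + l)"
proof -
  have 1: "monomial3 m * q \<in> homogeneous3 (k + l)" if "m \<in> exponents3 k" for m
    using assms(2) unfolding homogeneous3_def[of l]
  proof (induction rule: P3.span_induct_alt)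
    case base thus ?case by (simp add: homogeneous3_def P3.span_zero)
  next
    case (step c x y)
    then obtain m' where m': "x = monomial3 m'" "m' \<in> exponents3 l" by auto
    have "monomial3 m * x \<in> homogeneous3 (k + l)"
      using that m' by (cases m; cases m') (auto simp: monomial3_mult exponents3_def intro!: monomial3_in_homogeneous3)
    thus ?case using step.IH by (simp add: distrib_left poly_scale_mult homogeneous3_def P3.span_add P3.span_scale)
  qed
  show ?thesis using assms(1) unfolding homogeneous3_def[of k]
  proof (induction rule: P3.span_induct_alt)
    case base thus ?case by (simp add: homogeneous3_def P3.span_zero)
  next
    case (step c x y)
    then obtain m where m: "x = monomial3 m" "m \<in> exponents3 k" by auto
    show ?case using step.IH 1[OF m(2)] by (simp add: m distrib_right poly_scale_mult homogeneous3_def P3.span_add P3.span_scale)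
  qed
qed

lemma card_exponents3_0: "card (exponents3 0) = 1"
proof -
  have "exponents3 0 = {(0, 0, 0)}" by (auto simp: exponents3_def)
  thus ?thesis by simp
qed

lemma card_exponents3_Suc: "card (exponents3 (Suc k)) = card (exponents3 k) + (k + 2)"
proof -
  have e: "exponents3 (Suc k) = (\<lambda>(a, b, c). (Suc a, b, c)) ` exponents3 k \<union> (\<lambda>b. (0, b, Suc k - b)) ` {..Suc k}"
  proof (rule set_eqI)
    fix m :: "nat \<times> nat \<times> nat"
    obtain a b c where m: "m = (a, b, c)" by (cases m) auto
    show "m \<in> exponents3 (Suc k) \<longleftrightarrow> m \<in> (\<lambda>(a, b, c). (Suc a, b, c)) ` exponents3 k \<union> (\<lambda>b. (0, b, Suc k - b)) ` {..Suc k}"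
      by (cases a) (auto simp: m exponents3_def image_iff)
  qed
  have "inj_on (\<lambda>(a, b, c). (Suc a, b, c)) (exponents3 k)" "inj_on (\<lambda>b. (0 :: nat, b, Suc k - b)) {..Suc k}"
    by (auto simp: inj_on_def)
  thus ?thesis unfolding e
    by (subst card_Un_disjoint) (auto simp: finite_exponents3 card_image)
qed

text \<open>
  A basis of the degree \<open>k\<close> part of the quotient of the polynomial ring by
  \<open>p\<close>. The products of \<open>p\<close> with the monomials of degree \<open>k -
  d\<close> are independent and extend to a basis of all forms of degree \<open>k\<close>; the
  added elements form \<open>B\<close>. The condition on \<open>R\<close> for \<open>k <
  d\<close> expresses that there are no forms of negative degree.
\<close>

lemma complement_basis:
  fixes p :: "complex poly poly poly"
  assumes "p \<noteq> 0" "p \<in> homogeneous3 d"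
  obtains B where "finite B" "B \<subseteq> homogeneous3 k" "card B = card (exponents3 k) - (if k < d then 0 else card (exponents3 (k - d)))"
    "\<And>u. u \<in> homogeneous3 k \<Longrightarrow> \<exists>c R. u = (\<Sum>b\<in>B. poly_scale (c b) b) + p * R \<and> (if k < d then R = 0 else R \<in> homogeneous3 (k - d))"
    "\<And>c R. (\<Sum>b\<in>B. poly_scale (c b) b) = p * R \<Longrightarrow> (if k < d then R = 0 else R \<in> homogeneous3 (k - d)) \<Longrightarrow> \<forall>b\<in>B. c b = 0"
proof -
  define M' where "M' = (if k < d then {} else exponents3 (k - d))"
  define B1 where "B1 = (\<lambda>m. p * monomial3 m) ` M'"
  have fin: "finite M'" by (simp add: M'_def finite_exponents3)
  have ind1: "P3.independent B1" "inj_on (\<lambda>m. p * monomial3 m) M'"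
    using independent_mult_exponents3[OF assms(1), of "k - d"] by (auto simp: B1_def M'_def P3.independent_empty)
  have sub1: "B1 \<subseteq> homogeneous3 k"
  proof
    fix b assume "b \<in> B1"
    then obtain m where m: "m \<in> M'" "b = p * monomial3 m" by (auto simp: B1_def)
    hence "\<not> k < d" "m \<in> exponents3 (k - d)" by (auto simp: M'_def split: if_splits)
    hence "b \<in> homogeneous3 (d + (k - d))" using m(2) homogeneous3_mult[OF assms(2) monomial3_in_homogeneous3] by blast
    thus "b \<in> homogeneous3 k" using \<open>\<not> k < d\<close> by simp
  qed
  have spanR: "p * R \<in> P3.span B1" if "if k < d then R = 0 else R \<in> homogeneous3 (k - d)" for R
  proof (cases "k < d")
    case True thus ?thesis using that by (simp add: P3.span_zero)
  next
    case False thus ?thesis using that homogeneous3_mult_span[of R "k - d" p] by (simp add: B1_def M'_def)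
  qed
  obtain B2 where B2: "B1 \<subseteq> B2" "B2 \<subseteq> homogeneous3 k" "P3.independent B2" "homogeneous3 k \<subseteq> P3.span B2"
    using P3.maximal_independent_subset_extend[OF sub1 ind1(1)] by blast
  have span2: "P3.span B2 = P3.span (monomial3 ` exponents3 k)"
    using B2(2,4) P3.span_minimal[OF B2(2)] by (auto simp: homogeneous3_def)
  have f2: "finite B2"
    using P3.independent_span_bound[of "monomial3 ` exponents3 k" B2] B2(2,3) finite_exponents3 by (auto simp: homogeneous3_def)
  have c2: "card B2 = card (exponents3 k)"
    using P3.dim_eq_card[OF span2 B2(3)] P3.dim_eq_card[OF refl independent_exponents3[of k]]
      card_image[OF inj_on_subset[OF inj_monomial3 subset_UNIV, of "exponents3 k"]] by simp
  define B where "B = B2 - B1"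
  have f1: "finite B1" using fin by (simp add: B1_def)
  have c1: "card B1 = (if k < d then 0 else card (exponents3 (k - d)))"
    using card_image[OF ind1(2)] by (auto simp: B1_def M'_def)
  have split: "(\<Sum>b\<in>B2. g b) = (\<Sum>b\<in>B. g b) + (\<Sum>b\<in>B1. g b)" for g :: "_ \<Rightarrow> complex poly poly poly"
    unfolding B_def using sum.subset_diff[OF B2(1) f2] by simp
  show ?thesis
  proof (rule that[of B])
    show "finite B" "B \<subseteq> homogeneous3 k" using f2 B2(2) by (auto simp: B_def)
    show "card B = card (exponents3 k) - (if k < d then 0 else card (exponents3 (k - d)))"
      unfolding B_def using card_Diff_subset[OF f1 B2(1)] c1 c2 by simp
  next
    fix u assume "u \<in> homogeneous3 k"
    hence "u \<in> P3.span B2" using B2(4) by blast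
    then obtain c where u: "u = (\<Sum>b\<in>B2. poly_scale (c b) b)" using P3.span_finite[OF f2] by auto
    have "(\<Sum>b\<in>B1. poly_scale (c b) b) = (\<Sum>m\<in>M'. poly_scale (c (p * monomial3 m)) (p * monomial3 m))"
      unfolding B1_def using sum.reindex[OF ind1(2), of "\<lambda>b. poly_scale (c b) b"] by simp
    also have "\<dots> = p * (\<Sum>m\<in>M'. poly_scale (c (p * monomial3 m)) (monomial3 m))"
      by (simp add: sum_distrib_left poly_scale_mult)
    finally have "u = (\<Sum>b\<in>B. poly_scale (c b) b) + p * (\<Sum>m\<in>M'. poly_scale (c (p * monomial3 m)) (monomial3 m))"
      using u split by simp
    moreover have "if k < d then (\<Sum>m\<in>M'. poly_scale (c (p * monomial3 m)) (monomial3 m)) = 0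
       else (\<Sum>m\<in>M'. poly_scale (c (p * monomial3 m)) (monomial3 m)) \<in> homogeneous3 (k - d)"
    proof (cases "k < d")
      case False
      have "(\<Sum>m\<in>exponents3 (k - d). poly_scale (c (p * monomial3 m)) (monomial3 m)) \<in> homogeneous3 (k - d)"
        unfolding homogeneous3_def by (intro P3.span_sum P3.span_scale P3.span_base imageI)
      thus ?thesis using False by (simp add: M'_def)
    qed (simp add: M'_def)
    ultimately show "\<exists>c R. u = (\<Sum>b\<in>B. poly_scale (c b) b) + p * R \<and> (if k < d then R = 0 else R \<in> homogeneous3 (k - d))"
      by blast
  next
    fix c R assume cR: "(\<Sum>b\<in>B. poly_scale (c b) b) = p * R" "if k < d then R = 0 else R \<in> homogeneous3 (k - d)"
    obtain e where e: "p * R = (\<Sum>b\<in>B1. poly_scale (e b) b)"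
      using spanR[OF cR(2)] P3.span_finite[OF f1] by auto
    define u where "u b = (if b \<in> B1 then - e b else c b)" for b
    have "(\<Sum>b\<in>B. poly_scale (u b) b) = (\<Sum>b\<in>B. poly_scale (c b) b)" by (rule sum.cong) (auto simp: u_def B_def)
    moreover have "(\<Sum>b\<in>B1. poly_scale (u b) b) = - (\<Sum>b\<in>B1. poly_scale (e b) b)"
      unfolding sum_negf[symmetric] by (rule sum.cong) (auto simp: u_def P3.scale_minus_left)
    ultimately have "(\<Sum>b\<in>B2. poly_scale (u b) b) = 0" using split[of "\<lambda>b. poly_scale (u b) b"] cR(1) e by simp
    hence "u b = 0" if "b \<in> B2" for b using P3.independentD[OF B2(3) f2 subset_refl] that by blast
    thus "\<forall>b\<in>B. c b = 0" unfolding B_def u_def by fastforce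
  qed
qed

lemma eval_poly3_hom: "eval_poly3 (p + q) v = eval_poly3 p v + eval_poly3 q v"
  "eval_poly3 (p * q) v = eval_poly3 p v * eval_poly3 q v" "eval_poly3 0 v = 0"
  "eval_poly3 (poly_scale c p) v = c * eval_poly3 p v"
  by (simp_all add: eval_poly3_def poly_scale_def)

lemma eval_poly3_sum: "eval_poly3 (\<Sum>i\<in>I. g i) v = (\<Sum>i\<in>I. eval_poly3 (g i) v)"
  by (induction I rule: infinite_finite_induct) (simp_all add: eval_poly3_hom)

lemma eval_poly3_monomial3: "eval_poly3 (monomial3 (a, b, c)) v = (v $ 1) ^ a * (v $ 2) ^ b * (v $ 3) ^ c"
  by (simp add: eval_poly3_def monomial3_def poly_monom)

lemma hol_germ_eval_poly3: "hol_germ (eval_poly3 p)"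
  unfolding hol_germ_iff by (rule always_eventually, rule allI, rule hol_at_eval_poly3)

lemma eval_poly3_inj: assumes "eval_poly3 p = eval_poly3 q" shows "p = q"
proof (rule ccontr)
  assume "p \<noteq> q"
  hence "p - q \<noteq> 0" by simp
  then obtain e where e: "e \<in> evals3" "e (p - q) \<noteq> 0" using separates_evals3(1) unfolding separates_zero_def by blast
  obtain x y z where xyz: "e = ev3 x y z" using e(1) by (rule evals3_cases)
  have "ev3 x y z p = ev3 x y z q" using fun_cong[OF assms, of "vector [x, y, z]"] by (simp add: eval_poly3_ev3)
  moreover have "p = (p - q) + q" by simp
  hence "ev3 x y z p = ev3 x y z (p - q) + ev3 x y z q" by (metis ev3_hom(1))
  ultimately show False using e(2) xyz by simp
qed

lemma hpoly_scale: "hpoly k s \<Longrightarrow> hpoly k (\<lambda>x. c * s x)"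
proof (induction rule: hpoly.induct)
  case (hpoly_const d) show ?case by (rule hpoly.hpoly_const)
next
  case (hpoly_coord k s i)
  from hpoly.hpoly_coord[OF hpoly_coord.IH, of i] show ?case by (simp add: mult_ac)
next
  case (hpoly_add k s t)
  from hpoly.hpoly_add[OF hpoly_add.IH] show ?case by (simp add: distrib_left)
qed

lemma hpoly_coord_power: "hpoly k s \<Longrightarrow> hpoly (n + k) (\<lambda>x. (x $ i) ^ n * s x)"
proof (induction n)
  case (Suc n)
  from hpoly_coord[OF Suc.IH[OF Suc.prems], of i] show ?case by (simp add: mult.assoc)
qed simp

lemma homogeneous3_hpoly: assumes "p \<in> homogeneous3 k" shows "hpoly k (eval_poly3 p)"
  using assms unfolding homogeneous3_def
proof (induction rule: P3.span_induct_alt)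
  case base thus ?case by (simp add: eval_poly3_hom[abs_def] hpoly_0)
next
  case (step c x y)
  then obtain m where "x = monomial3 m" "m \<in> exponents3 k" by auto
  then obtain a b d where m: "x = monomial3 (a, b, d)" "a + b + d = k" by (auto simp: exponents3_def)
  have "hpoly (a + (b + (d + 0))) (\<lambda>v. (v $ 1) ^ a * ((v $ 2) ^ b * ((v $ 3) ^ d * 1)))"
    by (intro hpoly_coord_power hpoly_const)
  hence "hpoly k (eval_poly3 x)" using m by (simp add: eval_poly3_monomial3[abs_def] mult.assoc add.assoc)
  from hpoly_add[OF hpoly_scale[OF this, of c] step.IH] show ?case by (simp add: eval_poly3_hom[abs_def])
qed

lemma hpoly_homogeneous3: fixes s :: "complex ^ 3 \<Rightarrow> complex" assumes "hpoly k s" shows "\<exists>p\<in>homogeneous3 k. s = eval_poly3 p"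
  using assms
proof (induction rule: hpoly.induct)
  case (hpoly_const c)
  have "(0, 0, 0) \<in> exponents3 0" by (simp add: exponents3_def)
  hence "poly_scale c (monomial3 (0, 0, 0)) \<in> homogeneous3 0" using monomial3_in_homogeneous3 by (simp add: homogeneous3_def P3.span_scale)
  moreover have "(\<lambda>_. c) = eval_poly3 (poly_scale c (monomial3 (0, 0, 0)))"
    by (simp add: fun_eq_iff eval_poly3_hom eval_poly3_monomial3)
  ultimately show ?case by blast
next
  case (hpoly_coord k s i)
  then obtain p where p: "p \<in> homogeneous3 k" "s = eval_poly3 p" by blast
  define m where "m = (if i = 1 then (1, 0, 0) else if i = 2 then (0, 1, 0) else (0, 0, 1 :: nat) :: nat \<times> nat \<times> nat)"
  have m: "m \<in> exponents3 1" by (simp add: m_def exponents3_def)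
  have "eval_poly3 (monomial3 m) x = x $ i" for x
    using exhaust_3[of i] by (auto simp: m_def eval_poly3_monomial3)
  hence "(\<lambda>x. x $ i * s x) = eval_poly3 (monomial3 m * p)" by (simp add: fun_eq_iff eval_poly3_hom p(2))
  moreover have "monomial3 m * p \<in> homogeneous3 (Suc k)" using homogeneous3_mult[OF monomial3_in_homogeneous3[OF m] p(1)] by simp
  ultimately show ?case by blast
next
  case (hpoly_add k s t)
  then obtain p q where "p \<in> homogeneous3 k" "s = eval_poly3 p" "q \<in> homogeneous3 k" "t = eval_poly3 q" by blast
  hence "p + q \<in> homogeneous3 k" "(\<lambda>x. s x + t x) = eval_poly3 (p + q)"
    by (simp_all add: homogeneous3_def P3.span_add fun_eq_iff eval_poly3_hom)
  thus ?case by blast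
qed

text \<open>
  The Taylor part of degree \<open>k - d\<close> of \<open>R\<close> serves as the quotient: the
  comparison of both sides along lines leaves only this part.
\<close>

lemma homogeneous_quotient:
  fixes P Q R :: "complex ^ 'n \<Rightarrow> complex"
  assumes "hpoly d P" "hpoly k Q" "hol_germ R" "\<And>x. Q x = P x * R x"
  shows "(k < d \<and> Q = (\<lambda>_. 0)) \<or> (d \<le> k \<and> (\<exists>g. hpoly (k - d) g \<and> Q = (\<lambda>x. P x * g x)))"
proof -
  have h: "t ^ k * Q x = t ^ d * (P x * R (t *s x))" for t x
    using assms(4)[of "t *s x"] hpoly_homogeneous[OF assms(1)] hpoly_homogeneous[OF assms(2)] by simp
  have an: "(\<lambda>t. R (t *s x)) analytic_on {0}" for x by (rule analytic_compose_hol_germ[OF assms(3) line_curve])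
  show ?thesis
  proof (cases "k < d")
    case True
    have "Q x = 0" for x
    proof -
      have "vanish (d + 0) (\<lambda>t. t ^ d * (P x * R (t *s x)))"
        by (rule vanish_mult[OF vanish_t_power vanish_bounded[OF analytic_tendsto_nhds]]) (intro analytic_intros an)
      hence "vanish (Suc k) (\<lambda>t. t ^ k * Q x)" unfolding h using True by (auto intro: vanish_mono)
      from vanish_factor[OF this] show ?thesis by simp
    qed
    thus ?thesis using True by auto
  next
    case False
    define n where "n = k - d"
    obtain g where g: "\<And>j. hpoly j (g j)" "vanish (Suc n) (\<lambda>x. R x - (\<Sum>j\<le>n. g j x))"
      using taylor_expansion[OF assms(3), of n] by blast
    have "Q x = P x * g n x" for x
    proof -
      have v: "vanish (Suc n) (\<lambda>t. R (t *s x) - (\<Sum>j\<le>n. g j x * t ^ j))"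
        using vanish_compose_curve[OF g(2) line_curve, of x]
        by (simp add: hpoly_homogeneous[OF g(1)] mult.commute)
      have e: "P x * R (t *s x) = Q x * t ^ n" if "t \<noteq> 0" for t
      proof -
        have "t ^ d * (P x * R (t *s x)) = t ^ d * (Q x * t ^ n)"
          unfolding h[symmetric] n_def using False by (simp flip: power_add)
        thus ?thesis using that by simp
      qed
      have v2: "vanish (Suc n) (\<lambda>t. P x * (R (t *s x) - (\<Sum>j\<le>n. g j x * t ^ j)))"
        by (rule vanish_mult_left[OF v vanish_const])
      have c: "(\<lambda>t. P x * R (t *s x)) analytic_on {0}" by (intro analytic_intros an)
      have "P x * R (t *s x) = Q x * t ^ n" for t
      proof (cases "t = 0")
        case True
        have "((\<lambda>t. P x * R (t *s x)) \<longlongrightarrow> P x * R (0 *s x)) (at 0)"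
          using analytic_at_imp_isCont[OF c] by (simp add: isCont_def)
        moreover have "((\<lambda>t. Q x * t ^ n) \<longlongrightarrow> Q x * 0 ^ n) (at 0)" by (intro tendsto_intros)
        moreover have "\<forall>\<^sub>F t in at 0. P x * R (t *s x) = Q x * t ^ n"
          unfolding eventually_at_filter by (rule always_eventually) (use e in auto)
        ultimately have "P x * R (0 *s x) = Q x * 0 ^ n"
          by (intro tendsto_unique[OF _ Lim_transform_eventually[of "\<lambda>t. P x * R (t *s x)"]]) simp_all
        thus ?thesis using True by simp
      qed (rule e)
      hence "vanish (Suc n) (\<lambda>t. Q x * t ^ n - (\<Sum>j\<le>n. (P x * g j x) * t ^ j))"
        using v2 by (simp add: right_diff_distrib sum_distrib_left mult.assoc)
      hence "(deriv ^^ n) (\<lambda>t. Q x * t ^ n) 0 / fact n = P x * g n x"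
        by (intro taylor_coefficient_unique[where a = "\<lambda>j. P x * g j x"] analytic_intros) auto
      moreover have "(deriv ^^ n) (\<lambda>t. Q x * t ^ n) 0 / fact n = Q x"
      proof -
        have "(\<Sum>j\<le>n. (if j = n then Q x else 0) * t ^ j) = Q x * t ^ n" for t
        proof -
          have "(\<Sum>j\<le>n. (if j = n then Q x else 0) * t ^ j) = (\<Sum>j\<le>n. if j = n then Q x * t ^ n else 0)"
            by (rule sum.cong) auto
          thus ?thesis by simp
        qed
        hence "vanish (Suc n) (\<lambda>t. Q x * t ^ n - (\<Sum>j\<le>n. (if j = n then Q x else 0) * t ^ j))"
          by (simp add: vanish_0)
        from taylor_coefficient_unique[OF _ this, of n] show ?thesis by (simp add: analytic_intros)
      qed
      ultimately show ?thesis by simp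
    qed
    thus ?thesis using False g(1)[of n] by (auto simp: n_def)
  qed
qed

section \<open>Arcs through smooth points of the tangent cone\<close>

lemma leading_form:
  fixes h :: "complex ^ 'n \<Rightarrow> complex"
  assumes "hol_germ h" "vanish i h"
  shows "\<exists>g. hpoly i g \<and> vanish (Suc i) (\<lambda>x. h x - g x)"
proof -
  obtain g where g: "\<And>j. hpoly j (g j)" "vanish (Suc i) (\<lambda>x. h x - (\<Sum>j\<le>i. g j x))"
    using taylor_expansion[OF assms(1), of i] by blast
  have "(\<Sum>j\<le>i. g j x) = g i x" for x
  proof (cases i)
    case (Suc k)
    have "vanish (Suc k) (\<lambda>x. (h x - (\<Sum>j\<le>i. g j x)) + g i x)"
      by (rule vanish_add[OF vanish_mono[OF g(2)]]) (use hpoly_vanish[OF g(1)[of i]] Suc in auto)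
    hence "vanish (Suc k) (\<lambda>x. h x - (\<Sum>j\<le>k. g j x))" by (simp add: Suc algebra_simps)
    from jet_unique[OF assms(1) g(1) this] have "jet k h = (\<lambda>x. \<Sum>j\<le>k. g j x)" .
    moreover have "jet k h = (\<lambda>_. 0)" using jet_eq_0_iff[OF assms(1), of k] assms(2) Suc by simp
    ultimately have "(\<Sum>j\<le>k. g j x) = 0" by metis
    thus ?thesis by (simp add: Suc)
  qed simp
  thus ?thesis using g by (intro exI[of _ "g i"]) simp
qed

lemma vanish_in_arc_filtration:
  assumes "hol_germ g" "vanish i g" shows "g \<in> arc_filtration V i"
  using assms by (auto simp: arc_filtration_iff intro: vanish_compose_curve arcsD)

text \<open>
  Repeated division. The growth bound shows at each stage that the quotient reached so far
  vanishes on the axis.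
\<close>

lemma divide_second_coordinate_power:
  fixes G :: "complex ^ 2 \<Rightarrow> complex"
  assumes "hol_germ G" "C \<ge> 0" "\<forall>\<^sub>F q in nhds 0. norm (G q) \<le> C * norm (q $ 2) ^ k"
  shows "\<exists>H. hol_germ H \<and> (\<forall>\<^sub>F q in nhds 0. G q = (q $ 2) ^ k * H q)"
  using assms(3)
proof (induction k)
  case 0 thus ?case using assms(1) by (intro exI[of _ G]) simp
next
  case (Suc k)
  have small: "\<forall>\<^sub>F q :: complex ^ 2 in nhds 0. norm (q $ 2) < 1"
    using tendstoD[OF hol_germ_tendsto[OF hol_germ_coord[of 2]], of 1] by simp
  have "\<forall>\<^sub>F q in nhds 0. norm (G q) \<le> C * norm (q $ 2) ^ k"
    using Suc.prems small
  proof eventually_elim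
    case (elim q)
    have "C * norm (q $ 2) ^ Suc k \<le> C * norm (q $ 2) ^ k"
      by (rule mult_left_mono[OF power_decreasing]) (use elim(2) assms(2) in auto)
    thus ?case using elim by linarith
  qed
  from Suc.IH[OF this] obtain H where H: "hol_germ H" "\<forall>\<^sub>F q in nhds 0. G q = (q $ 2) ^ k * H q" by blast
  have "\<forall>\<^sub>F q in nhds 0. norm (G q) \<le> C * norm (q $ 2) ^ Suc k \<and> G q = (q $ 2) ^ k * H q \<and> hol_at H q"
    using Suc.prems H unfolding hol_germ_iff by eventually_elim blast
  then obtain U where U: "open U" "0 \<in> U"
    "\<And>q. q \<in> U \<Longrightarrow> norm (G q) \<le> C * norm (q $ 2) ^ Suc k \<and> G q = (q $ 2) ^ k * H q \<and> hol_at H q"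
    unfolding eventually_nhds by blast
  have "H q = 0" if q: "q \<in> U" "q $ 2 = 0" for q
  proof -
    define w where "w t = H (vector [q $ 1, t])" for t
    have c: "((\<lambda>t. vector [q $ 1, t] :: complex ^ 2) \<longlongrightarrow> vector [q $ 1, 0]) (nhds 0)"
    proof (rule vec_tendstoI)
      fix i :: 2
      show "((\<lambda>t. (vector [q $ 1, t] :: complex ^ 2) $ i) \<longlongrightarrow> (vector [q $ 1, 0] :: complex ^ 2) $ i) (nhds 0)"
        using exhaust_2[of i] by (auto simp: filterlim_ident)
    qed
    have q0: "vector [q $ 1, 0] = q" using q(2) by (intro vec2_eqI) simp_all
    have evU: "\<forall>\<^sub>F t in nhds 0. vector [q $ 1, t] \<in> U"
      using topological_tendstoD[OF c U(1)] q(1) q0 by simp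
    have "w analytic_on {0}" unfolding analytic_at_iff_eventually
      using evU
    proof eventually_elim
      case (elim t)
      show ?case unfolding w_def
      proof (rule field_differentiable_compose_hol_at)
        show "(\<lambda>t. (vector [q $ 1, t] :: complex ^ 2) $ i) field_differentiable at t" for i
          using exhaust_2[of i] by (auto simp: field_differentiable_ident)
      qed (use U(3)[OF elim] in blast)
    qed
    moreover have "vanish (Suc k) (\<lambda>t. t ^ k * w t)"
      unfolding vanish_def
    proof (rule exI[of _ C])
      show "\<forall>\<^sub>F t in nhds 0. norm (t ^ k * w t) \<le> C * norm t ^ Suc k"
        using evU
      proof eventually_elim
        case (elim t)
        have 1: "norm (G (vector [q $ 1, t])) \<le> C * norm t ^ Suc k" and 2: "G (vector [q $ 1, t]) = t ^ k * w t"
          using U(3)[OF elim] unfolding w_def vector_2 by blast+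
        show ?case using 1 unfolding 2 .
      qed
    qed
    ultimately have "w 0 = 0" using vanish_factor by blast
    thus ?thesis by (simp add: w_def q0)
  qed
  hence "\<forall>\<^sub>F q in nhds 0. q $ 2 = 0 \<longrightarrow> H q = 0"
    unfolding eventually_nhds using U(1,2) by blast
  then obtain H' where H': "hol_germ H'" "\<forall>\<^sub>F q in nhds 0. H q = q $ 2 * H' q"
    by (rule chart_division[OF chart_sym[OF chart_standard] H(1)]) blast
  have "\<forall>\<^sub>F q in nhds 0. G q = (q $ 2) ^ Suc k * H' q"
    using H(2) H'(2) by eventually_elim simp
  thus ?case using H'(1) by blast
qed

lemma hpoly_hol_at: "hpoly k s \<Longrightarrow> hol_at s x"
proof (induction rule: hpoly.induct)
  case (hpoly_coord k s i) show ?case by (rule hol_at_mult[OF hol_at_coord hpoly_coord.IH])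
next
  case (hpoly_add k s t) show ?case by (rule hol_at_add[OF hpoly_add.IH])
qed (rule hol_at_const)

text \<open>
  The map \<open>(s, t) \<mapsto> t (a + s e)\<close>, with \<open>e\<close> a coordinate
  vector, is modelled on the blow-up of the origin. Along it \<open>f\<close> is \<open>t^d
  H\<close> with \<open>H(s, 0) = P (a + s e)\<close>, and smoothness of the cone at
  \<open>a\<close> in the direction \<open>e\<close> makes \<open>H = 0\<close> solvable for
  \<open>s\<close>.
\<close>

lemma smooth_cone_point_arc:
  fixes f P :: "complex ^ 'n \<Rightarrow> complex"
  assumes f: "hol_germ f" and P: "hpoly d P" "vanish (Suc d) (\<lambda>x. f x - P x)" and a: "P a = 0"
    and der: "((\<lambda>s. P (a + s *s axis i 1)) has_field_derivative \<delta>) (at 0)" "\<delta> \<noteq> 0"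
  shows "\<exists>\<sigma>. \<sigma> analytic_on {0} \<and> \<sigma> 0 = 0 \<and> (\<lambda>t. t *s (a + \<sigma> t *s axis i 1)) \<in> arcs_on (zero_set f)"
proof -
  define \<Theta> where "\<Theta> q = (q $ 2) *s (a + (q $ 1) *s axis i 1)" for q :: "complex ^ 2"
  have \<Theta>: "hol_map_germ \<Theta>" "\<Theta> 0 = 0"
    unfolding hol_map_germ_def \<Theta>_def by (auto intro!: hol_intros)
  define G where "G q = f (\<Theta> q)" for q
  have G: "hol_germ G" unfolding G_def by (rule hol_germ_compose[OF \<Theta> f])
  have vf: "vanish d f"
    using vanish_add[OF vanish_mono[OF P(2), of d] hpoly_vanish[OF P(1)]] by simp
  obtain c where c: "c \<ge> 0" "\<forall>\<^sub>F x in nhds 0. norm (f x) \<le> c * norm x ^ d" using vf by (rule vanishE)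
  have nc: "norm (u *s x) = norm u * norm x" for u :: complex and x :: "complex ^ 'n"
    by (simp add: norm_vec_def L2_set_def norm_mult power_mult_distrib sum_distrib_left[symmetric] real_sqrt_mult)
  \<comment> \<open>A bound for \<open>a + s e\<close> with \<open>s\<close> in the unit
     disc.\<close>
  define b where "b = norm a + 1"
  have small: "\<forall>\<^sub>F q :: complex ^ 2 in nhds 0. norm (q $ 1) < 1"
    using tendstoD[OF hol_germ_tendsto[OF hol_germ_coord[of 1]], of 1] by simp
  have "\<forall>\<^sub>F q in nhds 0. norm (G q) \<le> (c * b ^ d) * norm (q $ 2) ^ d"
    using eventually_compose[OF \<Theta> c(2)] small
  proof eventually_elim
    case (elim q)
    have "norm (a + (q $ 1) *s axis i 1) \<le> b"
      using norm_triangle_ineq[of a "(q $ 1) *s axis i 1"] elim(2) by (simp add: b_def norm_smult_axis)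
    hence "norm (\<Theta> q) \<le> norm (q $ 2) * b" unfolding \<Theta>_def nc by (intro mult_left_mono) auto
    hence "norm (\<Theta> q) ^ d \<le> (norm (q $ 2) * b) ^ d" by (intro power_mono) auto
    hence "c * norm (\<Theta> q) ^ d \<le> c * (norm (q $ 2) * b) ^ d" using c(1) by (rule mult_left_mono)
    thus ?case using elim(1) by (simp add: G_def power_mult_distrib mult_ac)
  qed
  moreover have "c * b ^ d \<ge> 0" using c(1) by (simp add: b_def)
  ultimately obtain H where H: "hol_germ H" "\<forall>\<^sub>F q in nhds 0. G q = (q $ 2) ^ d * H q"
    using divide_second_coordinate_power[OF G] by blast
  have "\<forall>\<^sub>F q in nhds 0. G q = (q $ 2) ^ d * H q \<and> hol_at H q"
    using H unfolding hol_germ_iff by eventually_elim blast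
  then obtain U where U: "open U" "0 \<in> U" "\<And>q. q \<in> U \<Longrightarrow> G q = (q $ 2) ^ d * H q \<and> hol_at H q"
    unfolding eventually_nhds by blast
  have axis_curve: "(\<lambda>s. (vector [s, 0] :: complex ^ 2) $ i) analytic_on {0}" for i
    using exhaust_2[of i] by (auto intro!: analytic_intros)
  have "((\<lambda>s. vector [s, 0] :: complex ^ 2) \<longlongrightarrow> 0) (nhds 0)"
    by (rule curve_tendsto[OF axis_curve]) (simp add: zero_vec2)
  hence "\<forall>\<^sub>F s in nhds 0. vector [s, 0] \<in> U" using topological_tendstoD U(1,2) by blast
  \<comment> \<open>On each line of constant \<open>s\<close> the quotient is determined by the
     coefficient of \<open>t^d\<close>.\<close>
  hence HP: "\<forall>\<^sub>F s in nhds 0. H (vector [s, 0]) = P (a + s *s axis i 1)"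
  proof eventually_elim
    case (elim s)
    define x where "x = a + s *s axis i 1"
    define w where "w t = H (vector [s, t]) - P x" for t
    have c: "((\<lambda>t. vector [s, t] :: complex ^ 2) \<longlongrightarrow> vector [s, 0]) (nhds 0)"
    proof (rule vec_tendstoI)
      fix i :: 2
      show "((\<lambda>t. (vector [s, t] :: complex ^ 2) $ i) \<longlongrightarrow> (vector [s, 0] :: complex ^ 2) $ i) (nhds 0)"
        using exhaust_2[of i] by (auto simp: filterlim_ident)
    qed
    have evU: "\<forall>\<^sub>F t in nhds 0. vector [s, t] \<in> U"
      using topological_tendstoD[OF c U(1)] elim by simp
    have "(\<lambda>t. H (vector [s, t])) analytic_on {0}" unfolding analytic_at_iff_eventually
      using evU
    proof eventually_elim
      case (elim t)
      show ?case
      proof (rule field_differentiable_compose_hol_at)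
        show "(\<lambda>t. (vector [s, t] :: complex ^ 2) $ i) field_differentiable at t" for i
          using exhaust_2[of i] by (auto simp: field_differentiable_ident)
      qed (use U(3)[OF elim] in blast)
    qed
    hence w: "w analytic_on {0}" unfolding w_def by (intro analytic_intros)
    have "vanish (Suc d) (\<lambda>t. f (t *s x) - P (t *s x))"
      by (rule vanish_compose_curve[OF P(2) line_curve])
    moreover have "\<forall>\<^sub>F t in nhds 0. f (t *s x) - P (t *s x) = t ^ d * w t"
      using evU
    proof eventually_elim
      case (elim t)
      have "f (t *s x) = t ^ d * H (vector [s, t])" using U(3)[OF elim] by (simp add: G_def \<Theta>_def x_def)
      thus ?case by (simp add: w_def hpoly_homogeneous[OF P(1)] algebra_simps)
    qed
    ultimately have "vanish (Suc d) (\<lambda>t. t ^ d * w t)" by (rule vanish_cong)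
    from vanish_factor[OF this w] show ?case by (simp add: w_def x_def)
  qed
  have "((\<lambda>s. H (vector [s, 0])) has_field_derivative \<delta>) (at 0)"
    using der(1) by (rule DERIV_cong_ev[OF refl HP refl, THEN iffD2])
  moreover have "H 0 = 0" using eventually_nhds_x_imp_x[OF HP] a by (simp add: zero_vec2)
  ultimately obtain \<sigma> where s: "\<sigma> analytic_on {0}" "\<sigma> 0 = 0" "\<forall>\<^sub>F t in nhds 0. H (vector [\<sigma> t, t]) = 0"
    using implicit_function[OF H(1)] der(2) by blast
  have sc: "(\<lambda>t. (vector [\<sigma> t, t] :: complex ^ 2) $ i) analytic_on {0}" for i
    using exhaust_2[of i] s(1) by (auto intro!: analytic_intros)
  have "((\<lambda>t. vector [\<sigma> t, t] :: complex ^ 2) \<longlongrightarrow> 0) (nhds 0)"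
    by (rule curve_tendsto[OF sc]) (simp add: s(2) zero_vec2)
  hence "\<forall>\<^sub>F t in nhds 0. vector [\<sigma> t, t] \<in> U" using topological_tendstoD U(1,2) by blast
  hence "\<forall>\<^sub>F t in nhds 0. t *s (a + \<sigma> t *s axis i 1) \<in> zero_set f"
    using s(3)
  proof eventually_elim
    case (elim t)
    have "f (\<Theta> (vector [\<sigma> t, t])) = 0" using U(3)[OF elim(1)] elim(2) by (simp add: G_def)
    thus ?case by (simp add: \<Theta>_def zero_set_def)
  qed
  moreover have "(\<lambda>t. (t *s (a + \<sigma> t *s axis i 1)) $ j) analytic_on {0}" for j
    using s(1) by (auto intro!: analytic_intros)
  ultimately show ?thesis using s(1,2) by (auto simp: arcs_on_def)
qed

lemma diff_diff_cancel: "a - (a - b) = b" for a b :: complex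
  by simp

text \<open>
  Along the arc in the direction \<open>a\<close> the coefficient of \<open>t^k\<close> of
  \<open>g\<close> is \<open>Q a\<close>.
\<close>

lemma leading_form_zero_at_smooth_point:
  fixes f P g Q :: "complex ^ 'n \<Rightarrow> complex"
  assumes "hol_germ f" "hpoly d P" "vanish (Suc d) (\<lambda>x. f x - P x)" "P a = 0"
    and "((\<lambda>s. P (a + s *s axis i 1)) has_field_derivative \<delta>) (at 0)" "\<delta> \<noteq> 0"
    and "g \<in> arc_filtration (zero_set f) (Suc k)" "hpoly k Q" "vanish (Suc k) (\<lambda>x. g x - Q x)"
  shows "Q a = 0"
proof -
  obtain \<sigma> where s: "\<sigma> analytic_on {0}" "\<sigma> 0 = 0" "(\<lambda>t. t *s (a + \<sigma> t *s axis i 1)) \<in> arcs_on (zero_set f)"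
    using smooth_cone_point_arc[OF assms(1-6)] by blast
  let ?\<phi> = "\<lambda>t. t *s (a + \<sigma> t *s axis i 1)"
  define w where "w t = Q (a + \<sigma> t *s axis i 1)" for t
  have "vanish (Suc k) (\<lambda>t. g (?\<phi> t))" using assms(7) s(3) by (simp add: arc_filtration_iff)
  moreover have "vanish (Suc k) (\<lambda>t. g (?\<phi> t) - Q (?\<phi> t))"
    by (rule vanish_compose_curve[OF assms(9) arcsD(1,2)[OF s(3)]])
  ultimately have "vanish (Suc k) (\<lambda>t. g (?\<phi> t) - (g (?\<phi> t) - Q (?\<phi> t)))" by (rule vanish_diff)
  moreover have "g (?\<phi> t) - (g (?\<phi> t) - Q (?\<phi> t)) = t ^ k * w t" for t
  proof -
    have "g (?\<phi> t) - (g (?\<phi> t) - Q (?\<phi> t)) = Q (?\<phi> t)" by (rule diff_diff_cancel)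
    also have "\<dots> = t ^ k * w t" unfolding w_def by (rule hpoly_homogeneous[OF assms(8)])
    finally show ?thesis .
  qed
  ultimately have v: "vanish (Suc k) (\<lambda>t. t ^ k * w t)" by (simp only:)
  have "w analytic_on {0}" unfolding analytic_at_iff_eventually
    using s(1)[unfolded analytic_at_iff_eventually]
  proof eventually_elim
    case (elim t)
    show ?case unfolding w_def
    proof (rule field_differentiable_compose_hol_at)
      show "(\<lambda>t. (a + \<sigma> t *s axis i 1) $ j) field_differentiable at t" for j
        using elim by (auto intro!: derivative_intros)
    qed (rule hpoly_hol_at[OF assms(8)])
  qed
  from vanish_factor[OF v this] show ?thesis by (simp add: w_def s(2))
qed

section \<open>Surfaces with a reduced cubic tangent cone\<close>

text \<open>
  The tangent cone \<open>P = 0\<close> is given by a polynomial in order that squarefreeness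
  can be expressed, and at the same time as a homogeneous function, which is what leading forms
  are compared with.
\<close>

locale reduced_cone_surface =
  fixes f :: "complex ^ 3 \<Rightarrow> complex" and p :: "complex poly poly poly"
  assumes f: "hol_germ f" and cone: "hpoly 3 (eval_poly3 p)" and f_p: "vanish 4 (\<lambda>x. f x - eval_poly3 p x)"
    and sqf: "squarefree p"
begin

abbreviation "V \<equiv> zero_set f"
abbreviation "F \<equiv> arc_filtration V"
abbreviation "P \<equiv> eval_poly3 p"

lemma p_nonzero: "p \<noteq> 0" using sqf by auto

lemma p_homogeneous3: "p \<in> homogeneous3 3"
  using hpoly_homogeneous3[OF cone] eval_poly3_inj by blast

lemma multiple_of_f_in_F: "hol_germ q \<Longrightarrow> (\<lambda>x. q x * f x) \<in> F i"
  by (rule arc_filtration_cong[OF arc_filtration_zero]) (auto intro!: hol_intros f simp: zero_set_def)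

text \<open>
  The polynomial quotient of the leading form by \<open>p\<close> is homogeneous because both
  are.
\<close>

lemma leading_form_multiple:
  assumes "g \<in> F (Suc k)" "hpoly k Q" "vanish (Suc k) (\<lambda>x. g x - Q x)"
  shows "(k < 3 \<and> Q = (\<lambda>_. 0)) \<or> (3 \<le> k \<and> (\<exists>r. hpoly (k - 3) r \<and> Q = (\<lambda>x. P x * r x)))"
proof -
  obtain q where q: "Q = eval_poly3 q" using hpoly_homogeneous3[OF assms(2)] by blast
  have "p dvd q"
  proof (rule ccontr)
    assume "\<not> p dvd q"
    from squarefree_smooth_nullstellensatz[OF sqf this] obtain a i \<delta> where
      a: "P a = 0" "eval_poly3 q a \<noteq> 0" "\<delta> \<noteq> 0" "((\<lambda>s. P (a + s *s axis i 1)) has_field_derivative \<delta>) (at 0)"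
      by blast
    have "vanish (Suc 3) (\<lambda>x. f x - P x)" using f_p by simp
    from leading_form_zero_at_smooth_point[OF f cone this a(1,4,3) assms] a(2) q show False by simp
  qed
  then obtain r where "q = p * r" by (rule dvdE)
  hence "Q x = P x * eval_poly3 r x" for x by (simp add: q eval_poly3_hom)
  from homogeneous_quotient[OF cone assms(2) hol_germ_eval_poly3 this] show ?thesis .
qed

lemma multiple_of_cone:
  assumes "hpoly k r" shows "vanish (k + 4) (\<lambda>x. r x * (P x - f x))"
proof (rule vanish_mult[OF hpoly_vanish[OF assms]])
  show "vanish 4 (\<lambda>x. P x - f x)"
    using vanish_mult_left[OF f_p vanish_const[of "-1"]] by simp
qed

text \<open>
  As long as the order of \<open>g\<close> is too small, its leading form is a multiple \<open>P
  r\<close> of the tangent cone and subtracting \<open>r f\<close> raises the order. So on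
  \<open>V\<close> the arc filtration is induced by the order in the ambient space.
\<close>

lemma reduce_order:
  assumes "g \<in> F i" shows "\<exists>q. hol_germ q \<and> vanish i (\<lambda>x. g x - q x * f x)"
  using assms
proof (induction i)
  case 0
  thus ?case by (intro exI[of _ "\<lambda>_. 0"]) (auto intro: hol_intros vanish_hol_germ arc_filtration_hol)
next
  case (Suc i)
  have "g \<in> F i" using Suc.prems by (rule arc_filtration_mono) simp
  from Suc.IH[OF this] obtain q where q: "hol_germ q" "vanish i (\<lambda>x. g x - q x * f x)" by blast
  let ?h = "\<lambda>x. g x - q x * f x"
  have h: "?h \<in> F (Suc i)" by (rule arc_filtration_diff[OF Suc.prems multiple_of_f_in_F[OF q(1)]])
  obtain Q where Q: "hpoly i Q" "vanish (Suc i) (\<lambda>x. ?h x - Q x)"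
    using leading_form[OF arc_filtration_hol[OF h] q(2)] by blast
  from leading_form_multiple[OF h Q] show ?case
  proof (elim disjE conjE exE)
    assume "Q = (\<lambda>_. 0)"
    thus ?thesis using Q(2) q(1) by auto
  next
    fix r assume r: "3 \<le> i" "hpoly (i - 3) r" "Q = (\<lambda>x. P x * r x)"
    have "vanish (Suc i) (\<lambda>x. r x * (P x - f x))" using multiple_of_cone[OF r(2)] r(1) by simp
    from vanish_add[OF Q(2) this] have "vanish (Suc i) (\<lambda>x. g x - (q x + r x) * f x)"
      by (simp add: r(3) algebra_simps)
    moreover have "hol_germ (\<lambda>x. q x + r x)" by (intro hol_intros q hpoly_hol_germ[OF r(2)])
    ultimately show ?thesis by blast
  qed
qed

text \<open>
  Modulo multiples of \<open>f\<close> a germ in \<open>F i\<close> has order \<open>i\<close>,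
  and its leading form matters modulo multiples of the tangent cone only.
\<close>

lemma quotient_dim:
  "quotient_has_dim (F i) (F (i + 1)) (card (exponents3 i) - (if i < 3 then 0 else card (exponents3 (i - 3))))"
proof -
  obtain B where B: "finite B" "B \<subseteq> homogeneous3 i" "card B = card (exponents3 i) - (if i < 3 then 0 else card (exponents3 (i - 3)))"
    "\<And>u. u \<in> homogeneous3 i \<Longrightarrow> \<exists>c R. u = (\<Sum>b\<in>B. poly_scale (c b) b) + p * R \<and> (if i < 3 then R = 0 else R \<in> homogeneous3 (i - 3))"
    "\<And>c R. (\<Sum>b\<in>B. poly_scale (c b) b) = p * R \<Longrightarrow> (if i < 3 then R = 0 else R \<in> homogeneous3 (i - 3)) \<Longrightarrow> \<forall>b\<in>B. c b = 0"
    by (rule complement_basis[OF p_nonzero p_homogeneous3, of i]) blast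
  have ev: "eval_poly3 (\<Sum>b\<in>B. poly_scale (c b) b) x = (\<Sum>b\<in>B. c b * eval_poly3 b x)" for c x
    by (simp add: eval_poly3_sum eval_poly3_hom)
  have sumH: "(\<Sum>b\<in>B. poly_scale (c b) b) \<in> homogeneous3 i" for c
    using B(2) unfolding homogeneous3_def by (intro P3.span_sum P3.span_scale) auto
  show ?thesis
  proof (rule quotient_has_dimI[where I = B and e = eval_poly3])
    fix b assume "b \<in> B"
    hence "hpoly i (eval_poly3 b)" using B(2) homogeneous3_hpoly by blast
    thus "eval_poly3 b \<in> F i" by (intro vanish_in_arc_filtration hpoly_hol_germ hpoly_vanish)
  next
    fix c b assume c: "(\<lambda>x. \<Sum>b\<in>B. c b * eval_poly3 b x) \<in> F (i + 1)" "b \<in> B"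
    let ?u = "\<Sum>b\<in>B. poly_scale (c b) b"
    have e: "eval_poly3 ?u = (\<lambda>x. \<Sum>b\<in>B. c b * eval_poly3 b x)" by (rule ext) (rule ev)
    have "eval_poly3 ?u \<in> F (Suc i)" unfolding e using c(1) by simp
    moreover have "vanish (Suc i) (\<lambda>x. eval_poly3 ?u x - eval_poly3 ?u x)" by (simp add: vanish_0)
    ultimately have "(i < 3 \<and> eval_poly3 ?u = (\<lambda>_. 0)) \<or>
      (3 \<le> i \<and> (\<exists>r. hpoly (i - 3) r \<and> eval_poly3 ?u = (\<lambda>x. P x * r x)))"
      by (rule leading_form_multiple[OF _ homogeneous3_hpoly[OF sumH]])
    then
    have "\<exists>R. ?u = p * R \<and> (if i < 3 then R = 0 else R \<in> homogeneous3 (i - 3))"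
    proof (elim disjE conjE exE)
      assume "i < 3" "eval_poly3 ?u = (\<lambda>_. 0)"
      hence "eval_poly3 ?u = eval_poly3 (p * 0)" by (simp add: fun_eq_iff eval_poly3_hom)
      thus ?thesis using eval_poly3_inj \<open>i < 3\<close> by auto
    next
      fix r assume r: "3 \<le> i" "hpoly (i - 3) r" "eval_poly3 ?u = (\<lambda>x. P x * r x)"
      obtain R where R: "R \<in> homogeneous3 (i - 3)" "r = eval_poly3 R" using hpoly_homogeneous3[OF r(2)] by blast
      have "eval_poly3 ?u = eval_poly3 (p * R)" by (simp add: r(3) R(2) fun_eq_iff eval_poly3_hom)
      thus ?thesis using eval_poly3_inj R(1) r(1) by auto
    qed
    then obtain R where R: "?u = p * R" "if i < 3 then R = 0 else R \<in> homogeneous3 (i - 3)" by (elim exE conjE)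
    from B(5)[OF R] c(2) show "c b = 0" by blast
  next
    fix u assume u: "u \<in> F i"
    obtain q where q: "hol_germ q" "vanish i (\<lambda>x. u x - q x * f x)" using reduce_order[OF u] by blast
    let ?h = "\<lambda>x. u x - q x * f x"
    have hh: "hol_germ ?h" by (intro hol_intros arc_filtration_hol[OF u] q(1) f)
    obtain Q where Q: "hpoly i Q" "vanish (Suc i) (\<lambda>x. ?h x - Q x)" using leading_form[OF hh q(2)] by blast
    obtain Qp where Qp: "Qp \<in> homogeneous3 i" "Q = eval_poly3 Qp" using hpoly_homogeneous3[OF Q(1)] by blast
    obtain c R where cR: "Qp = (\<Sum>b\<in>B. poly_scale (c b) b) + p * R" "if i < 3 then R = 0 else R \<in> homogeneous3 (i - 3)"
      using B(4)[OF Qp(1)] by (elim exE conjE)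
    have Qe: "Q x = (\<Sum>b\<in>B. c b * eval_poly3 b x) + P x * eval_poly3 R x" for x
      by (simp add: Qp(2) cR(1) eval_poly3_hom ev)
    have r: "vanish (Suc i) (\<lambda>x. eval_poly3 R x * (P x - f x))"
    proof (cases "i < 3")
      case True thus ?thesis using cR(2) by (simp add: eval_poly3_hom vanish_0)
    next
      case False
      hence "hpoly (i - 3) (eval_poly3 R)" using cR(2) homogeneous3_hpoly by simp
      from multiple_of_cone[OF this] show ?thesis using False by simp
    qed
    have hR: "hol_germ (eval_poly3 R)" by (rule hol_germ_eval_poly3)
    have 1: "(\<lambda>x. ?h x - Q x) \<in> F (Suc i)"
      by (rule vanish_in_arc_filtration[OF _ Q(2)]) (intro hol_intros hh hpoly_hol_germ[OF Q(1)])
    have 2: "(\<lambda>x. eval_poly3 R x * (P x - f x)) \<in> F (Suc i)"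
      by (rule vanish_in_arc_filtration[OF _ r]) (intro hol_intros hR hol_germ_eval_poly3 f)
    have 3: "(\<lambda>x. (q x + eval_poly3 R x) * f x) \<in> F (Suc i)"
      by (rule multiple_of_f_in_F) (intro hol_intros q(1) hR)
    have "(\<lambda>x. (?h x - Q x + eval_poly3 R x * (P x - f x)) + (q x + eval_poly3 R x) * f x) \<in> F (Suc i)"
      by (rule arc_filtration_add[OF arc_filtration_add[OF 1 2] 3])
    moreover have "(?h x - Q x + eval_poly3 R x * (P x - f x)) + (q x + eval_poly3 R x) * f x =
        u x - (\<Sum>b\<in>B. c b * eval_poly3 b x)" for x
      unfolding Qe by (simp add: algebra_simps)
    ultimately show "\<exists>c. (\<lambda>x. u x - (\<Sum>b\<in>B. c b * eval_poly3 b x)) \<in> F (i + 1)" by auto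
  qed (use B(1,3) in \<open>simp_all add: arc_filtration_zero\<close>)
qed

text \<open>
  The forms in three variables have generating function \<open>1 / (1 - t)^3\<close>, as one
  sees by taking differences of successive coefficients three times; the multiples of the cubic
  have \<open>t^3 / (1 - t)^3\<close>.
\<close>

theorem Poincare_series: "has_arc_Poincare_series V ((1 - fps_X ^ 3) / (1 - fps_X) ^ 3)"
proof -
  define d where "d i = card (exponents3 i) - (if i < 3 then 0 else card (exponents3 (i - 3)))" for i
  define n where "n = Abs_fps (\<lambda>i. real (card (exponents3 i)))"
  define P' where "P' = Abs_fps (\<lambda>i. real (d i))"
  have mono: "card (exponents3 (i - 3)) \<le> card (exponents3 i)" for i
    by (rule lift_Suc_mono_le[of "\<lambda>i. card (exponents3 i)"]) (simp_all add: card_exponents3_Suc)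
  have X: "fps_nth (g * (1 - fps_X)) i = fps_nth g i - (if i = 0 then 0 else fps_nth g (i - 1))" for g :: "real fps" and i
    using fps_X_power_mult_right_nth[of g 1 i] by (simp add: right_diff_distrib)
  have P: "P' = n * (1 - fps_X ^ 3)"
    by (rule fps_ext) (simp add: P'_def n_def d_def right_diff_distrib fps_X_power_mult_right_nth mono of_nat_diff)
  have "n * (1 - fps_X) = Abs_fps (\<lambda>i. real (i + 1))"
  proof (rule fps_ext)
    fix i show "fps_nth (n * (1 - fps_X)) i = fps_nth (Abs_fps (\<lambda>i. real (i + 1))) i"
      by (cases i) (simp_all add: X n_def card_exponents3_0 card_exponents3_Suc)
  qed
  moreover have "Abs_fps (\<lambda>i. real (i + 1)) * (1 - fps_X) = Abs_fps (\<lambda>i. 1)"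
  proof (rule fps_ext)
    fix i show "fps_nth (Abs_fps (\<lambda>i. real (i + 1)) * (1 - fps_X)) i = fps_nth (Abs_fps (\<lambda>i. 1)) i"
      by (cases i) (simp_all add: X)
  qed
  moreover have "Abs_fps (\<lambda>i. 1 :: real) * (1 - fps_X) = 1"
  proof (rule fps_ext)
    fix i show "fps_nth (Abs_fps (\<lambda>i. 1 :: real) * (1 - fps_X)) i = fps_nth 1 i"
      by (cases i) (simp_all add: X)
  qed
  ultimately have n: "n * (1 - fps_X) ^ 3 = 1"
    by (simp only: power3_eq_cube mult.assoc[symmetric])
  have "P' * (1 - fps_X) ^ 3 = (n * (1 - fps_X) ^ 3) * (1 - fps_X ^ 3)" unfolding P by (simp only: mult_ac)
  hence PD: "P' * (1 - fps_X) ^ 3 = 1 - fps_X ^ 3" unfolding n by simp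
  have "(1 - fps_X) ^ 3 \<noteq> (0 :: real fps)"
  proof
    assume z: "(1 - fps_X) ^ 3 = (0 :: real fps)"
    have "n * (1 - fps_X) ^ 3 = 0" unfolding z by (rule mult_zero_right)
    thus False using n by simp
  qed
  hence "(1 - fps_X ^ 3) / (1 - fps_X) ^ 3 = P'"
    unfolding PD[symmetric] by (rule nonzero_mult_div_cancel_right)
  thus ?thesis unfolding has_arc_Poincare_series_def P'_def d_def using quotient_dim
    by (intro exI[of _ "\<lambda>i. card (exponents3 i) - (if i < 3 then 0 else card (exponents3 (i - 3)))"]) simp
qed

end

theorem reduced_cubic_cone_series:
  fixes f :: "complex ^ 3 \<Rightarrow> complex"
  assumes "hol_germ f" "jet 2 f = (\<lambda>_. 0)" "reduced_polynomial3 (jet 3 f)"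
  shows "has_arc_Poincare_series (zero_set f) ((1 - fps_X ^ 3) / (1 - fps_X) ^ 3)"
proof -
  obtain p where p: "jet 3 f = eval_poly3 p" "squarefree p" using assms(3) by (auto simp: reduced_polynomial3_def)
  have v3: "vanish 3 f" using jet_eq_0_iff[OF assms(1), of 2] assms(2) by simp
  obtain g where g: "hpoly 3 g" "vanish (Suc 3) (\<lambda>x. f x - g x)" using leading_form[OF assms(1) v3] by blast
  define G where "G j = (if j = 3 then g else (\<lambda>_. 0))" for j :: nat
  have "hpoly j (G j)" for j using g(1) by (auto simp: G_def hpoly_0)
  moreover have s: "(\<Sum>j\<le>3. G j x) = g x" for x
  proof -
    have "(\<Sum>j\<le>3. G j x) = (\<Sum>j\<le>(3::nat). if j = 3 then g x else 0)" by (rule sum.cong) (auto simp: G_def)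
    thus ?thesis by simp
  qed
  ultimately have "jet 3 f = g" using jet_unique[OF assms(1), of G 3] g(2) by simp
  hence "g = eval_poly3 p" using p(1) by simp
  hence "reduced_cone_surface f p" using assms(1) g p(2) by unfold_locales simp_all
  thus ?thesis by (rule reduced_cone_surface.Poincare_series)
qed

theorem theorem3:
  shows
    "(\<forall>f :: complex ^ 2 \<Rightarrow> complex.
        plane_curve_singularity f \<and> jet 3 f \<noteq> (\<lambda>_. 0) \<and> \<not> simple_germ f \<longrightarrow>
        has_arc_Poincare_series (zero_set (stabilization f))
          ((1 - fps_X ^ 6) / ((1 - fps_X) * (1 - fps_X ^ 2) * (1 - fps_X ^ 3)))) \<and>
     (\<forall>f :: complex ^ 2 \<Rightarrow> complex.
        plane_curve_singularity f \<and> jet 3 f = (\<lambda>_. 0) \<and> jet 4 f \<noteq> (\<lambda>_. 0) \<longrightarrow>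
        has_arc_Poincare_series (zero_set (stabilization f))
          ((1 - fps_X ^ 4) / ((1 - fps_X) ^ 2 * (1 - fps_X ^ 2)))) \<and>
     (\<forall>f :: complex ^ 3 \<Rightarrow> complex.
        hol_germ f \<and> isolated_hypersurface_singularity f \<and>
        jet 2 f = (\<lambda>_. 0) \<and> reduced_polynomial3 (jet 3 f) \<longrightarrow>
        has_arc_Poincare_series (zero_set f)
          ((1 - fps_X ^ 3) / (1 - fps_X) ^ 3))"
  using triple_point_series[OF nonsimple_weight6_form] quadruple_point_series reduced_cubic_cone_series
  by (auto simp: plane_curve_singularity_def)

end
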